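(* Let $n\ge m\ge1$, $1\le k\le n-1$, and $1\le p\le\infty$. The Radon transform $\hat f(\xi,t)$ is finite for almost all $(\xi,t)\in V_{n,n-k}\times\mathfrak M_{n-k,m}$ for every $f\in L^p(\mathfrak M_{n,m})$ if and only if $$1\le p<p_0=\frac{n+m-1}{k+m-1}.$$
   Context: $\mathfrak M_{n,m}$: real $n\times m$ matrices with Lebesgue measure; $x'$ transpose; $V_{n,n-k}=\{\xi\in\mathfrak M_{n,n-k}:\xi'\xi=I_{n-k}\}$ is the Stiefel manifold with its $O(n)$-invariant measure. Radon transform: $\hat f(\xi,t)=\int_{\mathfrak M_{k,m}}f\left(g_\xi\begin{bmatrix}\omega\\ t\end{bmatrix}\right)d\omega$, where $g_\xi\in SO(n)$ is any rotation sending $\begin{bmatrix}0\\ I_{n-k}\end{bmatrix}$ to $\xi$. "Finite" means that the integral converges absolutely. *)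

theory Defs
  imports "HOL-Analysis.Analysis"
begin

text \<open>
  Real \<open>r \<times> c\<close> matrices are elements of \<open>real ^ 'c ^ 'r\<close>. With \<open>k = CARD('k)\<close>,
  \<open>n - k = CARD('l)\<close> and \<open>m = CARD('m)\<close>, the \<open>n\<close> rows are indexed by the sum type
  \<open>'k + 'l\<close>, so that the first \<open>k\<close> rows are those indexed by \<open>Inl\<close> and the last \<open>n - k\<close>
  rows those indexed by \<open>Inr\<close>. Since index types are nonempty, \<open>1 \<le> k \<le> n - 1\<close> and
  \<open>m \<ge> 1\<close> hold automatically, and every such triple arises.
\<close>

definition stack_rows :: "real ^ ('m::finite) ^ ('k::finite) \<Rightarrow> real ^ 'm ^ ('l::finite) \<Rightarrow> real ^ 'm ^ ('k + 'l)" where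
  "stack_rows \<omega> t = (\<chi> i. case i of Inl a \<Rightarrow> \<omega> $ a | Inr b \<Rightarrow> t $ b)"

definition stiefel :: "(real ^ ('c::finite) ^ ('r::finite)) set" where
  "stiefel = {\<xi>. transpose \<xi> ** \<xi> = mat 1}"

text \<open>
  Invariance determines the measure on the Stiefel manifold up to a positive constant factor;
  no normalisation is fixed.
\<close>

definition stiefel_invariant_measure :: "(real ^ ('c::finite) ^ ('r::finite)) measure \<Rightarrow> bool" where
  "stiefel_invariant_measure \<mu> \<longleftrightarrow>
     sets \<mu> = sets (restrict_space borel stiefel) \<and>
     finite_measure \<mu> \<and>
     emeasure \<mu> stiefel \<noteq> 0 \<and>
     (\<forall>\<gamma> :: real ^ 'r ^ 'r. orthogonal_matrix \<gamma> \<longrightarrow> distr \<mu> \<mu> (\<lambda>\<xi>. \<gamma> ** \<xi>) = \<mu>)"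

definition rotation_choice ::
    "(real ^ ('l::finite) ^ ('k::finite + 'l) \<Rightarrow> real ^ ('k + 'l) ^ ('k + 'l)) \<Rightarrow> bool" where
  "rotation_choice g \<longleftrightarrow>
     (\<forall>\<xi> \<in> stiefel. rotation_matrix (g \<xi>) \<and> g \<xi> ** stack_rows (0 :: real ^ 'l ^ 'k) (mat 1) = \<xi>)"

text \<open>
  The value and the absolute convergence of the integral below do not depend on the choice of the
  rotations \<open>g \<xi>\<close>, because two choices differ by a rotation of the variable \<open>\<omega>\<close>. The choice
  is kept as an explicit parameter.
\<close>

definition radon_integrand ::
    "(real ^ ('l::finite) ^ ('k::finite + 'l) \<Rightarrow> real ^ ('k + 'l) ^ ('k + 'l)) \<Rightarrow> (real ^ ('m::finite) ^ ('k + 'l) \<Rightarrow> complex) \<Rightarrow>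
     real ^ 'l ^ ('k + 'l) \<Rightarrow> real ^ 'm ^ 'l \<Rightarrow> real ^ 'm ^ 'k \<Rightarrow> complex" where
  "radon_integrand g f \<xi> t \<omega> = f (g \<xi> ** stack_rows \<omega> t)"

definition radon_transform ::
    "(real ^ ('l::finite) ^ ('k::finite + 'l) \<Rightarrow> real ^ ('k + 'l) ^ ('k + 'l)) \<Rightarrow> (real ^ ('m::finite) ^ ('k + 'l) \<Rightarrow> complex) \<Rightarrow>
     real ^ 'l ^ ('k + 'l) \<Rightarrow> real ^ 'm ^ 'l \<Rightarrow> complex" where
  "radon_transform g f \<xi> t = (LINT \<omega>|lebesgue. radon_integrand g f \<xi> t \<omega>)"

text \<open>
  The Bochner integral defining \<open>radon_transform\<close> is total, so its existence is a
  separate predicate: the integral converges absolutely.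
\<close>

definition radon_finite ::
    "(real ^ ('l::finite) ^ ('k::finite + 'l) \<Rightarrow> real ^ ('k + 'l) ^ ('k + 'l)) \<Rightarrow> (real ^ ('m::finite) ^ ('k + 'l) \<Rightarrow> complex) \<Rightarrow>
     real ^ 'l ^ ('k + 'l) \<Rightarrow> real ^ 'm ^ 'l \<Rightarrow> bool" where
  "radon_finite g f \<xi> t \<longleftrightarrow> integrable lebesgue (radon_integrand g f \<xi> t)"

text \<open>\<open>L\<^sup>p\<close> as a set of functions, not of classes modulo null sets; meant for \<open>1 \<le> p \<le> \<infinity>\<close>.\<close>

definition Lp_space :: "ereal \<Rightarrow> 'a measure \<Rightarrow> ('a \<Rightarrow> complex) set" where
  "Lp_space p M =
     {f \<in> borel_measurable M.
        if p = \<infinity> then \<exists>C. AE x in M. norm (f x) \<le> C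
        else integrable M (\<lambda>x. norm (f x) powr real_of_ereal p)}"

end

theory Submission
  imports Defs
begin

text \<open>
  Sufficiency. By duality, integrating the Radon transform of \<open>f \<ge> 0\<close> against a positive weight \<open>w t\<close>
  gives the integral of \<open>f x * W x\<close>, where \<open>W x\<close> is the average of \<open>w (\<xi>' x)\<close> over the Stiefel manifold.
  For Gaussian \<open>w\<close>, \<open>W\<close> is bounded by a constant times \<open>det (I + x x') powr (- (n - k) / 2)\<close>. Uniqueness of the
  invariant measure is not needed: an \<open>O(n)\<close>-invariant kernel relating a frame \<open>\<xi>\<close> to the matrices
  with nearly the same column span bounds the average over \<open>\<xi>\<close> by a Gaussian integral over all
  \<open>n \<times> (n - k)\<close> matrices. Column by column, \<open>det (I + x x') powr (- \<lambda> / 2)\<close> is seen to be integrable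
  for \<open>\<lambda> > n + m - 1\<close>, so that \<open>W\<close> lies in the dual Lebesgue space when \<open>1 < p < p\<^sub>0\<close>; for \<open>p = 1\<close> it is bounded.

  Necessity. The matrices at bounded distance from rank one occupy volume of order \<open>R ^ (n + m - 1)\<close> in the shell
  \<open>norm x \<approx> R\<close>, and of order \<open>R ^ (k + m - 1)\<close> in its intersections with the planes of integration.
  On this set \<open>norm x powr (- (n + m - 1) / p) / (1 + ln (norm x))\<close> is \<open>p\<close>-integrable for \<open>p > 1\<close>, while its
  integrals over these planes diverge if \<open>p \<ge> p\<^sub>0\<close>; at \<open>p = p\<^sub>0\<close> the logarithm decides.
\<close>

section \<open>Lebesgue measure and linear maps\<close>

text \<open>The exponent p0 comes out of one comparison. The average W is bounded by the power n - k
  of a single Gaussian integral J, and J powr lam is integrable for lam > n + m - 1. Pairing W with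
  f in L^p for p > 1 asks for lam = (n - k) p / (p - 1), and (n - k) p > (n + m - 1) (p - 1)
  rearranges to p (k + m - 1) < n + m - 1. Two measurability obstacles shape the formalisation. The
  rotations \<open>g \<xi>\<close> may depend on \<xi> in a nonmeasurable way, so they have to be
  eliminated before anything is integrated over \<xi>. And f is only Lebesgue measurable, while a
  plane of integration is a null set. Hence f is replaced by a Borel function that is infinite on a
  Borel null set containing all exceptional points; finiteness of its integral over a plane shows
  that the plane meets this set in a null set of the plane. In the comparison of frames with
  matrices the kernel is used at scale 1 / (1 + norm x), so that a large x cannot magnify the error
  of the approximation. A doubling estimate for the volumes involved keeps the constant independent
  of this scale.\<close>

text \<open>Both sides are the double integral of 1_A(x) 1_B(x + y). For fixed y, invariance of
  \<open>M\<close> replaces x by x - y; after another interchange the integral over y sees A through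
  a reflection only. The cross-multiplied form stays meaningful when a factor is zero or
  infinite.\<close>

lemma translation_invariant_measure_unique:
  fixes M :: "'a::euclidean_space measure"
  assumes sf: "sigma_finite_measure M" and sM[measurable_cong]: "sets M = sets borel"
    and inv: "\<And>y A. A \<in> sets borel \<Longrightarrow> emeasure M ((\<lambda>x. x + y) -` A) = emeasure M A"
    and A[measurable]: "A \<in> sets borel" and B[measurable]: "B \<in> sets borel"
  shows "emeasure M A * emeasure lborel B = emeasure M B * emeasure lborel A"
proof -
  interpret M: sigma_finite_measure M by fact
  interpret P: pair_sigma_finite M "lborel :: 'a measure" ..
  have sp: "space M = UNIV"
    using sets_eq_imp_space_eq[OF sM] by simp
  have "emeasure M A * emeasure lborel B = (\<integral>\<^sup>+x. indicator A x * emeasure lborel B \<partial>M)"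
    by (simp add: nn_integral_multc sM)
  also have "\<dots> = (\<integral>\<^sup>+x. \<integral>\<^sup>+y. indicator A x * indicator B (x + y) \<partial>lborel \<partial>M)"
  proof (rule nn_integral_cong)
    fix x :: 'a
    have "(\<integral>\<^sup>+y. indicator B y \<partial>lborel) = (\<integral>\<^sup>+y. indicator B (x + y) \<partial>lborel)"
      by (subst lborel_distr_plus[of x, symmetric]) (simp add: nn_integral_distr del: nn_integral_indicator)
    then show "indicator A x * emeasure lborel B = (\<integral>\<^sup>+y. indicator A x * indicator B (x + y) \<partial>lborel)"
      by (simp add: nn_integral_cmult)
  qed
  also have "\<dots> = (\<integral>\<^sup>+y. \<integral>\<^sup>+x. indicator A x * indicator B (x + y) \<partial>M \<partial>lborel)"
    by (rule P.Fubini'[symmetric]) measurable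
  also have "\<dots> = (\<integral>\<^sup>+y. \<integral>\<^sup>+x. indicator A (x - y) * indicator B x \<partial>M \<partial>lborel)"
  proof (rule nn_integral_cong)
    fix y :: 'a
    have m: "(\<lambda>x. x + y) -` (B \<inter> {x. x - y \<in> A}) = A \<inter> {x. x + y \<in> B}" by auto
    have [measurable]: "{x. x - y \<in> A} \<in> sets borel" "{x. x + y \<in> B} \<in> sets borel"
      by measurable
    have "(\<integral>\<^sup>+x. indicator A x * indicator B (x + y) \<partial>M) = (\<integral>\<^sup>+x. indicator (A \<inter> {x. x + y \<in> B}) x \<partial>M)"
      by (rule nn_integral_cong) (auto split: split_indicator)
    also have "\<dots> = emeasure M (A \<inter> {x. x + y \<in> B})"
      by (rule nn_integral_indicator) (simp add: sM)
    also have "\<dots> = emeasure M (B \<inter> {x. x - y \<in> A})"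
      unfolding m[symmetric] by (rule inv) simp
    also have "\<dots> = (\<integral>\<^sup>+x. indicator (B \<inter> {x. x - y \<in> A}) x \<partial>M)"
      by (rule nn_integral_indicator[symmetric]) (simp add: sM)
    also have "\<dots> = (\<integral>\<^sup>+x. indicator A (x - y) * indicator B x \<partial>M)"
      by (rule nn_integral_cong) (auto split: split_indicator)
    finally show "(\<integral>\<^sup>+x. indicator A x * indicator B (x + y) \<partial>M) = (\<integral>\<^sup>+x. indicator A (x - y) * indicator B x \<partial>M)" .
  qed
  also have "\<dots> = (\<integral>\<^sup>+x. \<integral>\<^sup>+y. indicator A (x - y) * indicator B x \<partial>lborel \<partial>M)"
    by (rule P.Fubini') measurable
  also have "\<dots> = (\<integral>\<^sup>+x. emeasure lborel A * indicator B x \<partial>M)"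
  proof (rule nn_integral_cong)
    fix x :: 'a
    have "(lborel :: 'a measure) = distr lborel borel (\<lambda>y. x - y)"
      using lborel_affine[of "-1" x] by (simp add: density_1)
    then have "(\<integral>\<^sup>+y. indicator A y \<partial>lborel) = (\<integral>\<^sup>+y. indicator A y \<partial>distr lborel borel (\<lambda>y. x - y))"
      by simp
    also have "\<dots> = (\<integral>\<^sup>+y. indicator A (x - y) \<partial>lborel)"
      by (simp add: nn_integral_distr del: nn_integral_indicator)
    finally show "(\<integral>\<^sup>+y. indicator A (x - y) * indicator B x \<partial>lborel) = emeasure lborel A * indicator B x"
      by (simp add: nn_integral_multc)
  qed
  also have "\<dots> = emeasure M B * emeasure lborel A"
    by (subst nn_integral_cmult) (simp_all add: sM mult.commute)
  finally show ?thesis .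
qed

text \<open>The image of \<open>lborel\<close> under \<open>L\<close> is translation invariant,
  because translating by \<open>L z\<close> corresponds to translating by z, and hence is a multiple
  of \<open>lborel\<close>. Source and target may be different types, so the factor is not expressed
  as a determinant.\<close>

lemma linear_bij_nn_integral_lborel:
  fixes L :: "'a::euclidean_space \<Rightarrow> 'b::euclidean_space"
  assumes L: "linear L" and bij: "bij L"
  shows "\<exists>c>0. \<forall>F \<in> borel_measurable borel. (\<integral>\<^sup>+x. F (L x) \<partial>lborel) = ennreal c * (\<integral>\<^sup>+y. F y \<partial>lborel)"
proof -
  have cont: "continuous_on UNIV L"
    using L linear_continuous_on linear_conv_bounded_linear by blast
  have Lm[measurable]: "L \<in> borel_measurable borel"
    by (rule borel_measurable_continuous_onI[OF cont])
  define M where "M = distr lborel borel L"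
  have sM: "sets M = sets borel" by (simp add: M_def)
  have spM: "space M = UNIV" by (simp add: M_def)
  \<comment> \<open>Images of balls exhaust the target and have finite measure under
    \<open>M\<close>; \<open>C 1\<close> is also the test set that determines the factor.\<close>
  define C where "C = (\<lambda>n::nat. L ` cball 0 (real n))"
  have comp: "compact (C n)" for n
    unfolding C_def by (intro compact_continuous_image continuous_on_subset[OF cont]) auto
  then have Cb: "C n \<in> sets borel" for n
    by (auto intro: borel_compact)
  have Mem: "emeasure M A = emeasure lborel (L -` A)" if "A \<in> sets borel" for A
    using that by (simp add: M_def emeasure_distr)
  have MC: "emeasure M (C n) = emeasure lborel (cball (0::'a) (real n))" for n
    using bij by (simp add: Mem Cb) (simp add: C_def inj_vimage_image_eq bij_is_inj)
  have sf: "sigma_finite_measure M"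
  proof
    have "(\<Union>n. C n) = UNIV"
    proof (intro equalityI subsetI)
      fix y :: 'b assume "y \<in> UNIV"
      obtain x where x: "y = L x" using bij by (metis bij_pointE)
      obtain n where "norm x \<le> real n" using real_arch_simple by blast
      then have "y \<in> C n" unfolding C_def x by auto
      then show "y \<in> (\<Union>n. C n)" by blast
    qed auto
    then show "\<exists>A. countable A \<and> A \<subseteq> sets M \<and> \<Union>A = space M \<and> (\<forall>a\<in>A. emeasure M a \<noteq> \<infinity>)"
      by (intro exI[of _ "range C"]) (auto simp: sM Cb MC spM emeasure_cball)
  qed
  have inv: "emeasure M ((\<lambda>x. x + y) -` A) = emeasure M A" if A: "A \<in> sets borel" for y A
  proof -
    obtain z where z: "y = L z" using bij by (metis bij_pointE)
    have "(\<lambda>x. x + y) -` A \<in> sets borel"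
      using measurable_sets_borel[of "\<lambda>x. x + y" borel A] A by simp
    then have "emeasure M ((\<lambda>x. x + y) -` A) = emeasure lborel (L -` (\<lambda>x. x + y) -` A)"
      by (rule Mem)
    also have "L -` (\<lambda>x. x + y) -` A = (\<lambda>x. z + x) -` (L -` A)"
      using linear_add[OF L] by (auto simp: z add.commute)
    also have "emeasure lborel \<dots> = emeasure lborel (L -` A)"
    proof -
      have 1: "L -` A \<in> sets borel" using measurable_sets_borel[OF Lm A] by simp
      have "emeasure lborel (L -` A) = emeasure (distr lborel borel ((+) z)) (L -` A)"
        by (simp add: lborel_distr_plus)
      also have "\<dots> = emeasure lborel ((\<lambda>x. z + x) -` (L -` A))"
        using 1 by (subst emeasure_distr) auto
      finally show ?thesis by simp
    qed
    finally show ?thesis using Mem[OF A] by simp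
  qed
  have key: "emeasure M A * emeasure lborel B = emeasure M B * emeasure lborel A"
    if "A \<in> sets borel" "B \<in> sets borel" for A B
    using translation_invariant_measure_unique[OF sf sM inv that] by simp
  have MCpos: "emeasure M (C 1) \<noteq> 0" "emeasure M (C 1) \<noteq> \<infinity>"
    by (auto simp: MC emeasure_cball unit_ball_vol_pos less_imp_neq ennreal_eq_0_iff not_le)
  have fin: "emeasure lborel (C 1) \<noteq> \<infinity>"
    using emeasure_compact_finite[OF comp[of 1]] by simp
  have pos: "emeasure lborel (C 1) \<noteq> 0"
  proof
    assume "emeasure lborel (C 1) = 0"
    then have "emeasure M (C 1) * emeasure lborel (UNIV::'b set) = 0"
      using key[of UNIV "C 1"] Cb by simp
    then show False using MCpos by (simp add: emeasure_lborel_UNIV)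
  qed
  define c where "c = enn2real (emeasure M (C 1) / emeasure lborel (C 1))"
  have cq: "emeasure M (C 1) / emeasure lborel (C 1) \<noteq> \<infinity>" "emeasure M (C 1) / emeasure lborel (C 1) \<noteq> 0"
    using MCpos fin pos by (auto simp: ennreal_divide_eq_top_iff top_unique)
  then have c: "ennreal c = emeasure M (C 1) / emeasure lborel (C 1)"
    by (simp add: c_def less_top)
  have cpos: "c > 0"
    using cq by (simp add: c_def enn2real_positive_iff less_top zero_less_iff_neq_zero)
  have eq: "M = scale_measure (ennreal c) lborel"
  proof (rule measure_eqI)
    fix A assume "A \<in> sets M"
    then have A: "A \<in> sets borel" by (simp add: sM)
    have "emeasure M A = emeasure M A * emeasure lborel (C 1) / emeasure lborel (C 1)"
      using pos fin by (simp add: ennreal_mult_divide_eq)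
    also have "\<dots> = emeasure M (C 1) * emeasure lborel A / emeasure lborel (C 1)"
      by (simp add: key[OF A Cb])
    also have "\<dots> = ennreal c * emeasure lborel A"
      by (simp add: c ennreal_divide_times ennreal_times_divide mult.commute)
    finally show "emeasure M A = emeasure (scale_measure (ennreal c) lborel) A" by simp
  qed (simp add: M_def)
  show ?thesis
  proof (intro exI[of _ c] conjI ballI cpos)
    fix F :: "'b \<Rightarrow> ennreal" assume F: "F \<in> borel_measurable borel"
    have "(\<integral>\<^sup>+x. F (L x) \<partial>lborel) = (\<integral>\<^sup>+y. F y \<partial>M)"
      unfolding M_def using F by (simp add: nn_integral_distr)
    also have "\<dots> = ennreal c * (\<integral>\<^sup>+y. F y \<partial>lborel)"
      unfolding eq using F by (simp add: nn_integral_scale_measure)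
    finally show "(\<integral>\<^sup>+x. F (L x) \<partial>lborel) = ennreal c * (\<integral>\<^sup>+y. F y \<partial>lborel)" .
  qed
qed

text \<open>Testing the factor of \<open>linear_bij_nn_integral_lborel\<close> on the unit ball,
  whose preimage under \<open>T\<close> is again the unit ball, shows that it is 1.\<close>

lemma linear_isometry_nn_integral_lborel:
  fixes T :: "'a::euclidean_space \<Rightarrow> 'b::euclidean_space"
  assumes T: "linear T" and surj: "surj T" and iso: "\<And>x. norm (T x) = norm x"
    and F: "F \<in> borel_measurable borel"
  shows "(\<integral>\<^sup>+x. F (T x) \<partial>lborel) = (\<integral>\<^sup>+y. F y \<partial>lborel)"
proof -
  have inj: "inj T"
    using linear_injective_0[OF T] iso by (metis norm_eq_zero)
  then obtain c where c: "c > 0" and eq: "\<And>F. F \<in> borel_measurable borel \<Longrightarrow>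
      (\<integral>\<^sup>+x. F (T x) \<partial>lborel) = ennreal c * (\<integral>\<^sup>+y. F y \<partial>lborel)"
    using linear_bij_nn_integral_lborel[OF T] surj by (auto simp: bij_def)
  have dim: "DIM('a) = DIM('b)"
    using dim_image_eq[OF T, of UNIV] inj surj by (simp add: dim_UNIV)
  have "(\<integral>\<^sup>+x. indicator (cball 0 1) (T x) \<partial>lborel) = (\<integral>\<^sup>+x. indicator (cball 0 1) x \<partial>(lborel::'a measure))"
    by (rule nn_integral_cong) (auto simp: iso split: split_indicator)
  also have "\<dots> = ennreal (unit_ball_vol (real DIM('b)))"
    by (simp add: emeasure_cball dim)
  finally have "ennreal (unit_ball_vol (real DIM('b))) = ennreal c * ennreal (unit_ball_vol (real DIM('b)))"
    by (subst (asm) eq) (simp_all add: emeasure_cball borel_measurable_indicator)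
  then have "ennreal (unit_ball_vol (real DIM('b))) = ennreal (c * unit_ball_vol (real DIM('b)))"
    using c by (simp add: ennreal_mult)
  then have "unit_ball_vol (real DIM('b)) = c * unit_ball_vol (real DIM('b))"
    using c unit_ball_vol_pos[of "real DIM('b)"] by (subst (asm) ennreal_inj) auto
  then have "c = 1"
    using unit_ball_vol_pos[of "real DIM('b)", OF of_nat_0_le_iff] by simp
  then show ?thesis using eq[OF F] by simp
qed

text \<open>Used with rows as components, so that the rows of a matrix become independent
  coordinates. The two measures agree on boxes, and boxes determine \<open>lborel\<close>.\<close>

lemma nn_integral_lborel_vec:
  fixes F :: "'a::euclidean_space ^ 'n \<Rightarrow> ennreal"
  assumes F: "F \<in> borel_measurable borel"
  shows "(\<integral>\<^sup>+x. F x \<partial>lborel) = (\<integral>\<^sup>+X. F (\<chi> i. X i) \<partial>(\<Pi>\<^sub>M i\<in>UNIV. lborel))"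
proof -
  interpret product_sigma_finite "\<lambda>_::'n. lborel :: 'a measure" ..
  let ?P = "\<Pi>\<^sub>M i\<in>(UNIV::'n set). (lborel :: 'a measure)"
  have m[measurable]: "vec_lambda \<in> measurable ?P (borel :: ('a^'n) measure)"
  proof (rule borel_measurable_euclidean_space[THEN iffD2], intro ballI)
    fix b :: "'a^'n" assume "b \<in> Basis"
    have "(\<lambda>X::'n\<Rightarrow>'a. vec_lambda X \<bullet> b) = (\<lambda>X. \<Sum>i\<in>UNIV. X i \<bullet> (b $ i))"
      by (simp add: inner_vec_def)
    then show "(\<lambda>X. vec_lambda X \<bullet> b) \<in> borel_measurable ?P" by simp
  qed
  have "lborel = distr ?P borel vec_lambda"
  proof (rule lborel_eqI)
    fix l u :: "'a^'n" assume lu: "\<And>b. b \<in> Basis \<Longrightarrow> l \<bullet> b \<le> u \<bullet> b"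
    have lu': "l $ i \<bullet> b \<le> u $ i \<bullet> b" if "b \<in> Basis" for i b
      using lu[of "axis i b"] that by (simp add: inner_axis axis_in_Basis_iff)
    have box: "vec_lambda -` box l u \<inter> space ?P = (\<Pi>\<^sub>E i\<in>UNIV. box (l $ i) (u $ i))"
      by (auto simp: space_PiM PiE_def Pi_iff extensional_def mem_box Basis_vec_def inner_axis)
    have Bas: "Basis = (\<lambda>(i,b). axis i b :: 'a^'n) ` (UNIV \<times> Basis)"
      by (auto simp: Basis_vec_def)
    have inj: "inj_on (\<lambda>(i,b). axis i b :: 'a^'n) (UNIV \<times> Basis)"
      by (auto simp: inj_on_def axis_eq_axis)
    have "emeasure (distr ?P borel vec_lambda) (box l u) = emeasure ?P (\<Pi>\<^sub>E i\<in>UNIV. box (l $ i) (u $ i))"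
      by (simp add: emeasure_distr box)
    also have "\<dots> = (\<Prod>i\<in>UNIV. \<Prod>b\<in>Basis. (u $ i - l $ i) \<bullet> b)"
      using lu' by (subst emeasure_PiM) (simp_all add: prod_ennreal[symmetric] inner_diff_left prod_nonneg)
    also have "\<dots> = (\<Prod>b\<in>Basis. (u - l) \<bullet> b)"
      unfolding Bas by (subst prod.reindex[OF inj])
        (simp add: prod.cartesian_product inner_axis case_prod_unfold comp_def)
    finally show "emeasure (distr ?P borel vec_lambda) (box l u) = ennreal (\<Prod>b\<in>Basis. (u - l) \<bullet> b)" by simp
  qed simp
  then have "(\<integral>\<^sup>+x. F x \<partial>lborel) = (\<integral>\<^sup>+x. F x \<partial>distr ?P borel vec_lambda)" by simp
  also have "\<dots> = (\<integral>\<^sup>+X. F (\<chi> i. X i) \<partial>?P)"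
    using F by (simp add: nn_integral_distr)
  finally show ?thesis .
qed

lemma borel_measurable_linear:
  fixes L :: "'a::euclidean_space \<Rightarrow> 'b::euclidean_space"
  assumes "linear L"
  shows "L \<in> borel_measurable borel"
  using assms linear_continuous_on linear_conv_bounded_linear borel_measurable_continuous_onI by blast

section \<open>Radial integrals by dyadic shells\<close>

lemma dyadic_shell:
  assumes "1 \<le> (s::real)"
  obtains j :: nat where "2 ^ j \<le> s" "s < 2 ^ Suc j"
proof
  let ?j = "nat \<lfloor>log 2 s\<rfloor>"
  have l: "0 \<le> log 2 s" using assms by simp
  have "real ?j \<le> log 2 s" using l by linarith
  then have "2 powr real ?j \<le> s" using assms by (subst (asm) le_log_iff) auto
  then show "2 ^ ?j \<le> s" by (simp add: powr_realpow)
  have "log 2 s < real (Suc ?j)" using l by linarith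
  then have "s < 2 powr real (Suc ?j)" using assms by (subst (asm) log_less_iff) auto
  then show "s < 2 ^ Suc ?j" by (simp add: powr_realpow del: of_nat_Suc power_Suc)
qed

text \<open>Dyadic shells replace polar coordinates: on each shell \<phi> is at most its value at
  the inner radius, and enlarging the shell to a full ball costs only a constant factor.\<close>

lemma radial_nn_integral_le:
  fixes \<phi> :: "real \<Rightarrow> real"
  assumes mono: "\<And>s t. 1 \<le> s \<Longrightarrow> s \<le> t \<Longrightarrow> \<phi> t \<le> \<phi> s" and pos: "\<And>s. 1 \<le> s \<Longrightarrow> 0 \<le> \<phi> s"
  shows "(\<integral>\<^sup>+r. ennreal (\<phi> (norm r)) * indicator {r. 1 \<le> norm r} r \<partial>(lborel :: 'a::euclidean_space measure))
     \<le> (\<Sum>j. ennreal (\<phi> (2 ^ j) * (unit_ball_vol (real DIM('a)) * (2 ^ Suc j) ^ DIM('a))))"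
proof -
  have "(\<integral>\<^sup>+r. ennreal (\<phi> (norm r)) * indicator {r. 1 \<le> norm r} r \<partial>(lborel :: 'a measure))
     \<le> (\<integral>\<^sup>+r. (\<Sum>j. ennreal (\<phi> (2 ^ j)) * indicator (cball 0 (2 ^ Suc j)) r) \<partial>(lborel :: 'a measure))"
  proof (rule nn_integral_mono)
    fix r :: 'a
    show "ennreal (\<phi> (norm r)) * indicator {r. 1 \<le> norm r} r
      \<le> (\<Sum>j. ennreal (\<phi> (2 ^ j)) * indicator (cball 0 (2 ^ Suc j)) r)"
    proof (cases "1 \<le> norm r")
      case True
      then obtain j :: nat where j: "2 ^ j \<le> norm r" "norm r < 2 ^ Suc j" by (rule dyadic_shell)
      have "ennreal (\<phi> (norm r)) \<le> ennreal (\<phi> (2 ^ j)) * indicator (cball 0 (2 ^ Suc j)) r"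
        using j mono[of "2^j" "norm r"] by (simp add: ennreal_leI)
      also have "\<dots> \<le> (\<Sum>j. ennreal (\<phi> (2 ^ j)) * indicator (cball 0 (2 ^ Suc j)) r)"
        using sum_le_suminf[of "\<lambda>j. ennreal (\<phi> (2 ^ j)) * indicator (cball 0 (2 ^ Suc j)) r" "{j}"]
        by (simp only: sum.insert sum.empty finite.intros empty_iff not_False_eq_True add_0_right) simp
      finally show ?thesis using True by simp
    qed simp
  qed
  also have "\<dots> = (\<Sum>j. \<integral>\<^sup>+r. ennreal (\<phi> (2 ^ j)) * indicator (cball 0 (2 ^ Suc j)) r \<partial>(lborel :: 'a measure))"
    by (rule nn_integral_suminf) (simp add: borel_measurable_indicator borel_measurable_times_ennreal)
  also have "\<dots> = (\<Sum>j. ennreal (\<phi> (2 ^ j) * (unit_ball_vol (real DIM('a)) * (2 ^ Suc j) ^ DIM('a))))"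
    by (intro suminf_cong) (simp add: nn_integral_cmult borel_measurable_indicator emeasure_cball ennreal_mult pos)
  finally show ?thesis .
qed

text \<open>The j-th shell contributes a multiple of the j-th power of 2 powr (DIM('a) - lam), which
  gives a convergent geometric series.\<close>

lemma radial_powr_nn_integral_finite:
  assumes "real DIM('a) < lam"
  shows "(\<integral>\<^sup>+z. ennreal ((1 + norm z) powr (- lam)) \<partial>(lborel :: 'a::euclidean_space measure)) < \<infinity>"
proof -
  let ?n = "DIM('a)" and ?B = "unit_ball_vol (real DIM('a))"
  have lam: "lam > 0" using assms by simp
  have B: "?B \<ge> 0" by simp
  have "(\<integral>\<^sup>+z. ennreal ((1 + norm z) powr (- lam)) \<partial>(lborel :: 'a measure))
     \<le> (\<integral>\<^sup>+z. indicator (cball 0 1) z + ennreal (norm z powr (- lam)) * indicator {z. 1 \<le> norm z} z \<partial>(lborel :: 'a measure))"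
  proof (rule nn_integral_mono)
    fix z :: 'a
    show "ennreal ((1 + norm z) powr (- lam)) \<le> indicator (cball 0 1) z + ennreal (norm z powr (- lam)) * indicator {z. 1 \<le> norm z} z"
    proof (cases "1 \<le> norm z")
      case True
      then have "(1 + norm z) powr (- lam) \<le> norm z powr (- lam)"
        using lam by (intro powr_mono2') auto
      then show ?thesis using True by (simp add: ennreal_leI add_increasing)
    next
      case False
      have "(1 + norm z) powr (- lam) \<le> 1 powr (- lam)"
        using lam by (intro powr_mono2') auto
      then show ?thesis using False by simp
    qed
  qed
  also have "\<dots> = ennreal ?B + (\<integral>\<^sup>+z. ennreal (norm z powr (- lam)) * indicator {z. 1 \<le> norm z} z \<partial>(lborel :: 'a measure))"
    by (subst nn_integral_add) (simp_all add: emeasure_cball borel_measurable_indicator)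
  also have "\<dots> \<le> ennreal ?B + (\<Sum>j. ennreal ((2 ^ j) powr (- lam) * (?B * (2 ^ Suc j) ^ ?n)))"
    using lam by (intro add_left_mono radial_nn_integral_le) (auto intro!: powr_mono2')
  also have "\<dots> = ennreal ?B + (\<Sum>j. ennreal (?B * 2 ^ ?n * (2 powr (real ?n - lam)) ^ j))"
  proof -
    have "(2 ^ j) powr (- lam) * (?B * (2 ^ Suc j) ^ ?n) = ?B * 2 ^ ?n * (2 powr (real ?n - lam)) ^ j" for j
    proof -
      have "((2::real) ^ Suc j) ^ ?n = 2 ^ ?n * (2 powr real j) powr real ?n"
        by (simp add: powr_realpow power_mult_distrib)
      then show ?thesis
        by (simp add: powr_realpow[symmetric] powr_powr powr_add[symmetric] algebra_simps)
    qed
    then show ?thesis by (simp only:)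
  qed
  also have "\<dots> < \<infinity>"
  proof -
    have "2 powr (real ?n - lam) < 1" using assms by (intro powr_less_one) auto
    then have "summable (\<lambda>j. ?B * 2 ^ ?n * (2 powr (real ?n - lam)) ^ j)"
      by (intro summable_mult summable_geometric) simp
    then have "(\<Sum>j. ennreal (?B * 2 ^ ?n * (2 powr (real ?n - lam)) ^ j)) \<noteq> \<infinity>"
      unfolding infinity_ennreal_def using B by (intro ennreal_suminf_neq_top) simp_all
    then show ?thesis by (simp add: less_top)
  qed
  finally show ?thesis .
qed

text \<open>exp (- s^2) is at most exp (1 - s), and exp s is at least ((1 + s) / N) ^ N. With N one
  more than the dimension this leaves an integrable power.\<close>

lemma gaussian_nn_integral_finite:
  "(\<integral>\<^sup>+z. ennreal (exp (- (norm z)\<^sup>2)) \<partial>(lborel :: 'a::euclidean_space measure)) < \<infinity>"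
proof -
  let ?N = "Suc DIM('a)"
  have le: "exp (- (norm z)\<^sup>2) \<le> exp 1 * real ?N ^ ?N * (1 + norm z) powr (- real ?N)" for z :: 'a
  proof -
    let ?s = "norm z"
    have "((1 + ?s) / real ?N) ^ ?N \<le> (1 + ?s / real ?N) ^ ?N"
      by (intro power_mono) (auto simp: field_simps)
    also have "\<dots> \<le> exp ?s"
      by (intro exp_ge_one_plus_x_over_n_power_n) (auto simp: order_trans[OF _ norm_ge_zero])
    finally have 1: "(1 + ?s) ^ ?N / real ?N ^ ?N \<le> exp ?s" by (simp add: power_divide)
    have "2 * ?s \<le> 1 + ?s\<^sup>2" using zero_le_power2[of "?s - 1"] unfolding power2_diff by simp
    then have "?s \<le> 1 + ?s\<^sup>2" using norm_ge_zero[of z] by linarith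
    then have "exp (- ?s\<^sup>2) \<le> exp (1 - ?s)" by simp
    also have "\<dots> = exp 1 / exp ?s" by (simp add: exp_diff)
    also have "\<dots> \<le> exp 1 / ((1 + ?s) ^ ?N / real ?N ^ ?N)"
    proof -
      have n1: "0 < 1 + ?s" using norm_ge_zero[of z] by linarith
      have "0 < (1 + ?s) ^ ?N / real ?N ^ ?N"
        using n1 by (intro divide_pos_pos zero_less_power) auto
      then show ?thesis using 1 by (intro divide_left_mono mult_pos_pos) (use n1 in auto)
    qed
    also have "\<dots> = exp 1 * real ?N ^ ?N * (1 + ?s) powr (- real ?N)"
    proof -
      have "0 < 1 + ?s" using norm_ge_zero[of z] by linarith
      then have "(1 + ?s) powr (- real ?N) = inverse ((1 + ?s) ^ ?N)"
        by (simp only: powr_minus powr_realpow)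
      then show ?thesis by (simp only: divide_inverse inverse_mult_distrib inverse_inverse_eq mult_ac)
    qed
    finally show ?thesis .
  qed
  have "(\<integral>\<^sup>+z. ennreal (exp (- (norm z)\<^sup>2)) \<partial>(lborel :: 'a measure))
      \<le> (\<integral>\<^sup>+z. ennreal (exp 1 * real ?N ^ ?N) * ennreal ((1 + norm z) powr (- real ?N)) \<partial>(lborel :: 'a measure))"
    using le by (intro nn_integral_mono) (simp add: ennreal_mult[symmetric] ennreal_leI del: of_nat_Suc)
  also have "\<dots> = ennreal (exp 1 * real ?N ^ ?N) * (\<integral>\<^sup>+z. ennreal ((1 + norm z) powr (- real ?N)) \<partial>(lborel :: 'a measure))"
    by (rule nn_integral_cmult) measurable
  also have "\<dots> < \<infinity>"
    using radial_powr_nn_integral_finite[of "real ?N", where 'a='a] by (simp add: ennreal_mult_less_top)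
  finally show ?thesis .
qed

text \<open>\<open>M\<close> is the inverse square root of I + z z': it contracts the direction of z
  by s = 1 / sqrt (1 + norm z ^ 2) and fixes the orthogonal complement. It therefore turns the
  quadratic form norm h ^ 2 + (z \<bullet> h) ^ 2 into norm h ^ 2, and its Jacobian is s.\<close>

lemma rank_one_whitening:
  fixes z :: "real ^ 'n"
  obtains M where "linear M" "\<And>x y. M x \<bullet> y = x \<bullet> M y"
    "\<And>F. F \<in> borel_measurable borel \<Longrightarrow>
       (\<integral>\<^sup>+x. F (M x) \<partial>lborel) = ennreal (sqrt (1 + (norm z)\<^sup>2)) * (\<integral>\<^sup>+x. F x \<partial>lborel)"
    "\<And>h. (norm (M h))\<^sup>2 + (z \<bullet> M h)\<^sup>2 = (norm h)\<^sup>2"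
proof -
  \<comment> \<open>Obtaining the unit vector as \<open>f e\<close> with \<open>f\<close>
    orthogonal, instead of dividing z by its norm, covers z = 0 as well.\<close>
  define e where "e = (axis (SOME i. True) 1 :: real ^ 'n)"
  have e: "norm e = 1" "e \<in> Basis" by (auto simp: e_def axis_in_Basis_iff)
  have "norm (norm z *\<^sub>R e) = norm z" by (simp add: e)
  then obtain f where f: "orthogonal_transformation f" and fz: "f (norm z *\<^sub>R e) = z"
    using orthogonal_transformation_exists[of "norm z *\<^sub>R e" z] by metis
  define u where "u = f e"
  have linf: "linear f" using f by (rule orthogonal_transformation_linear)
  have zu: "z = norm z *\<^sub>R u"
    using fz linear_scale[OF linf] by (simp add: u_def)
  have uu: "u \<bullet> u = 1"
    using f e by (simp add: u_def orthogonal_transformation_def norm_eq_1)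
  define s where "s = 1 / sqrt (1 + (norm z)\<^sup>2)"
  have p: "0 < 1 + (norm z)\<^sup>2" by (simp add: add_pos_nonneg)
  have s: "s > 0" using p by (simp add: s_def)
  have s2: "s\<^sup>2 * (1 + (norm z)\<^sup>2) = 1" using p by (simp add: s_def power_divide)
  define M where "M = (\<lambda>h. h + ((s - 1) * (u \<bullet> h)) *\<^sub>R u)"
  \<comment> \<open>\<open>E\<close> is \<open>M\<close> seen in the coordinates given by
    \<open>f\<close>. It is diagonal with respect to \<open>Basis\<close>, so its Jacobian can be
    read off.\<close>
  define E where "E = (\<lambda>h. h + ((s - 1) * (e \<bullet> h)) *\<^sub>R e)"
  have linM: "linear M"
    by (rule linearI) (simp_all add: M_def inner_add_right algebra_simps scaleR_add_left)
  show thesis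
  proof (rule that[OF linM])
    show "M x \<bullet> y = x \<bullet> M y" for x y
      by (simp add: M_def inner_add_left inner_add_right inner_commute)
    show "(norm (M h))\<^sup>2 + (z \<bullet> M h)\<^sup>2 = (norm h)\<^sup>2" for h
    proof -
      have "z \<bullet> M h = norm z * (u \<bullet> M h)" by (subst zu) simp
      also have "u \<bullet> M h = s * (u \<bullet> h)"
        by (simp add: M_def inner_add_right uu algebra_simps)
      finally have 1: "(z \<bullet> M h)\<^sup>2 = (norm z)\<^sup>2 * s\<^sup>2 * (u \<bullet> h)\<^sup>2" by (simp add: power_mult_distrib)
      have 2: "(norm (M h))\<^sup>2 = (norm h)\<^sup>2 + (s\<^sup>2 - 1) * (u \<bullet> h)\<^sup>2"
        unfolding M_def power2_norm_eq_inner
        by (simp add: inner_add_left inner_add_right uu inner_commute algebra_simps power2_eq_square)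
      have "(norm (M h))\<^sup>2 + (z \<bullet> M h)\<^sup>2 = (norm h)\<^sup>2 + (s\<^sup>2 * (1 + (norm z)\<^sup>2) - 1) * (u \<bullet> h)\<^sup>2"
        unfolding 1 2 by (simp add: algebra_simps)
      then show ?thesis by (simp add: s2)
    qed
    fix F :: "real ^ 'n \<Rightarrow> ennreal" assume F[measurable]: "F \<in> borel_measurable borel"
    have [measurable]: "M \<in> borel_measurable borel" "f \<in> borel_measurable borel"
      by (rule borel_measurable_linear, fact)+
    have surjf: "surj f" and isof: "\<And>x. norm (f x) = norm x"
      using f by (auto simp: orthogonal_transformation_surj orthogonal_transformation_norm)
    have Mf: "M (f h) = f (E h)" for h
    proof -
      have "u \<bullet> f h = e \<bullet> h" using f by (simp add: u_def orthogonal_transformation_def)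
      then show ?thesis by (simp add: M_def E_def linear_add[OF linf] linear_scale[OF linf] u_def)
    qed
    define c where "c = (\<lambda>j. if j = e then s else 1)"
    have ET: "(0::real^'n) + (\<Sum>j\<in>Basis. (c j * (h \<bullet> j)) *\<^sub>R j) = E h" for h
    proof -
      have "(\<Sum>j\<in>Basis. (c j * (h \<bullet> j)) *\<^sub>R j) = (\<Sum>j\<in>Basis. (h \<bullet> j) *\<^sub>R j + (if j = e then ((s - 1) * (h \<bullet> e)) *\<^sub>R e else 0))"
        by (rule sum.cong) (auto simp: c_def algebra_simps)
      also have "\<dots> = E h"
        using e euclidean_representation[of h] by (simp add: sum.distrib E_def inner_commute[of e])
      finally show ?thesis by simp
    qed
    have prodc: "(\<Prod>j\<in>Basis. \<bar>c j\<bar>) = s"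
      using e s by (simp add: c_def if_distrib[of abs] prod.delta cong: if_cong)
    have Em[measurable]: "E \<in> borel_measurable borel"
      unfolding E_def by measurable
    have lb: "lborel = density (distr lborel borel E) (\<lambda>_. ennreal s)"
      using lborel_affine_euclidean[where c=c and t=0] s by (simp only: ET prodc) (auto simp: c_def)
    have "(\<integral>\<^sup>+x. F x \<partial>lborel) = (\<integral>\<^sup>+x. F (f x) \<partial>lborel)"
      by (rule linear_isometry_nn_integral_lborel[OF linf surjf isof F, symmetric])
    also have "\<dots> = (\<integral>\<^sup>+x. F (f x) \<partial>density (distr lborel borel E) (\<lambda>_. ennreal s))"
      by (simp add: lb[symmetric])
    also have "\<dots> = ennreal s * (\<integral>\<^sup>+x. F (f (E x)) \<partial>lborel)"
      by (simp add: nn_integral_density nn_integral_cmult nn_integral_distr)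
    also have "(\<integral>\<^sup>+x. F (f (E x)) \<partial>lborel) = (\<integral>\<^sup>+x. F (M x) \<partial>lborel)"
      unfolding Mf[symmetric] by (rule linear_isometry_nn_integral_lborel[OF linf surjf isof]) measurable
    finally have "(\<integral>\<^sup>+x. F x \<partial>lborel) = ennreal s * (\<integral>\<^sup>+x. F (M x) \<partial>lborel)" .
    then have "ennreal (1 / s) * (\<integral>\<^sup>+x. F x \<partial>lborel) = (ennreal (1 / s) * ennreal s) * (\<integral>\<^sup>+x. F (M x) \<partial>lborel)"
      by (simp add: mult.assoc)
    also have "ennreal (1 / s) * ennreal s = 1" using s by (simp add: ennreal_mult[symmetric])
    finally show "(\<integral>\<^sup>+x. F (M x) \<partial>lborel) = ennreal (sqrt (1 + (norm z)\<^sup>2)) * (\<integral>\<^sup>+x. F x \<partial>lborel)"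
      by (simp add: s_def)
  qed
qed

section \<open>Powers of Gaussian integrals\<close>

text \<open>
  \<open>L'\<close> is the adjoint of \<open>L\<close>; recording that both have the same Jacobian avoids determinants.
\<close>

lemma whitening:
  fixes X :: "'m \<Rightarrow> real ^ 'n"
  assumes "finite C"
  shows "\<exists>(L :: real ^ 'n \<Rightarrow> real ^ 'n) L' c. linear L \<and> linear L' \<and> (\<forall>x y. L x \<bullet> y = x \<bullet> L' y) \<and> c > 0 \<and>
    (\<forall>F\<in>borel_measurable borel. (\<integral>\<^sup>+x. F (L x) \<partial>lborel) = ennreal c * (\<integral>\<^sup>+x. F x \<partial>lborel)) \<and>
    (\<forall>F\<in>borel_measurable borel. (\<integral>\<^sup>+x. F (L' x) \<partial>lborel) = ennreal c * (\<integral>\<^sup>+x. F x \<partial>lborel)) \<and>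
    (\<forall>h. (norm (L h))\<^sup>2 + (\<Sum>j\<in>C. (X j \<bullet> L h)\<^sup>2) = (norm h)\<^sup>2)"
  using assms
proof (induction C rule: finite_induct)
  case empty
  show ?case
    by (rule exI[where x="\<lambda>x. x"], rule exI[where x="\<lambda>x. x"], rule exI[where x=1]) (simp add: linear_ident)
next
  case (insert j C)
  then obtain L L' :: "real ^ 'n \<Rightarrow> real ^ 'n" and c where L: "linear L" "linear L'" "\<And>x y. L x \<bullet> y = x \<bullet> L' y" "c > 0"
    "\<And>F. F\<in>borel_measurable borel \<Longrightarrow> (\<integral>\<^sup>+x. F (L x) \<partial>lborel) = ennreal c * (\<integral>\<^sup>+x. F x \<partial>lborel)"
    "\<And>F. F\<in>borel_measurable borel \<Longrightarrow> (\<integral>\<^sup>+x. F (L' x) \<partial>lborel) = ennreal c * (\<integral>\<^sup>+x. F x \<partial>lborel)"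
    "\<And>h. (norm (L h))\<^sup>2 + (\<Sum>j\<in>C. (X j \<bullet> L h)\<^sup>2) = (norm h)\<^sup>2"
    by blast
  \<comment> \<open>After the substitution by \<open>L\<close> the new column acts through
    \<open>X j \<bullet> L h = L' (X j) \<bullet> h\<close>, so the next rank-one correction has to
    be built from \<open>L' (X j)\<close>.\<close>
  obtain M where M: "linear M" "\<And>x y. M x \<bullet> y = x \<bullet> M y"
    "\<And>F. F \<in> borel_measurable borel \<Longrightarrow>
       (\<integral>\<^sup>+x. F (M x) \<partial>lborel) = ennreal (sqrt (1 + (norm (L' (X j)))\<^sup>2)) * (\<integral>\<^sup>+x. F x \<partial>lborel)"
    "\<And>h. (norm (M h))\<^sup>2 + (L' (X j) \<bullet> M h)\<^sup>2 = (norm h)\<^sup>2"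
    using rank_one_whitening[of "L' (X j)"] by metis
  have [measurable]: "M \<in> borel_measurable borel" "L \<in> borel_measurable borel" "L' \<in> borel_measurable borel"
    by (rule borel_measurable_linear, fact)+
  let ?c = "sqrt (1 + (norm (L' (X j)))\<^sup>2)"
  have cc: "?c > 0" by (simp add: add_pos_nonneg)
  show ?case
  proof (rule exI[of _ "\<lambda>x. L (M x)"], rule exI[of _ "\<lambda>x. M (L' x)"], rule exI[of _ "c * ?c"], intro conjI allI ballI)
    show "linear (\<lambda>x. L (M x))" "linear (\<lambda>x. M (L' x))"
      using linear_compose[OF M(1) L(1)] linear_compose[OF L(2) M(1)] by (simp_all add: o_def)
    show "L (M x) \<bullet> y = x \<bullet> M (L' y)" for x y by (simp add: L(3) M(2))
    show "0 < c * ?c" using L(4) cc by simp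
    show "(\<integral>\<^sup>+x. F (L (M x)) \<partial>lborel) = ennreal (c * ?c) * (\<integral>\<^sup>+x. F x \<partial>lborel)"
      if [measurable]: "F \<in> borel_measurable borel" for F
      using L(4) cc by (subst M(3)[of "\<lambda>x. F (L x)"]) (simp_all add: L(5) ennreal_mult mult_ac)
    show "(\<integral>\<^sup>+x. F (M (L' x)) \<partial>lborel) = ennreal (c * ?c) * (\<integral>\<^sup>+x. F x \<partial>lborel)"
      if [measurable]: "F \<in> borel_measurable borel" for F
      using L(4) cc by (subst L(6)[of "\<lambda>x. F (M x)"]) (simp_all add: M(3) ennreal_mult mult_ac)
    show "(norm (L (M h)))\<^sup>2 + (\<Sum>i\<in>insert j C. (X i \<bullet> L (M h))\<^sup>2) = (norm h)\<^sup>2" for h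
    proof -
      have "X j \<bullet> L (M h) = L' (X j) \<bullet> M h" by (metis L(3) inner_commute)
      then show ?thesis using L(7)[of "M h"] M(4)[of h] insert.hyps by simp
    qed
  qed
qed

text \<open>
  If the \<open>X j\<close> are the columns of a matrix \<open>x\<close>, this is a constant multiple of \<open>det (I + x x') powr (- 1/2)\<close>.
\<close>

definition gauss_int :: "'m set \<Rightarrow> ('m \<Rightarrow> real ^ 'n) \<Rightarrow> real" where
  "gauss_int C X = enn2real (\<integral>\<^sup>+g. ennreal (exp (- ((norm g)\<^sup>2 + (\<Sum>j\<in>C. (X j \<bullet> g)\<^sup>2)))) \<partial>lborel)"

text \<open>Induction on the columns with the exponent generalised: integrating out one column
  replaces lam by lam - 1. The column itself only requires lam to exceed \<open>CARD('n)\<close>;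
  each remaining column raises the threshold by one.\<close>

lemma gauss_int_powr_nn_integral_finite:
  fixes C :: "'m set"
  assumes "finite C" and "real CARD('n::finite) + real (card C) - 1 < lam"
  shows "(\<integral>\<^sup>+X. ennreal (gauss_int C X powr lam) \<partial>(\<Pi>\<^sub>M j\<in>C. (lborel :: (real ^ 'n) measure))) < \<infinity>"
  using assms
proof (induction C arbitrary: lam rule: finite_induct)
  case empty
  interpret product_sigma_finite "\<lambda>_::'m. lborel :: (real^'n) measure" ..
  show ?case by (simp add: PiM_empty nn_integral_count_space_finite)
next
  case (insert j C)
  interpret product_sigma_finite "\<lambda>_::'m. lborel :: (real^'n) measure" ..
  define K where "K = enn2real (\<integral>\<^sup>+z. ennreal (exp (- (norm z)\<^sup>2)) \<partial>(lborel :: (real^'n) measure))"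
  have K: "(\<integral>\<^sup>+z. ennreal (exp (- (norm z)\<^sup>2)) \<partial>(lborel :: (real^'n) measure)) = ennreal K"
    using gaussian_nn_integral_finite[where 'a="real^'n"] by (simp add: K_def)
  have K0: "K \<ge> 0" by (simp add: K_def)
  have lam: "real CARD('n) + real (card C) < lam"
    using insert by simp
  define R where "R = enn2real (\<integral>\<^sup>+z. ennreal ((1 + norm z) powr (- lam)) \<partial>(lborel :: (real^'n) measure))"
  have R: "(\<integral>\<^sup>+z. ennreal ((1 + norm z) powr (- lam)) \<partial>(lborel :: (real^'n) measure)) = ennreal R"
    using radial_powr_nn_integral_finite[of lam, where 'a="real^'n"] lam by (simp add: R_def)
  have R0: "R \<ge> 0" by (simp add: R_def)
  have meas: "(\<lambda>X. gauss_int (insert j C) X) \<in> borel_measurable (\<Pi>\<^sub>M j\<in>insert j C. (lborel :: (real ^ 'n) measure))"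
    unfolding gauss_int_def using insert.hyps by measurable
  have meas': "(\<lambda>X. gauss_int C X) \<in> borel_measurable (\<Pi>\<^sub>M j\<in>C. (lborel :: (real ^ 'n) measure))"
    unfolding gauss_int_def using insert.hyps by measurable
  \<comment> \<open>Adding a column multiplies the Gaussian integral by \<open>1 / sqrt (1 + norm (L' y)^2)\<close>; integrating over
    \<open>y\<close> gives back one power through the Jacobian of \<open>L'\<close>.\<close>
  have step: "(\<integral>\<^sup>+y. ennreal (gauss_int (insert j C) (X(j:=y)) powr lam) \<partial>lborel)
      \<le> ennreal (2 powr lam * R * K) * ennreal (gauss_int C X powr (lam - 1))" for X :: "'m \<Rightarrow> real^'n"
  proof -
    obtain L L' :: "real ^ 'n \<Rightarrow> real ^ 'n" and c where L: "linear L" "linear L'" "\<And>x y. L x \<bullet> y = x \<bullet> L' y" "c > 0"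
      "\<And>F. F\<in>borel_measurable borel \<Longrightarrow> (\<integral>\<^sup>+x. F (L x) \<partial>lborel) = ennreal c * (\<integral>\<^sup>+x. F x \<partial>lborel)"
      "\<And>F. F\<in>borel_measurable borel \<Longrightarrow> (\<integral>\<^sup>+x. F (L' x) \<partial>lborel) = ennreal c * (\<integral>\<^sup>+x. F x \<partial>lborel)"
      "\<And>h. (norm (L h))\<^sup>2 + (\<Sum>j\<in>C. (X j \<bullet> L h)\<^sup>2) = (norm h)\<^sup>2"
      using whitening[OF insert.hyps(1), of X] by blast
    have cancel: "(\<integral>\<^sup>+x. F x \<partial>lborel) = ennreal (b / a)"
      if "(\<integral>\<^sup>+x. G x \<partial>lborel) = ennreal a * (\<integral>\<^sup>+x. F x \<partial>lborel)" "(\<integral>\<^sup>+x. G x \<partial>lborel) = ennreal b"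
        "a > 0" "b \<ge> 0" for F G :: "real^'n \<Rightarrow> ennreal" and a b
    proof -
      have "(\<integral>\<^sup>+x. F x \<partial>lborel) = ennreal (1/a) * ennreal a * (\<integral>\<^sup>+x. F x \<partial>lborel)"
        using that(3) by (simp add: ennreal_mult[symmetric])
      also have "\<dots> = ennreal (1/a) * ennreal b" using that(1,2) by (simp add: mult.assoc)
      also have "\<dots> = ennreal (b/a)" using that(3,4) by (simp add: ennreal_mult[symmetric])
      finally show ?thesis .
    qed
    have gC: "gauss_int C X = K / c"
    proof -
      let ?F = "\<lambda>g. ennreal (exp (- ((norm g)\<^sup>2 + (\<Sum>j\<in>C. (X j \<bullet> g)\<^sup>2))))"
      have "(\<integral>\<^sup>+g. ?F (L g) \<partial>lborel) = ennreal c * (\<integral>\<^sup>+g. ?F g \<partial>lborel)"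
        by (rule L(5)) measurable
      moreover have "(\<integral>\<^sup>+g. ?F (L g) \<partial>lborel) = ennreal K"
        by (simp add: L(7) K)
      ultimately have "(\<integral>\<^sup>+g. ?F g \<partial>lborel) = ennreal (K / c)"
        using L(4) K0 by (intro cancel)
      then show ?thesis using L(4) K0 by (simp add: gauss_int_def)
    qed
    have gI: "gauss_int (insert j C) (X(j:=y)) = K / c / sqrt (1 + (norm (L' y))\<^sup>2)" for y
    proof -
      let ?F = "\<lambda>g. ennreal (exp (- ((norm g)\<^sup>2 + (\<Sum>i\<in>insert j C. ((X(j:=y)) i \<bullet> g)\<^sup>2))))"
      let ?G = "\<lambda>h. ennreal (exp (- ((norm h)\<^sup>2 + (L' y \<bullet> h)\<^sup>2)))"
      obtain M where M: "linear M" "\<And>x y. M x \<bullet> y = x \<bullet> M y"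
        "\<And>F. F \<in> borel_measurable borel \<Longrightarrow>
           (\<integral>\<^sup>+x. F (M x) \<partial>lborel) = ennreal (sqrt (1 + (norm (L' y))\<^sup>2)) * (\<integral>\<^sup>+x. F x \<partial>lborel)"
        "\<And>h. (norm (M h))\<^sup>2 + (L' y \<bullet> M h)\<^sup>2 = (norm h)\<^sup>2"
        using rank_one_whitening[of "L' y"] by metis
      have "(\<integral>\<^sup>+g. ?G (M g) \<partial>lborel) = ennreal (sqrt (1 + (norm (L' y))\<^sup>2)) * (\<integral>\<^sup>+g. ?G g \<partial>lborel)"
        by (rule M(3)) measurable
      moreover have "(\<integral>\<^sup>+g. ?G (M g) \<partial>lborel) = ennreal K" by (simp add: M(4) K)
      ultimately have 1: "(\<integral>\<^sup>+g. ?G g \<partial>lborel) = ennreal (K / sqrt (1 + (norm (L' y))\<^sup>2))"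
        using K0 by (intro cancel) (auto simp: add_pos_nonneg)
      have FL: "?F (L g) = ?G g" for g
      proof -
        have a: "y \<bullet> L g = L' y \<bullet> g" by (metis L(3) inner_commute)
        have b: "(\<Sum>i\<in>C. ((X(j:=y)) i \<bullet> L g)\<^sup>2) = (\<Sum>i\<in>C. (X i \<bullet> L g)\<^sup>2)"
          using insert.hyps by (intro sum.cong) auto
        show ?thesis using L(7)[of g] insert.hyps
          by (simp add: a b del: fun_upd_apply) (simp add: a algebra_simps)
      qed
      have "(\<integral>\<^sup>+g. ?F (L g) \<partial>lborel) = ennreal c * (\<integral>\<^sup>+g. ?F g \<partial>lborel)"
        by (rule L(5)) measurable
      moreover have "(\<integral>\<^sup>+g. ?F (L g) \<partial>lborel) = ennreal (K / sqrt (1 + (norm (L' y))\<^sup>2))"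
        using 1 by (simp only: FL)
      moreover note L(4)
      moreover have "0 \<le> K / sqrt (1 + (norm (L' y))\<^sup>2)" using K0 by simp
      ultimately have "(\<integral>\<^sup>+g. ?F g \<partial>lborel) = ennreal (K / sqrt (1 + (norm (L' y))\<^sup>2) / c)"
        by (rule cancel)
      then show ?thesis using L(4) K0 by (simp add: gauss_int_def field_simps)
    qed
    \<comment> \<open>The factor 2 powr lam comes from 1 + s \<le> 2 * sqrt (1 + s^2), which brings
      the bound to the form integrated in \<open>R\<close>.\<close>
    have le: "gauss_int (insert j C) (X(j:=y)) powr lam
        \<le> (K / c) powr lam * 2 powr lam * (1 + norm (L' y)) powr (- lam)" for y
    proof -
      let ?s = "norm (L' y)"
      have "(1 + ?s)\<^sup>2 \<le> (2 * sqrt (1 + ?s\<^sup>2))\<^sup>2"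
      proof -
        have "(2 * sqrt (1 + ?s\<^sup>2))\<^sup>2 = 4 * (1 + ?s\<^sup>2)" by (simp add: power_mult_distrib)
        moreover have "2 * ?s \<le> 1 + ?s\<^sup>2" using zero_le_power2[of "1 - ?s"] unfolding power2_diff by simp
        ultimately show ?thesis unfolding power2_sum by simp (smt (verit) zero_le_power2)
      qed
      then have q: "1 + ?s \<le> 2 * sqrt (1 + ?s\<^sup>2)"
        by (rule power2_le_imp_le) simp
      have "K / c / sqrt (1 + ?s\<^sup>2) \<le> K / c * (2 / (1 + ?s))"
      proof -
        have "1 / sqrt (1 + ?s\<^sup>2) \<le> 2 / (1 + ?s)"
          using q by (simp add: divide_simps add_pos_nonneg)
        then show ?thesis
          using K0 L(4) mult_left_mono[of "1 / sqrt (1 + ?s\<^sup>2)" "2 / (1 + ?s)" "K / c"] by simp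
      qed
      then have "gauss_int (insert j C) (X(j:=y)) powr lam \<le> (K / c * (2 / (1 + ?s))) powr lam"
        unfolding gI using K0 L(4) lam by (intro powr_mono2) auto
      also have "\<dots> = (K / c) powr lam * 2 powr lam * (1 + ?s) powr (- lam)"
        using K0 L(4) by (simp add: powr_mult powr_divide powr_minus_divide add_nonneg_nonneg)
      finally show ?thesis .
    qed
    have "(\<integral>\<^sup>+y. ennreal (gauss_int (insert j C) (X(j:=y)) powr lam) \<partial>lborel)
      \<le> (\<integral>\<^sup>+y. ennreal ((K / c) powr lam * 2 powr lam * (1 + norm (L' y)) powr (- lam)) \<partial>lborel)"
      using le by (intro nn_integral_mono ennreal_leI)
    also have "\<dots> = (\<integral>\<^sup>+y. ennreal ((K / c) powr lam * 2 powr lam) * ennreal ((1 + norm (L' y)) powr (- lam)) \<partial>lborel)"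
      by (simp add: ennreal_mult)
    also have "\<dots> = ennreal ((K / c) powr lam * 2 powr lam) * (ennreal c * ennreal R)"
      using borel_measurable_linear[OF L(2)]
      by (subst nn_integral_cmult) (simp_all add: L(6)[of "\<lambda>z. ennreal ((1 + norm z) powr (- lam))"] R)
    also have "\<dots> = ennreal ((K / c) powr lam * 2 powr lam * (c * R))"
      using L(4) R0 by (simp add: ennreal_mult)
    also have "(K / c) powr lam * 2 powr lam * (c * R) = 2 powr lam * R * K * (K / c) powr (lam - 1)"
      using L(4) K0 by (cases "K = 0") (auto simp: powr_diff)
    finally show ?thesis unfolding gC using K0 R0 by (simp add: ennreal_mult fun_upd_def)
  qed
  have "(\<integral>\<^sup>+X. ennreal (gauss_int (insert j C) X powr lam) \<partial>(\<Pi>\<^sub>M j\<in>insert j C. (lborel :: (real ^ 'n) measure)))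
     = (\<integral>\<^sup>+X. \<integral>\<^sup>+y. ennreal (gauss_int (insert j C) (X(j:=y)) powr lam) \<partial>lborel \<partial>(\<Pi>\<^sub>M j\<in>C. (lborel :: (real ^ 'n) measure)))"
    using insert.hyps meas by (intro product_nn_integral_insert) auto
  also have "\<dots> \<le> (\<integral>\<^sup>+X. ennreal (2 powr lam * R * K) * ennreal (gauss_int C X powr (lam - 1)) \<partial>(\<Pi>\<^sub>M j\<in>C. (lborel :: (real ^ 'n) measure)))"
    by (intro nn_integral_mono step)
  also have "\<dots> = ennreal (2 powr lam * R * K) * (\<integral>\<^sup>+X. ennreal (gauss_int C X powr (lam - 1)) \<partial>(\<Pi>\<^sub>M j\<in>C. (lborel :: (real ^ 'n) measure)))"
    using meas' by (intro nn_integral_cmult) auto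
  also have "\<dots> < \<infinity>"
    using insert.IH[of "lam - 1"] lam by (simp add: ennreal_mult_less_top)
  finally show ?case .
qed

section \<open>Matrices: measurability, isometries and block rows\<close>

lemma sum_UNIV_Plus:
  "(\<Sum>i\<in>UNIV. f (i :: 'k::finite + 'l::finite)) = (\<Sum>a\<in>UNIV. f (Inl a)) + (\<Sum>b\<in>UNIV. f (Inr b))"
proof -
  have "(\<Sum>i\<in>UNIV. f i) = (\<Sum>i\<in>UNIV <+> UNIV. f i)" by (simp only: UNIV_Plus_UNIV)
  also have "\<dots> = (\<Sum>a\<in>UNIV. f (Inl a)) + (\<Sum>b\<in>UNIV. f (Inr b))" by (subst sum.Plus) auto
  finally show ?thesis .
qed

lemma borel_measurable_vecI:
  fixes f :: "'b \<Rightarrow> 'a::euclidean_space ^ 'n"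
  assumes "\<And>i. (\<lambda>x. f x $ i) \<in> borel_measurable M"
  shows "f \<in> borel_measurable M"
proof (rule borel_measurable_euclidean_space[THEN iffD2], intro ballI)
  fix b :: "'a^'n"
  have "(\<lambda>x. f x \<bullet> b) = (\<lambda>x. \<Sum>i\<in>UNIV. f x $ i \<bullet> (b $ i))"
    by (simp add: inner_vec_def)
  then show "(\<lambda>x. f x \<bullet> b) \<in> borel_measurable M" using assms by simp
qed

lemma borel_measurable_vec_nth:
  fixes f :: "'b \<Rightarrow> 'a::euclidean_space ^ 'n"
  assumes "f \<in> borel_measurable M"
  shows "(\<lambda>x. f x $ i) \<in> borel_measurable M"
  using assms by (rule borel_measurable_continuous_on[rotated]) (intro continuous_intros)

lemma borel_measurable_matrix_mult [measurable]:
  fixes f :: "'z \<Rightarrow> real ^ 'b ^ 'a" and g :: "'z \<Rightarrow> real ^ 'c ^ 'b"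
  assumes "f \<in> borel_measurable M" "g \<in> borel_measurable M"
  shows "(\<lambda>x. f x ** g x) \<in> borel_measurable M"
  unfolding matrix_matrix_mult_def
  by (intro borel_measurable_vecI)
    (simp add: borel_measurable_vec_nth assms borel_measurable_times borel_measurable_sum)

lemma borel_measurable_transpose [measurable]:
  fixes f :: "'z \<Rightarrow> real ^ 'b ^ 'a"
  assumes "f \<in> borel_measurable M"
  shows "(\<lambda>x. transpose (f x)) \<in> borel_measurable M"
  unfolding transpose_def
  by (intro borel_measurable_vecI) (simp add: borel_measurable_vec_nth assms)

lemma borel_measurable_stack_rows [measurable]:
  assumes "f \<in> borel_measurable M" "g \<in> borel_measurable M"
  shows "(\<lambda>x. stack_rows (f x) (g x)) \<in> borel_measurable M"
proof (rule borel_measurable_vecI)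
  fix i show "(\<lambda>x. stack_rows (f x) (g x) $ i) \<in> borel_measurable M"
    unfolding stack_rows_def by (cases i) (simp_all add: borel_measurable_vec_nth assms)
qed

lemma linear_matrix_mult_left: "linear (\<lambda>X. (A :: real ^ 'b ^ 'a) ** (X :: real ^ 'c ^ 'b))"
  by (rule linearI) (simp_all add: vec_eq_iff matrix_matrix_mult_def sum.distrib distrib_left sum_distrib_left mult_ac)

lemma linear_matrix_mult_right: "linear (\<lambda>X. (X :: real ^ 'b ^ 'a) ** (A :: real ^ 'c ^ 'b))"
  by (rule linearI) (simp_all add: vec_eq_iff matrix_matrix_mult_def sum.distrib distrib_right sum_distrib_left mult.assoc)

lemma linear_transpose: "linear (transpose :: real ^ 'b ^ 'a \<Rightarrow> _)"
  by (rule linearI) (simp_all add: vec_eq_iff transpose_def)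

lemma norm_vec_power2: "(norm (x :: 'a::euclidean_space ^ 'n))\<^sup>2 = (\<Sum>i\<in>UNIV. (norm (x $ i))\<^sup>2)"
  by (simp add: power2_norm_eq_inner inner_vec_def)

lemma norm_transpose [simp]: "norm (transpose (X :: real ^ 'b ^ 'a)) = norm X"
proof -
  have "(norm (transpose X))\<^sup>2 = (norm X)\<^sup>2"
    unfolding norm_vec_power2 transpose_def by (simp, rule sum.swap)
  then show ?thesis by (simp add: power2_eq_iff_nonneg)
qed

lemma norm_power2_columns: "(norm (X :: real ^ 'b ^ 'a))\<^sup>2 = (\<Sum>j\<in>UNIV. (norm (column j X))\<^sup>2)"
  by (subst norm_transpose[symmetric]) (simp add: norm_vec_power2 transpose_def column_def)

lemma column_matrix_mult: "column j (A ** B) = A *v column j B"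
  by (simp add: column_def matrix_matrix_mult_def matrix_vector_mult_def vec_eq_iff)

lemma norm_orthogonal_matrix_mult:
  assumes "orthogonal_matrix (\<gamma> :: real ^ 'a ^ 'a)"
  shows "norm (\<gamma> *v v) = norm v"
proof -
  have "orthogonal_transformation (\<lambda>v. \<gamma> *v v)"
    using assms by (simp add: orthogonal_transformation_matrix)
  then show ?thesis by (rule orthogonal_transformation_norm)
qed

lemma norm_orthogonal_matrix_mult_matrix:
  assumes "orthogonal_matrix \<gamma>"
  shows "norm (\<gamma> ** (X :: real ^ 'b ^ 'a)) = norm X"
proof -
  have "(norm (\<gamma> ** X))\<^sup>2 = (norm X)\<^sup>2"
    unfolding norm_power2_columns column_matrix_mult using assms by (simp add: norm_orthogonal_matrix_mult)
  then show ?thesis by (simp add: power2_eq_iff_nonneg)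
qed

lemma orthogonal_matrix_cancel:
  assumes "orthogonal_matrix (\<gamma> :: real ^ 'a ^ 'a)"
  shows "transpose \<gamma> ** (\<gamma> ** X) = X" "\<gamma> ** (transpose \<gamma> ** X) = X"
  using assms by (simp_all add: orthogonal_matrix_def matrix_mul_assoc)

lemma nn_integral_orthogonal_matrix_mult:
  assumes \<gamma>: "orthogonal_matrix (\<gamma> :: real ^ 'a ^ 'a)" and F: "F \<in> borel_measurable borel"
  shows "(\<integral>\<^sup>+X. F (\<gamma> ** (X :: real ^ 'b ^ 'a)) \<partial>lborel) = (\<integral>\<^sup>+X. F X \<partial>lborel)"
proof (rule linear_isometry_nn_integral_lborel[OF linear_matrix_mult_left _ norm_orthogonal_matrix_mult_matrix[OF \<gamma>] F])
  show "surj ((**) \<gamma> :: real ^ 'b ^ 'a \<Rightarrow> _)"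
    using orthogonal_matrix_cancel[OF \<gamma>] by (metis surjI)
qed

lemma nn_integral_transpose:
  assumes F: "F \<in> borel_measurable borel"
  shows "(\<integral>\<^sup>+X. F (transpose (X :: real ^ 'b ^ 'a)) \<partial>lborel) = (\<integral>\<^sup>+X. F X \<partial>lborel)"
proof (rule linear_isometry_nn_integral_lborel[OF linear_transpose _ norm_transpose F])
  show "surj (transpose :: real ^ 'b ^ 'a \<Rightarrow> _)"
    using transpose_transpose by (metis surjI)
qed

lemma norm_stack_rows: "(norm (stack_rows \<omega> t))\<^sup>2 = (norm \<omega>)\<^sup>2 + (norm t)\<^sup>2"
  by (simp add: norm_vec_power2 sum_UNIV_Plus stack_rows_def)

lemma linear_stack_rows: "linear (\<lambda>p. stack_rows (fst p) (snd p))"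
  by (rule linearI) (simp_all add: vec_eq_iff stack_rows_def split: sum.split)

text \<open>\<open>stack_rows\<close> is a linear isometry from pairs of blocks onto matrices, so
  Tonelli applies. The integral over t stays outside because the Radon transform integrates over
  \<omega> with t fixed.\<close>

lemma nn_integral_stack_rows:
  fixes F :: "real ^ 'm ^ ('k::finite + 'l::finite) \<Rightarrow> ennreal"
  assumes F[measurable]: "F \<in> borel_measurable borel"
  shows "(\<integral>\<^sup>+x. F x \<partial>lborel) = (\<integral>\<^sup>+t. \<integral>\<^sup>+\<omega>. F (stack_rows \<omega> t) \<partial>lborel \<partial>lborel)"
proof -
  have F': "(\<lambda>(\<omega>,t). F (stack_rows \<omega> t)) \<in> borel_measurable ((lborel :: (real^'m^'k) measure) \<Otimes>\<^sub>M (lborel :: (real^'m^'l) measure))"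
    by measurable
  have surj: "surj (\<lambda>p. stack_rows (fst p) (snd p) :: real ^ 'm ^ ('k + 'l))"
  proof (rule surjI)
    fix x :: "real ^ 'm ^ ('k + 'l)"
    show "stack_rows (fst ((\<chi> a. x $ Inl a), (\<chi> b. x $ Inr b))) (snd ((\<chi> a. x $ Inl a), (\<chi> b. x $ Inr b))) = x"
      by (simp add: vec_eq_iff stack_rows_def split: sum.split)
  qed
  have iso: "norm (stack_rows (fst p) (snd p)) = norm p" for p :: "(real^'m^'k) \<times> (real^'m^'l)"
  proof -
    have "(norm (stack_rows (fst p) (snd p)))\<^sup>2 = (norm p)\<^sup>2"
      by (simp add: norm_stack_rows norm_prod_def)
    then show ?thesis by (simp add: power2_eq_iff_nonneg)
  qed
  have "(\<integral>\<^sup>+x. F x \<partial>lborel) = (\<integral>\<^sup>+p. F (stack_rows (fst p) (snd p)) \<partial>(lborel :: ((real^'m^'k) \<times> (real^'m^'l)) measure))"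
    by (rule linear_isometry_nn_integral_lborel[OF linear_stack_rows surj iso F, symmetric])
  also have "\<dots> = (\<integral>\<^sup>+p. (\<lambda>(\<omega>,t). F (stack_rows \<omega> t)) p \<partial>((lborel :: (real^'m^'k) measure) \<Otimes>\<^sub>M (lborel :: (real^'m^'l) measure)))"
    by (simp add: lborel_prod case_prod_unfold)
  also have "\<dots> = (\<integral>\<^sup>+t. \<integral>\<^sup>+\<omega>. F (stack_rows \<omega> t) \<partial>lborel \<partial>lborel)"
    using lborel_pair.nn_integral_snd[OF F'] by simp
  finally show ?thesis .
qed

abbreviation base_frame :: "real ^ 'l::finite ^ ('k::finite + 'l)" where
  "base_frame \<equiv> stack_rows 0 (mat 1)"

lemma base_frame_transpose_mult: "transpose base_frame ** stack_rows \<omega> t = t"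
  by (simp add: vec_eq_iff matrix_matrix_mult_def transpose_def stack_rows_def sum_UNIV_Plus mat_def
      of_bool_def[symmetric])

lemma base_frame_mult: "base_frame ** t = stack_rows 0 t"
  by (simp add: vec_eq_iff matrix_matrix_mult_def stack_rows_def mat_def of_bool_def[symmetric] split: sum.split)

lemma stack_rows_diff: "stack_rows a b - stack_rows c d = stack_rows (a - c) (b - d)"
  by (simp add: vec_eq_iff stack_rows_def split: sum.split)

lemma stack_rows_add: "stack_rows a b + stack_rows c d = stack_rows (a + c) (b + d)"
  by (simp add: vec_eq_iff stack_rows_def split: sum.split)

text \<open>Every point x of the plane attached to \<xi> and t satisfies
  \<open>transpose \<xi> ** x = t\<close>. This recovers t without the rotation.\<close>

lemma frame_transpose_mult:
  assumes "orthogonal_matrix \<gamma>"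
  shows "transpose (\<gamma> ** base_frame) ** (\<gamma> ** stack_rows \<omega> t) = t"
proof -
  have "transpose (\<gamma> ** base_frame) ** (\<gamma> ** stack_rows \<omega> t) = transpose base_frame ** (transpose \<gamma> ** (\<gamma> ** stack_rows \<omega> t))"
    by (simp add: matrix_transpose_mul matrix_mul_assoc)
  then show ?thesis by (simp add: orthogonal_matrix_cancel[OF assms] base_frame_transpose_mult)
qed

section \<open>The Radon transform without a choice of rotations\<close>

text \<open>
  Up to a constant factor the absolute Radon transform of \<open>F\<close>, written without the rotations
  \<open>g \<xi>\<close>: the component of \<open>y\<close> along \<open>\<xi>\<close> is averaged over the unit ball and then replaced by \<open>t\<close>.
  In this form joint measurability in \<open>\<xi>\<close> and \<open>t\<close> is evident, whereas \<open>g\<close> need not be measurable.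
\<close>

definition plane_average :: "(real ^ 'm ^ ('k::finite + 'l::finite) \<Rightarrow> ennreal) \<Rightarrow> real ^ 'l ^ ('k + 'l) \<Rightarrow> real ^ 'm ^ 'l \<Rightarrow> ennreal" where
  "plane_average F \<xi> t = (\<integral>\<^sup>+y. F (\<xi> ** t + (y - \<xi> ** (transpose \<xi> ** y))) * indicator {s. norm s \<le> 1} (transpose \<xi> ** y) \<partial>lborel)"

lemma plane_average_measurable:
  assumes [measurable]: "F \<in> borel_measurable borel"
  shows "(\<lambda>(\<xi>, t). plane_average F \<xi> t) \<in> borel_measurable (borel \<Otimes>\<^sub>M borel)"
  unfolding plane_average_def by measurable

text \<open>Substitute \<open>\<gamma> ** stack_rows \<omega> s\<close> for y. Removing the
  component along \<xi> and adding \<open>\<xi> ** t\<close> turns s into t, so s survives only in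
  the indicator, whose integral is the volume of the unit ball.\<close>

lemma plane_average_eq:
  fixes F :: "real ^ 'm ^ ('k::finite + 'l::finite) \<Rightarrow> ennreal"
  assumes \<gamma>: "orthogonal_matrix \<gamma>" and \<xi>: "\<gamma> ** base_frame = \<xi>" and F[measurable]: "F \<in> borel_measurable borel"
  shows "plane_average F \<xi> t =
    (\<integral>\<^sup>+\<omega>. F (\<gamma> ** stack_rows \<omega> t) \<partial>lborel) * emeasure lborel (cball 0 1 :: (real ^ 'm ^ 'l) set)"
proof -
  have a: "\<xi> ** t + (\<gamma> ** stack_rows \<omega> s - \<xi> ** s) = \<gamma> ** stack_rows \<omega> t" for \<omega> s
  proof -
    have "\<xi> ** s = \<gamma> ** stack_rows 0 s" for s :: "real ^ 'm ^ 'l"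
      by (simp only: \<xi>[symmetric] matrix_mul_assoc[symmetric] base_frame_mult)
    moreover have "\<gamma> ** stack_rows 0 t + (\<gamma> ** stack_rows \<omega> s - \<gamma> ** stack_rows 0 s) = \<gamma> ** (stack_rows 0 t + (stack_rows \<omega> s - stack_rows 0 s))"
      by (simp only: linear_diff[OF linear_matrix_mult_left] linear_add[OF linear_matrix_mult_left])
    ultimately show ?thesis by (simp add: stack_rows_diff stack_rows_add)
  qed
  have "plane_average F \<xi> t = (\<integral>\<^sup>+y. F (\<xi> ** t + (\<gamma> ** y - \<xi> ** (transpose \<xi> ** (\<gamma> ** y)))) * indicator {s. norm s \<le> 1} (transpose \<xi> ** (\<gamma> ** y)) \<partial>lborel)"
    unfolding plane_average_def by (rule nn_integral_orthogonal_matrix_mult[OF \<gamma>, symmetric]) measurable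
  also have "\<dots> = (\<integral>\<^sup>+s. \<integral>\<^sup>+\<omega>. F (\<gamma> ** stack_rows \<omega> t) * indicator {s :: real ^ 'm ^ 'l. norm s \<le> 1} s \<partial>lborel \<partial>lborel)"
  proof -
    have "(\<lambda>y. F (\<xi> ** t + (\<gamma> ** y - \<xi> ** (transpose \<xi> ** (\<gamma> ** y)))) * indicator {s. norm s \<le> 1} (transpose \<xi> ** (\<gamma> ** y))) \<in> borel_measurable borel"
      by measurable
    from nn_integral_stack_rows[OF this] show ?thesis
      by (simp only: frame_transpose_mult[OF \<gamma>, unfolded \<xi>] a)
  qed
  also have "\<dots> = (\<integral>\<^sup>+\<omega>. F (\<gamma> ** stack_rows \<omega> t) \<partial>lborel) * emeasure lborel (cball 0 1 :: (real ^ 'm ^ 'l) set)"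
  proof -
    have "{s. norm s \<le> 1} = (cball 0 1 :: (real ^ 'm ^ 'l) set)" by auto
    then show ?thesis by (simp add: nn_integral_multc nn_integral_cmult borel_measurable_indicator)
  qed
  finally show ?thesis .
qed

text \<open>In rotated block coordinates \<omega> and t together run over all matrices x, and t is
  \<open>transpose \<xi> ** x\<close>. The right-hand side contains no \<gamma>, so the identity can
  be integrated over \<xi>.\<close>

lemma plane_average_duality:
  fixes F :: "real ^ 'm ^ ('k::finite + 'l::finite) \<Rightarrow> ennreal"
  assumes \<gamma>: "orthogonal_matrix \<gamma>" and \<xi>: "\<gamma> ** base_frame = \<xi>" and F[measurable]: "F \<in> borel_measurable borel"
    and w[measurable]: "w \<in> borel_measurable borel"
  shows "(\<integral>\<^sup>+t. w t * plane_average F \<xi> t \<partial>lborel) =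
     emeasure lborel (cball 0 1 :: (real ^ 'm ^ 'l) set) * (\<integral>\<^sup>+x. F x * w (transpose \<xi> ** x) \<partial>lborel)"
proof -
  let ?c = "emeasure lborel (cball 0 1 :: (real ^ 'm ^ 'l) set)"
  have "(\<integral>\<^sup>+t. w t * plane_average F \<xi> t \<partial>lborel) = (\<integral>\<^sup>+t. ?c * (\<integral>\<^sup>+\<omega>. F (\<gamma> ** stack_rows \<omega> t) * w t \<partial>lborel) \<partial>lborel)"
    by (subst nn_integral_multc) (auto simp: plane_average_eq[OF \<gamma> \<xi> F] mult_ac)
  also have "\<dots> = ?c * (\<integral>\<^sup>+t. \<integral>\<^sup>+\<omega>. F (\<gamma> ** stack_rows \<omega> t) * w t \<partial>lborel \<partial>lborel)"
    by (rule nn_integral_cmult) measurable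
  also have "(\<integral>\<^sup>+t. \<integral>\<^sup>+\<omega>. F (\<gamma> ** stack_rows \<omega> t) * w t \<partial>lborel \<partial>lborel)
      = (\<integral>\<^sup>+x. F (\<gamma> ** x) * w (transpose \<xi> ** (\<gamma> ** x)) \<partial>lborel)"
  proof -
    have "(\<lambda>x. F (\<gamma> ** x) * w (transpose \<xi> ** (\<gamma> ** x))) \<in> borel_measurable borel"
      by measurable
    from nn_integral_stack_rows[OF this] show ?thesis
      by (simp only: frame_transpose_mult[OF \<gamma>, unfolded \<xi>])
  qed
  also have "\<dots> = (\<integral>\<^sup>+x. F x * w (transpose \<xi> ** x) \<partial>lborel)"
    by (rule nn_integral_orthogonal_matrix_mult[OF \<gamma>]) measurable
  finally show ?thesis .
qed

section \<open>From a weighted integral to finiteness almost everywhere\<close>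

lemma sigma_finite_lebesgue: "sigma_finite_measure (lebesgue :: 'a::euclidean_space measure)"
proof
  have "(\<Union>n. cball (0::'a) (real n)) = UNIV"
    using real_arch_simple by (auto simp: dist_norm)
  then show "\<exists>A. countable A \<and> A \<subseteq> sets (lebesgue :: 'a measure) \<and> \<Union>A = space (lebesgue :: 'a measure) \<and> (\<forall>a\<in>A. emeasure (lebesgue :: 'a measure) a \<noteq> \<infinity>)"
    by (intro exI[of _ "range (\<lambda>n. cball (0::'a) (real n))"]) (auto simp: emeasure_cball)
qed

lemma rotation_choice_orthogonal:
  assumes "rotation_choice g" "\<xi> \<in> stiefel"
  shows "orthogonal_matrix (g \<xi>)" "g \<xi> ** base_frame = \<xi>"
  using assms by (auto simp: rotation_choice_def rotation_matrix_def)

context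
  fixes \<mu> :: "(real ^ 'l ^ ('k::finite + 'l::finite)) measure"
  assumes \<mu>: "stiefel_invariant_measure \<mu>"
begin

lemma stiefel_measure_space: "space \<mu> = stiefel"
  using \<mu> sets_eq_imp_space_eq[of \<mu> "restrict_space borel stiefel"]
  by (simp add: stiefel_invariant_measure_def space_restrict_space)

lemma stiefel_measure_finite: "finite_measure \<mu>"
  using \<mu> by (simp add: stiefel_invariant_measure_def)

lemma stiefel_measure_measurable:
  "(\<lambda>\<xi>. \<xi>) \<in> measurable \<mu> borel"
proof -
  have s: "sets \<mu> = sets (restrict_space borel stiefel)"
    using \<mu> by (simp add: stiefel_invariant_measure_def)
  show ?thesis
    by (subst measurable_cong_sets[OF s refl]) (rule measurable_restrict_space1, simp)
qed

lemma radon_AE_finite: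
  fixes F :: "real ^ 'm ^ ('k + 'l) \<Rightarrow> ennreal"
  assumes F[measurable]: "F \<in> borel_measurable borel" and w[measurable]: "w \<in> borel_measurable borel"
    and wpos: "\<And>t. w t \<noteq> 0" and g: "rotation_choice g"
    and fin: "(\<integral>\<^sup>+x. F x * (\<integral>\<^sup>+\<xi>. w (transpose \<xi> ** x) \<partial>\<mu>) \<partial>lborel) < \<infinity>"
  shows "AE (\<xi>, t) in \<mu> \<Otimes>\<^sub>M (lebesgue :: (real ^ 'm ^ 'l) measure). (\<integral>\<^sup>+\<omega>. F (g \<xi> ** stack_rows \<omega> t) \<partial>lborel) < \<infinity>"
proof -
  let ?c = "emeasure lborel (cball 0 1 :: (real ^ 'm ^ 'l) set)"
  have c: "?c \<noteq> 0" "?c \<noteq> \<infinity>"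
    by (auto simp: emeasure_cball unit_ball_vol_pos less_imp_neq ennreal_eq_0_iff not_le)
  interpret finite_measure \<mu> by (rule stiefel_measure_finite)
  interpret leb: sigma_finite_measure "lebesgue :: (real ^ 'm ^ 'l) measure" by (rule sigma_finite_lebesgue)
  interpret P: pair_sigma_finite \<mu> "lborel :: (real ^ 'm ^ ('k + 'l)) measure" ..
  note [measurable] = stiefel_measure_measurable
  define h where "h = (\<lambda>p. w (snd p) * plane_average F (fst p) (snd p))"
  have [measurable]: "(\<lambda>(\<xi>, t). plane_average F \<xi> t) \<in> borel_measurable (borel \<Otimes>\<^sub>M borel)"
    by (rule plane_average_measurable) fact
  have h0: "h \<in> borel_measurable (borel \<Otimes>\<^sub>M borel)"
    unfolding h_def by measurable
  \<comment> \<open>Measurability is known for the Borel structures, while the second factor carries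
    the completed measure; the identity map transports it.\<close>
  have id: "(\<lambda>p. (fst p, snd p)) \<in> measurable (\<mu> \<Otimes>\<^sub>M (lebesgue :: (real ^ 'm ^ 'l) measure)) (borel \<Otimes>\<^sub>M borel)"
  proof (rule measurable_Pair)
    show "fst \<in> measurable (\<mu> \<Otimes>\<^sub>M (lebesgue :: (real ^ 'm ^ 'l) measure)) borel"
      using measurable_comp[OF measurable_fst stiefel_measure_measurable] by (simp add: comp_def)
    have "(\<lambda>t. t) \<in> measurable (lebesgue :: (real ^ 'm ^ 'l) measure) borel"
      by (rule measurable_completion) simp
    from measurable_comp[OF measurable_snd this]
    show "snd \<in> measurable (\<mu> \<Otimes>\<^sub>M (lebesgue :: (real ^ 'm ^ 'l) measure)) borel" by (simp add: comp_def)
  qed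
  have h1: "h \<in> borel_measurable (\<mu> \<Otimes>\<^sub>M (lebesgue :: (real ^ 'm ^ 'l) measure))"
    using measurable_comp[OF id h0] by (simp add: comp_def)
  have "(\<integral>\<^sup>+p. h p \<partial>(\<mu> \<Otimes>\<^sub>M (lebesgue :: (real ^ 'm ^ 'l) measure))) = (\<integral>\<^sup>+\<xi>. \<integral>\<^sup>+t. h (\<xi>, t) \<partial>lebesgue \<partial>\<mu>)"
    by (rule leb.nn_integral_fst[OF h1, symmetric])
  also have "\<dots> = (\<integral>\<^sup>+\<xi>. ?c * (\<integral>\<^sup>+x. F x * w (transpose \<xi> ** x) \<partial>lborel) \<partial>\<mu>)"
  proof (rule nn_integral_cong)
    fix \<xi> assume "\<xi> \<in> space \<mu>"
    then have \<xi>: "\<xi> \<in> stiefel" by (simp add: stiefel_measure_space)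
    show "(\<integral>\<^sup>+t. h (\<xi>, t) \<partial>lebesgue) = ?c * (\<integral>\<^sup>+x. F x * w (transpose \<xi> ** x) \<partial>lborel)"
      unfolding nn_integral_completion h_def fst_conv snd_conv
      by (rule plane_average_duality[OF rotation_choice_orthogonal[OF g \<xi>] F w])
  qed
  also have "\<dots> = ?c * (\<integral>\<^sup>+\<xi>. \<integral>\<^sup>+x. F x * w (transpose \<xi> ** x) \<partial>lborel \<partial>\<mu>)"
    by (rule nn_integral_cmult) measurable
  also have "(\<integral>\<^sup>+\<xi>. \<integral>\<^sup>+x. F x * w (transpose \<xi> ** x) \<partial>lborel \<partial>\<mu>) = (\<integral>\<^sup>+x. \<integral>\<^sup>+\<xi>. F x * w (transpose \<xi> ** x) \<partial>\<mu> \<partial>lborel)"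
    by (rule P.Fubini'[symmetric]) measurable
  also have "\<dots> = (\<integral>\<^sup>+x. F x * (\<integral>\<^sup>+\<xi>. w (transpose \<xi> ** x) \<partial>\<mu>) \<partial>lborel)"
    by (intro nn_integral_cong nn_integral_cmult) measurable
  finally have "(\<integral>\<^sup>+p. h p \<partial>(\<mu> \<Otimes>\<^sub>M (lebesgue :: (real ^ 'm ^ 'l) measure))) \<noteq> \<infinity>"
    using fin c by (simp add: ennreal_mult_eq_top_iff less_top)
  from nn_integral_PInf_AE[OF h1 this]
  have "AE p in \<mu> \<Otimes>\<^sub>M (lebesgue :: (real ^ 'm ^ 'l) measure). h p \<noteq> \<infinity>" .
  moreover have "AE p in \<mu> \<Otimes>\<^sub>M (lebesgue :: (real ^ 'm ^ 'l) measure). fst p \<in> stiefel"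
    by (rule AE_I2) (auto simp: space_pair_measure stiefel_measure_space)
  ultimately have "AE p in \<mu> \<Otimes>\<^sub>M (lebesgue :: (real ^ 'm ^ 'l) measure). (\<integral>\<^sup>+\<omega>. F (g (fst p) ** stack_rows \<omega> (snd p)) \<partial>lborel) < \<infinity>"
  proof eventually_elim
    case (elim p)
    then show ?case
      using c wpos[of "snd p"]
      by (auto simp: h_def plane_average_eq[OF rotation_choice_orthogonal[OF g elim(2)] F] ennreal_mult_eq_top_iff less_top)
  qed
  then show ?thesis by (simp add: case_prod_unfold)
qed

end

section \<open>Operator bounds and entrywise norms\<close>

lemma norm_matrix_mult_le: "norm ((A :: real ^ 'b ^ 'a) ** (B :: real ^ 'c ^ 'b)) \<le> norm A * norm B"
proof -
  have "(norm (A ** B))\<^sup>2 = (\<Sum>i\<in>UNIV. \<Sum>j\<in>UNIV. (A $ i \<bullet> column j B)\<^sup>2)"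
    by (simp add: norm_vec_power2 matrix_matrix_mult_def inner_vec_def column_def)
  also have "\<dots> \<le> (\<Sum>i\<in>UNIV. \<Sum>j\<in>UNIV. (norm (A $ i))\<^sup>2 * (norm (column j B))\<^sup>2)"
    by (intro sum_mono) (metis Cauchy_Schwarz_ineq power2_norm_eq_inner)
  also have "\<dots> = (norm A)\<^sup>2 * (norm B)\<^sup>2"
    by (simp add: norm_vec_power2[of A] norm_power2_columns[of B] sum_product)
  finally have "(norm (A ** B))\<^sup>2 \<le> (norm A * norm B)\<^sup>2" by (simp add: power_mult_distrib)
  then show ?thesis by (rule power2_le_imp_le) simp
qed

lemma norm_matrix_vector_mult_le: "norm ((A :: real ^ 'b ^ 'a) *v v) \<le> norm A * norm v"
proof -
  have "(norm (A *v v))\<^sup>2 = (\<Sum>i\<in>UNIV. (A $ i \<bullet> v)\<^sup>2)"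
    by (simp add: norm_vec_power2 matrix_vector_mult_def inner_vec_def)
  also have "\<dots> \<le> (\<Sum>i\<in>UNIV. (norm (A $ i))\<^sup>2 * (norm v)\<^sup>2)"
    by (intro sum_mono) (metis Cauchy_Schwarz_ineq power2_norm_eq_inner)
  also have "\<dots> = (norm A)\<^sup>2 * (norm v)\<^sup>2"
    by (simp add: norm_vec_power2[of A] sum_distrib_right)
  finally have "(norm (A *v v))\<^sup>2 \<le> (norm A * norm v)\<^sup>2" by (simp add: power_mult_distrib)
  then show ?thesis by (rule power2_le_imp_le) simp
qed

text \<open>Converts an operator bound, the natural language for spans, into a bound for the
  entrywise Euclidean norm, in which volumes are computed. The square root of the number of columns
  would suffice; the number itself avoids roots.\<close>

lemma norm_le_CARD_mult:
  fixes A :: "real ^ 'b ^ 'a"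
  assumes "\<And>v. norm (A *v v) \<le> d * norm v" and "0 \<le> d"
  shows "norm A \<le> real CARD('b) * d"
proof -
  have "(norm A)\<^sup>2 = (\<Sum>j\<in>UNIV. (norm (A *v axis j 1))\<^sup>2)"
    by (simp add: norm_power2_columns matrix_vector_mult_basis)
  also have "\<dots> \<le> (\<Sum>j\<in>(UNIV::'b set). d\<^sup>2)"
  proof (intro sum_mono power_mono)
    fix j show "norm (A *v axis j 1) \<le> d" using assms(1)[of "axis j 1"] by simp
  qed simp
  also have "\<dots> = real CARD('b) * d\<^sup>2" by simp
  also have "\<dots> \<le> (real CARD('b))\<^sup>2 * d\<^sup>2"
    using one_le_card_finite[where 'a='b] by (intro mult_right_mono self_le_power) auto
  also have "\<dots> = (real CARD('b) * d)\<^sup>2" by (simp only: power_mult_distrib)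
  finally show ?thesis by (rule power2_le_imp_le) (use assms(2) in simp)
qed

lemma stiefel_norm:
  fixes \<xi> :: "real ^ 'l ^ 'n"
  assumes "\<xi> \<in> stiefel"
  shows "norm (\<xi> *v v) = norm v" "norm \<xi> \<le> real CARD('l)"
proof -
  have "(\<xi> *v v) \<bullet> (\<xi> *v v) = v \<bullet> v" for v
  proof -
    have "(\<xi> *v v) \<bullet> (\<xi> *v v) = (v v* transpose \<xi>) \<bullet> (\<xi> *v v)" by (simp only: vector_transpose_matrix)
    also have "\<dots> = v \<bullet> ((transpose \<xi> ** \<xi>) *v v)" by (simp only: dot_lmul_matrix matrix_vector_mul_assoc)
    also have "transpose \<xi> ** \<xi> = mat 1" using assms by (simp add: stiefel_def)
    finally show ?thesis by (simp only: matrix_vector_mul_lid)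
  qed
  then show n: "norm (\<xi> *v v) = norm v" for v by (simp add: norm_eq)
  show "norm \<xi> \<le> real CARD('l)" using norm_le_CARD_mult[of \<xi> 1] by (simp add: n)
qed

lemma stiefel_orthogonal_mult:
  assumes "orthogonal_matrix \<gamma>"
  shows "\<gamma> ** \<xi> \<in> stiefel \<longleftrightarrow> \<xi> \<in> stiefel"
  unfolding stiefel_def mem_Collect_eq matrix_transpose_mul matrix_mul_assoc[symmetric] orthogonal_matrix_cancel[OF assms] ..

section \<open>Averages over the Stiefel manifold\<close>

text \<open>
  The columns of \<open>G\<close> nearly lie in the span of the columns of \<open>\<xi>\<close>.
  This kernel is invariant under the orthogonal group, and integrating it in either variable
  compares an invariant measure on the Stiefel manifold with Lebesgue measure on all matrices.
\<close>

definition near_frame :: "real \<Rightarrow> real ^ 'l ^ 'n \<Rightarrow> real ^ 'l ^ 'n \<Rightarrow> bool" where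
  "near_frame e \<xi> G \<longleftrightarrow> (\<forall>v. norm (G *v v - \<xi> *v (transpose \<xi> *v (G *v v))) \<le> e * norm v)"

text \<open>All singular values lie between 1/2 and 2. The upper bound keeps the kernel inside a
  bounded set; the lower one keeps the column span nondegenerate.\<close>

definition well_conditioned :: "(real ^ 'l ^ 'n) set" where
  "well_conditioned = {G. \<forall>v. norm v / 2 \<le> norm (G *v v) \<and> norm (G *v v) \<le> 2 * norm v}"

lemma near_frame_orthogonal:
  assumes \<gamma>: "orthogonal_matrix \<gamma>"
  shows "near_frame e (\<gamma> ** \<xi>) (\<gamma> ** G) \<longleftrightarrow> near_frame e \<xi> G"
proof -
  have "norm ((\<gamma> ** G) *v v - (\<gamma> ** \<xi>) *v (transpose (\<gamma> ** \<xi>) *v ((\<gamma> ** G) *v v)))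
      = norm (G *v v - \<xi> *v (transpose \<xi> *v (G *v v)))" for v
  proof -
    have "transpose (\<gamma> ** \<xi>) *v ((\<gamma> ** G) *v v) = transpose \<xi> *v (G *v v)"
      by (simp only: matrix_transpose_mul matrix_vector_mul_assoc matrix_mul_assoc[symmetric] orthogonal_matrix_cancel[OF \<gamma>])
    moreover have "(\<gamma> ** G) *v v - (\<gamma> ** \<xi>) *v u = \<gamma> *v (G *v v - \<xi> *v u)" for u
      by (simp only: matrix_vector_mult_diff_distrib matrix_vector_mul_assoc)
    ultimately show ?thesis by (simp only: norm_orthogonal_matrix_mult[OF \<gamma>])
  qed
  then show ?thesis by (simp add: near_frame_def)
qed

lemma well_conditioned_orthogonal:
  assumes "orthogonal_matrix \<gamma>"
  shows "\<gamma> ** G \<in> well_conditioned \<longleftrightarrow> G \<in> well_conditioned"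
  by (simp add: well_conditioned_def matrix_vector_mul_assoc[symmetric] norm_orthogonal_matrix_mult[OF assms])

lemma continuous_on_matrix_vector_mult:
  assumes "continuous_on S f" "continuous_on S g"
  shows "continuous_on S (\<lambda>x. (f x :: real ^ 'b ^ 'a) *v g x)"
  unfolding matrix_vector_mult_def by (intro continuous_intros assms)

lemma continuous_on_transpose:
  assumes "continuous_on S f"
  shows "continuous_on S (\<lambda>x. transpose (f x :: real ^ 'b ^ 'a))"
  unfolding transpose_def by (intro continuous_intros assms)

lemma closed_near_frame: "closed {p. near_frame e (fst p) (snd p)}"
  unfolding near_frame_def
  by (intro closed_Collect_all closed_Collect_le continuous_intros continuous_on_matrix_vector_mult continuous_on_transpose)

lemma closed_well_conditioned: "closed well_conditioned"
  unfolding well_conditioned_def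
  by (intro closed_Collect_all closed_Collect_conj closed_Collect_le continuous_intros continuous_on_matrix_vector_mult)

lemma pred_near_frame [measurable]:
  assumes "f \<in> borel_measurable M" "g \<in> borel_measurable M"
  shows "Measurable.pred M (\<lambda>x. near_frame e (f x) (g x))"
proof -
  have "(\<lambda>x. (f x, g x)) \<in> borel_measurable M" using assms by (rule borel_measurable_Pair)
  moreover have "Measurable.pred borel (\<lambda>p. near_frame e (fst p) (snd p))"
    using borel_closed[OF closed_near_frame[of e]] by (simp add: pred_def)
  ultimately have "Measurable.pred M (\<lambda>x. (\<lambda>p. near_frame e (fst p) (snd p)) (f x, g x))"
    by (rule measurable_compose)
  then show ?thesis by simp
qed

lemma pred_well_conditioned [measurable]:
  assumes "f \<in> borel_measurable M"
  shows "Measurable.pred M (\<lambda>x. f x \<in> well_conditioned)"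
proof -
  have "Measurable.pred borel (\<lambda>x. x \<in> well_conditioned)"
    using borel_closed[OF closed_well_conditioned] by (simp add: pred_def)
  from measurable_compose[OF assms this] show ?thesis .
qed

text \<open>An orthonormal basis of the column space gives \<eta>, and projecting onto that space
  fixes every column of G. This reduces statements about G to frames, on which the orthogonal group
  acts transitively.\<close>

lemma well_conditioned_factor:
  fixes G :: "real ^ 'l ^ 'n"
  assumes G: "G \<in> well_conditioned"
  obtains \<eta> :: "real ^ 'l ^ 'n" and T where "\<eta> \<in> stiefel" "G = \<eta> ** T"
proof -
  define S where "S = range (\<lambda>v. G *v v)"
  have lin: "linear (\<lambda>v. G *v v)" by simp
  have inj: "inj (\<lambda>v. G *v v)"
    unfolding linear_injective_0[OF lin]
  proof (intro allI impI)
    fix v assume "G *v v = 0"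
    moreover have "norm v / 2 \<le> norm (G *v v)" using G by (simp add: well_conditioned_def)
    ultimately show "v = 0" by simp
  qed
  have sub: "subspace S" unfolding S_def using lin by (simp add: linear_subspace_image)
  have dim: "dim S = CARD('l)"
    unfolding S_def using dim_image_eq[OF lin, of UNIV] inj by (simp add: dim_UNIV)
  obtain B where B: "B \<subseteq> S" "pairwise orthogonal B" "\<And>x. x \<in> B \<Longrightarrow> norm x = 1" "independent B"
    "card B = dim S" "span B = S"
    using orthonormal_basis_subspace[OF sub] by blast
  have "finite B" using B(4) independent_imp_finite by blast
  then obtain h where h: "bij_betw h (UNIV :: 'l set) B"
    using finite_same_card_bij[of "UNIV :: 'l set" B] B(5) dim by auto
  have hB: "h c \<in> B" for c using h by (auto simp: bij_betw_def)
  have hh: "h c \<bullet> h d = (if c = d then 1 else 0)" for c d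
  proof (cases "c = d")
    case True
    then show ?thesis using B(3)[OF hB[of c]] by (simp add: norm_eq_1)
  next
    case False
    then have "h c \<noteq> h d" using h by (auto simp: bij_betw_def inj_on_def)
    then show ?thesis using B(2) hB False by (auto simp: pairwise_def orthogonal_def)
  qed
  define \<eta> where "\<eta> = (\<chi> i c. h c $ i)"
  have \<eta>: "\<eta> \<in> stiefel"
    using hh by (simp add: stiefel_def \<eta>_def vec_eq_iff matrix_matrix_mult_def transpose_def mat_def inner_vec_def)
  have projS: "\<eta> *v (transpose \<eta> *v s) = s" if "s \<in> S" for s
  proof (rule linear_eq_on[where f="\<lambda>s. \<eta> *v (transpose \<eta> *v s)" and g="\<lambda>s. s" and B=B])
    show "linear (\<lambda>s. \<eta> *v (transpose \<eta> *v s))"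
      unfolding matrix_vector_mul_assoc by (rule matrix_vector_mul_linear)
    show "linear (\<lambda>s::real^'n. s)" by (rule linear_ident)
    show "s \<in> span B" using that B(6) by simp
    fix b assume "b \<in> B"
    then obtain c where c: "b = h c" using h by (auto simp: bij_betw_def)
    have "transpose \<eta> *v b = axis c 1"
      using hh[of _ c] by (simp add: c \<eta>_def vec_eq_iff matrix_vector_mult_def transpose_def axis_def inner_vec_def)
    then show "\<eta> *v (transpose \<eta> *v b) = b"
      by (simp add: matrix_vector_mult_basis column_def \<eta>_def c)
  qed
  have "G = \<eta> ** (transpose \<eta> ** G)"
    unfolding matrix_eq
    by (auto simp: matrix_vector_mul_assoc[symmetric] projS S_def simp del: transpose_matrix_vector)
  then show thesis by (rule that[OF \<eta>])
qed

text \<open>\<eta> and \<open>\<eta> ** T\<close> have the same column span, and T stretches vectors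
  by a factor between 1/2 and 2 because \<eta> is isometric. Passing either way therefore costs a
  factor 2 in the tolerance.\<close>

lemma near_frame_factor:
  fixes \<eta> :: "real ^ 'l ^ 'n"
  assumes \<eta>: "\<eta> \<in> stiefel" and G: "\<eta> ** T \<in> well_conditioned" and e: "0 \<le> e"
  shows "near_frame e \<xi> (\<eta> ** T) \<Longrightarrow> near_frame (2 * e) \<xi> \<eta>"
    and "near_frame e \<xi> \<eta> \<Longrightarrow> near_frame (2 * e) \<xi> (\<eta> ** T)"
proof -
  have nT: "norm ((\<eta> ** T) *v v) = norm (T *v v)" for v
    using stiefel_norm(1)[OF \<eta>, of "T *v v"] by (simp add: matrix_vector_mul_assoc)
  have T: "norm v / 2 \<le> norm (T *v v)" "norm (T *v v) \<le> 2 * norm v" for v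
    using G unfolding well_conditioned_def mem_Collect_eq nT by auto
  have lin: "linear (\<lambda>v. T *v v)" by simp
  have "inj (\<lambda>v. T *v v)"
    unfolding linear_injective_0[OF lin]
  proof (intro allI impI)
    fix v assume "T *v v = 0"
    then show "v = 0" using T(1)[of v] by simp
  qed
  then have surj: "surj (\<lambda>v. T *v v)" using linear_injective_imp_surjective[OF lin] by simp
  show "near_frame (2 * e) \<xi> \<eta>" if n: "near_frame e \<xi> (\<eta> ** T)"
    unfolding near_frame_def
  proof
    fix v
    obtain u where u: "v = T *v u" using surj by (metis surjD)
    have "norm ((\<eta> ** T) *v u - \<xi> *v (transpose \<xi> *v ((\<eta> ** T) *v u))) \<le> e * norm u"
      using n by (simp add: near_frame_def)
    also have "\<dots> \<le> e * (2 * norm v)" using T(1)[of u] e u by (intro mult_left_mono) auto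
    finally show "norm (\<eta> *v v - \<xi> *v (transpose \<xi> *v (\<eta> *v v))) \<le> 2 * e * norm v"
      by (simp add: u matrix_vector_mul_assoc mult_ac)
  qed
  show "near_frame (2 * e) \<xi> (\<eta> ** T)" if n: "near_frame e \<xi> \<eta>"
    unfolding near_frame_def
  proof
    fix v
    have "norm (\<eta> *v (T *v v) - \<xi> *v (transpose \<xi> *v (\<eta> *v (T *v v)))) \<le> e * norm (T *v v)"
      using n unfolding near_frame_def by blast
    also have "\<dots> \<le> e * (2 * norm v)" using T(2)[of v] e by (intro mult_left_mono) auto
    finally show "norm ((\<eta> ** T) *v v - \<xi> *v (transpose \<xi> *v ((\<eta> ** T) *v v))) \<le> 2 * e * norm v"
      by (simp add: matrix_vector_mul_assoc mult_ac)
  qed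
qed

lemma norm_stack_rows_vector_mult:
  "(norm (stack_rows \<omega> r *v v))\<^sup>2 = (norm (\<omega> *v v))\<^sup>2 + (norm (r *v v))\<^sup>2"
  by (simp add: norm_vec_power2 sum_UNIV_Plus stack_rows_def matrix_vector_mult_def)

text \<open>Subtracting the projection onto the span of \<open>base_frame\<close> leaves exactly the
  first block of rows.\<close>

lemma near_frame_base_frame:
  "near_frame e base_frame (stack_rows \<omega> r) \<longleftrightarrow> (\<forall>v. norm (\<omega> *v v) \<le> e * norm v)"
proof -
  have "norm (stack_rows \<omega> r *v v - base_frame *v (transpose base_frame *v (stack_rows \<omega> r *v v))) = norm (\<omega> *v v)" for v
  proof -
    have "stack_rows \<omega> r *v v - base_frame *v (transpose base_frame *v (stack_rows \<omega> r *v v)) = stack_rows \<omega> 0 *v v"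
      by (simp add: matrix_vector_mul_assoc base_frame_transpose_mult base_frame_mult
          matrix_vector_mult_diff_rdistrib[symmetric] stack_rows_diff)
    then have "(norm (stack_rows \<omega> r *v v - base_frame *v (transpose base_frame *v (stack_rows \<omega> r *v v))))\<^sup>2 = (norm (\<omega> *v v))\<^sup>2"
      by (simp add: norm_stack_rows_vector_mult)
    then show ?thesis by (simp add: power2_eq_iff_nonneg)
  qed
  then show ?thesis by (simp add: near_frame_def)
qed

section \<open>Volumes of the sections of the kernel\<close>

text \<open>The section of the kernel over \<xi>. For small e its volume at a frame has order e ^ (k
  * (n - k)).\<close>

definition cap :: "real \<Rightarrow> real ^ 'l ^ 'n \<Rightarrow> (real ^ 'l ^ 'n) set" where
  "cap e \<xi> = {G \<in> well_conditioned. near_frame e \<xi> G}"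

lemma cap_borel [measurable]: "cap e \<xi> \<in> sets borel"
  unfolding cap_def by measurable

lemma cap_volume_orthogonal:
  assumes \<gamma>: "orthogonal_matrix \<gamma>"
  shows "emeasure lborel (cap e (\<gamma> ** \<xi>)) = emeasure lborel (cap e \<xi>)"
proof -
  have "emeasure lborel (cap e (\<gamma> ** \<xi>)) = (\<integral>\<^sup>+G. indicator (cap e (\<gamma> ** \<xi>)) G \<partial>lborel)"
    by (simp add: cap_borel)
  also have "\<dots> = (\<integral>\<^sup>+G. indicator (cap e (\<gamma> ** \<xi>)) (\<gamma> ** G) \<partial>lborel)"
    by (rule nn_integral_orthogonal_matrix_mult[OF \<gamma>, symmetric]) (simp add: borel_measurable_indicator cap_borel)
  also have "\<dots> = (\<integral>\<^sup>+G. indicator (cap e \<xi>) G \<partial>lborel)"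
    by (simp add: cap_def indicator_def well_conditioned_orthogonal[OF \<gamma>] near_frame_orthogonal[OF \<gamma>])
  also have "\<dots> = emeasure lborel (cap e \<xi>)"
    by (simp add: cap_borel)
  finally show ?thesis .
qed

lemma emeasure_stack_rows:
  fixes A :: "(real ^ 'm ^ ('k::finite + 'l::finite)) set"
  assumes "A \<in> sets borel"
  shows "emeasure lborel A = (\<integral>\<^sup>+t. \<integral>\<^sup>+\<omega>. indicator A (stack_rows \<omega> t) \<partial>lborel \<partial>lborel)"
  using nn_integral_stack_rows[of "indicator A"] assms by (simp add: borel_measurable_indicator)

lemma nn_integral_indicator_Times:
  assumes [simp]: "A \<in> sets borel" "B \<in> sets borel"
  shows "(\<integral>\<^sup>+t. \<integral>\<^sup>+\<omega>. indicator A \<omega> * indicator B t \<partial>(lborel :: 'a::euclidean_space measure) \<partial>(lborel :: 'b::euclidean_space measure))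
     = emeasure lborel A * emeasure lborel B"
  by (simp add: nn_integral_multc nn_integral_cmult borel_measurable_indicator)

lemma well_conditioned_norm:
  fixes G :: "real ^ 'l ^ 'n"
  assumes "G \<in> well_conditioned"
  shows "norm G \<le> real CARD('l) * 2"
  using assms by (intro norm_le_CARD_mult) (auto simp: well_conditioned_def)

text \<open>In block coordinates the first rows have operator norm at most e and the last rows at
  most 2. Entrywise norms turn this into a product of balls.\<close>

lemma cap_volume_le:
  assumes "0 < e"
  shows "emeasure lborel (cap e (base_frame :: real ^ 'l::finite ^ ('k::finite + 'l)))
    \<le> emeasure lborel (cball (0 :: real ^ 'l ^ 'k) (real CARD('l) * e)) * emeasure lborel (cball (0 :: real ^ 'l ^ 'l) (real CARD('l) * 2))"
proof -
  have "emeasure lborel (cap e (base_frame :: real ^ 'l ^ ('k + 'l)))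
     = (\<integral>\<^sup>+r. \<integral>\<^sup>+\<omega>. indicator (cap e base_frame) (stack_rows \<omega> r :: real ^ 'l ^ ('k + 'l)) \<partial>lborel \<partial>lborel)"
    by (rule emeasure_stack_rows) (rule cap_borel)
  also have "\<dots> \<le> (\<integral>\<^sup>+r. \<integral>\<^sup>+\<omega>. indicator (cball (0 :: real ^ 'l ^ 'k) (real CARD('l) * e)) \<omega> * indicator (cball (0 :: real ^ 'l ^ 'l) (real CARD('l) * 2)) r \<partial>lborel \<partial>lborel)"
  proof (intro nn_integral_mono)
    fix r :: "real ^ 'l ^ 'l" and \<omega> :: "real ^ 'l ^ 'k"
    show "indicator (cap e base_frame) (stack_rows \<omega> r) \<le> (indicator (cball 0 (real CARD('l) * e)) \<omega> * indicator (cball 0 (real CARD('l) * 2)) r :: ennreal)"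
    proof (cases "stack_rows \<omega> r \<in> cap e base_frame")
      case True
      then have w: "stack_rows \<omega> r \<in> well_conditioned" and n: "\<And>v. norm (\<omega> *v v) \<le> e * norm v"
        by (auto simp: cap_def near_frame_base_frame)
      have "norm \<omega> \<le> real CARD('l) * e" using n assms by (intro norm_le_CARD_mult) auto
      moreover have "norm r \<le> real CARD('l) * 2"
      proof (rule norm_le_CARD_mult)
        fix v
        have "(norm (r *v v))\<^sup>2 \<le> (norm (stack_rows \<omega> r *v v))\<^sup>2"
          by (simp add: norm_stack_rows_vector_mult)
        then have "norm (r *v v) \<le> norm (stack_rows \<omega> r *v v)" by (rule power2_le_imp_le) simp
        also have "\<dots> \<le> 2 * norm v" using w by (simp add: well_conditioned_def)
        finally show "norm (r *v v) \<le> 2 * norm v" .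
      qed simp
      ultimately show ?thesis by (simp add: indicator_def)
    qed simp
  qed
  also have "\<dots> = emeasure lborel (cball (0 :: real ^ 'l ^ 'k) (real CARD('l) * e)) * emeasure lborel (cball (0 :: real ^ 'l ^ 'l) (real CARD('l) * 2))"
    by (rule nn_integral_indicator_Times) auto
  finally show ?thesis .
qed

text \<open>If the last block is within 1/4 of the identity, its singular values lie in [3/4, 5/4].
  A first block of operator norm at most 1/2 then keeps the whole matrix between 1/2 and 2.\<close>

lemma cap_volume_ge:
  assumes "0 < e" "e \<le> 1"
  shows "emeasure lborel (cball (0 :: real ^ 'l ^ 'k) (e / 2)) * emeasure lborel (cball (mat 1 :: real ^ 'l ^ 'l) (1 / 4))
    \<le> emeasure lborel (cap e (base_frame :: real ^ 'l::finite ^ ('k::finite + 'l)))"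
proof -
  have "emeasure lborel (cball (0 :: real ^ 'l ^ 'k) (e / 2)) * emeasure lborel (cball (mat 1 :: real ^ 'l ^ 'l) (1 / 4))
    = (\<integral>\<^sup>+r. \<integral>\<^sup>+\<omega>. indicator (cball (0 :: real ^ 'l ^ 'k) (e / 2)) \<omega> * indicator (cball (mat 1 :: real ^ 'l ^ 'l) (1 / 4)) r \<partial>lborel \<partial>lborel)"
    by (rule nn_integral_indicator_Times[symmetric]) auto
  also have "\<dots> \<le> (\<integral>\<^sup>+r. \<integral>\<^sup>+\<omega>. indicator (cap e base_frame) (stack_rows \<omega> r :: real ^ 'l ^ ('k + 'l)) \<partial>lborel \<partial>lborel)"
  proof (intro nn_integral_mono)
    fix r :: "real ^ 'l ^ 'l" and \<omega> :: "real ^ 'l ^ 'k"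
    show "(indicator (cball 0 (e / 2)) \<omega> * indicator (cball (mat 1) (1 / 4)) r :: ennreal) \<le> indicator (cap e base_frame) (stack_rows \<omega> r)"
    proof (cases "\<omega> \<in> cball 0 (e / 2) \<and> r \<in> cball (mat 1) (1 / 4)")
      case True
      have \<omega>: "norm (\<omega> *v v) \<le> e / 2 * norm v" for v
      proof -
        have "norm \<omega> * norm v \<le> e / 2 * norm v" using True by (intro mult_right_mono) auto
        then show ?thesis using norm_matrix_vector_mult_le[of \<omega> v] by linarith
      qed
      have \<omega>1: "norm (\<omega> *v v) \<le> 1 / 2 * norm v" for v
      proof -
        have "e / 2 * norm v \<le> 1 / 2 * norm v" using assms by (intro mult_right_mono) auto
        then show ?thesis using \<omega>[of v] by linarith
      qed
      have r: "norm (r *v v - v) \<le> 1 / 4 * norm v" for v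
      proof -
        have "r *v v - v = (r - mat 1) *v v" by (simp add: matrix_vector_mult_diff_rdistrib)
        moreover have "norm (r - mat 1) * norm v \<le> 1 / 4 * norm v"
          using True by (intro mult_right_mono) (auto simp: dist_norm norm_minus_commute)
        ultimately show ?thesis using norm_matrix_vector_mult_le[of "r - mat 1" v] by simp
      qed
      have "norm v / 2 \<le> norm (stack_rows \<omega> r *v v) \<and> norm (stack_rows \<omega> r *v v) \<le> 2 * norm v" for v
      proof
        have a: "3 / 4 * norm v \<le> norm (r *v v)" "norm (r *v v) \<le> 5 / 4 * norm v"
          using r[of v] norm_triangle_ineq2[of v "r *v v"] norm_triangle_ineq2[of "r *v v" v] norm_minus_commute[of v "r *v v"]
          by linarith+
        have "(norm (r *v v))\<^sup>2 \<le> (norm (stack_rows \<omega> r *v v))\<^sup>2"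
          by (simp add: norm_stack_rows_vector_mult)
        then have "norm (r *v v) \<le> norm (stack_rows \<omega> r *v v)" by (rule power2_le_imp_le) simp
        then show "norm v / 2 \<le> norm (stack_rows \<omega> r *v v)" using a(1) norm_ge_zero[of v] by linarith
        have "(norm (stack_rows \<omega> r *v v))\<^sup>2 \<le> (norm (\<omega> *v v) + norm (r *v v))\<^sup>2"
          by (simp add: norm_stack_rows_vector_mult power2_sum)
        then have "norm (stack_rows \<omega> r *v v) \<le> norm (\<omega> *v v) + norm (r *v v)" by (rule power2_le_imp_le) simp
        then show "norm (stack_rows \<omega> r *v v) \<le> 2 * norm v" using a(2) \<omega>1[of v] norm_ge_zero[of v] by linarith
      qed
      moreover have "norm (\<omega> *v v) \<le> e * norm v" for v
      proof -
        have "e / 2 * norm v \<le> e * norm v" using assms by (intro mult_right_mono) auto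
        then show ?thesis using \<omega>[of v] by linarith
      qed
      ultimately have "stack_rows \<omega> r \<in> cap e base_frame"
        by (simp add: cap_def near_frame_base_frame well_conditioned_def)
      then show ?thesis by (simp add: indicator_def)
    qed (auto simp: indicator_def)
  qed
  also have "\<dots> = emeasure lborel (cap e (base_frame :: real ^ 'l ^ ('k + 'l)))"
    by (rule emeasure_stack_rows[symmetric]) (rule cap_borel)
  finally show ?thesis .
qed

text \<open>The upper and lower bounds contain the same power of e, so their ratio does not depend
  on e. The factor 4 is what two applications of \<open>near_frame_factor\<close> lose.\<close>

lemma cap_volume_doubling:
  obtains C where "0 \<le> C"
    "\<And>e. 0 < e \<Longrightarrow> e \<le> 1 \<Longrightarrow> emeasure lborel (cap (4 * e) (base_frame :: real ^ 'l::finite ^ ('k::finite + 'l)))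
       \<le> ennreal C * emeasure lborel (cap e (base_frame :: real ^ 'l ^ ('k + 'l)))"
    "\<And>e. 0 < e \<Longrightarrow> e \<le> 1 \<Longrightarrow> 0 < emeasure lborel (cap e (base_frame :: real ^ 'l ^ ('k + 'l)))
       \<and> emeasure lborel (cap e (base_frame :: real ^ 'l ^ ('k + 'l))) < \<infinity>"
proof -
  let ?l = "real CARD('l)" and ?N = "DIM(real ^ 'l ^ 'k)" and ?M = "DIM(real ^ 'l ^ 'l)"
  let ?A = "unit_ball_vol (real ?N)" and ?B = "unit_ball_vol (real ?M)"
  have pos: "?A > 0" "?B > 0" by (auto intro: unit_ball_vol_pos)
  have lpos: "?l > 0" by simp
  \<comment> \<open>Both bases are ratios of radii in the two volume bounds: 4 * l * e to e / 2 in
    the first block, and 2 * l to 1 / 4 in the second.\<close>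
  define C where "C = (8 * ?l) ^ ?N * (8 * ?l) ^ ?M"
  show thesis
  proof (rule that[of C])
    show "0 \<le> C" by (simp add: C_def)
    fix e :: real assume e: "0 < e" "e \<le> 1"
    have up: "emeasure lborel (cap d (base_frame :: real ^ 'l ^ ('k + 'l))) \<le> ennreal (?A * (?l * d) ^ ?N * (?B * (?l * 2) ^ ?M))"
      if "0 < d" for d
      using cap_volume_le[OF that, where 'k='k and 'l='l] that
      by (simp add: emeasure_cball ennreal_mult del: DIM_cart)
    have lo: "ennreal (?A * (e / 2) ^ ?N * (?B * (1 / 4) ^ ?M)) \<le> emeasure lborel (cap e (base_frame :: real ^ 'l ^ ('k + 'l)))"
      using cap_volume_ge[OF e, where 'k='k and 'l='l] e
      by (simp add: emeasure_cball ennreal_mult del: DIM_cart)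
    have eq: "?A * (?l * (4 * e)) ^ ?N * (?B * (?l * 2) ^ ?M) = C * (?A * (e / 2) ^ ?N * (?B * (1 / 4) ^ ?M))"
    proof -
      have "(?l * (4 * e)) ^ ?N = (8 * ?l) ^ ?N * (e / 2) ^ ?N" "(?l * 2) ^ ?M = (8 * ?l) ^ ?M * (1 / 4) ^ ?M"
        by (simp_all only: power_mult_distrib[symmetric]) (simp_all add: mult_ac del: DIM_cart)
      then show ?thesis by (simp only: C_def mult_ac)
    qed
    have "emeasure lborel (cap (4 * e) (base_frame :: real ^ 'l ^ ('k + 'l))) \<le> ennreal C * ennreal (?A * (e / 2) ^ ?N * (?B * (1 / 4) ^ ?M))"
      using up[of "4 * e"] e(1) unfolding ennreal_mult'[OF \<open>0 \<le> C\<close>, symmetric] eq[symmetric] by simp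
    also have "\<dots> \<le> ennreal C * emeasure lborel (cap e (base_frame :: real ^ 'l ^ ('k + 'l)))"
      using lo by (rule mult_left_mono) simp
    finally show "emeasure lborel (cap (4 * e) (base_frame :: real ^ 'l ^ ('k + 'l)))
       \<le> ennreal C * emeasure lborel (cap e (base_frame :: real ^ 'l ^ ('k + 'l)))" .
    have "0 < ennreal (?A * (e / 2) ^ ?N * (?B * (1 / 4) ^ ?M))"
      using pos e by (simp del: DIM_cart)
    from less_le_trans[OF this lo] le_less_trans[OF up[OF e(1)] ennreal_less_top]
    show "0 < emeasure lborel (cap e (base_frame :: real ^ 'l ^ ('k + 'l)))
       \<and> emeasure lborel (cap e (base_frame :: real ^ 'l ^ ('k + 'l))) < \<infinity>"
      by simp
  qed
qed

text \<open>Write G = \<xi> H + E with H of norm at most 2 l and E of norm at most l / (1 + norm x),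
  where l = \<open>CARD('l)\<close>. Then G' x differs from H' (\<xi>' x) by a matrix of norm at
  most l, however large x is, so the Gaussian at \<xi> is bounded by a constant times the one at G.
  The 8 and 6 come from (2 s + 1)^2 \<le> 8 s^2 + 2 and from norm G ^ 2 \<le> 4 l^2.\<close>

lemma gaussian_near_frame_le:
  fixes G \<xi> :: "real ^ 'l ^ 'n" and x :: "real ^ 'm ^ 'n"
  assumes G: "G \<in> cap (1 / (1 + norm x)) \<xi>" and \<xi>: "\<xi> \<in> stiefel"
  shows "exp (- (8 * (real CARD('l))\<^sup>2 * (norm (transpose \<xi> ** x))\<^sup>2))
    \<le> exp (6 * (real CARD('l))\<^sup>2) * exp (- ((norm G)\<^sup>2 + (norm (transpose G ** x))\<^sup>2))"
proof -
  let ?l = "real CARD('l)" and ?e = "1 / (1 + norm x)"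
  have "0 < 1 + norm x" using norm_ge_zero[of x] by linarith
  then have e: "0 \<le> ?e" "?e * norm x \<le> 1" by simp_all
  have Gn: "norm G \<le> ?l * 2" using G by (intro well_conditioned_norm) (simp add: cap_def)
  define H where "H = transpose \<xi> ** G"
  have Hn: "norm H \<le> ?l * 2"
  proof (rule norm_le_CARD_mult)
    fix v
    have "(norm (H *v v))\<^sup>2 \<le> (norm (G *v v))\<^sup>2"
    proof -
      have "(H *v v) \<bullet> (H *v v) = (transpose \<xi> *v (G *v v)) \<bullet> (H *v v)"
        by (simp only: H_def matrix_vector_mul_assoc)
      also have "\<dots> = (G *v v) \<bullet> (\<xi> *v (H *v v))"
        by (simp add: dot_lmul_matrix)
      also have "\<dots> \<le> norm (G *v v) * norm (\<xi> *v (H *v v))" by (rule norm_cauchy_schwarz)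
      also have "\<dots> = norm (G *v v) * norm (H *v v)" by (simp only: stiefel_norm(1)[OF \<xi>])
      finally have "norm (H *v v) * norm (H *v v) \<le> norm (G *v v) * norm (H *v v)"
        by (simp add: power2_norm_eq_inner[symmetric] power2_eq_square)
      then have "norm (H *v v) \<le> norm (G *v v)"
        by (cases "norm (H *v v) = 0") auto
      then show ?thesis by (intro power_mono) auto
    qed
    then have "norm (H *v v) \<le> norm (G *v v)" by (rule power2_le_imp_le) simp
    also have "\<dots> \<le> 2 * norm v" using G by (simp add: cap_def well_conditioned_def)
    finally show "norm (H *v v) \<le> 2 * norm v" .
  qed simp
  define E where "E = G - \<xi> ** H"
  have En: "norm E \<le> ?l * ?e"
  proof (rule norm_le_CARD_mult)
    fix v
    have "E *v v = G *v v - \<xi> *v (transpose \<xi> *v (G *v v))"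
      by (simp only: E_def H_def matrix_vector_mult_diff_rdistrib matrix_vector_mul_assoc)
    then show "norm (E *v v) \<le> ?e * norm v"
      using G by (simp only: cap_def near_frame_def mem_Collect_eq)
  qed (use e in simp)
  have "transpose G ** x = transpose H ** (transpose \<xi> ** x) + transpose E ** x"
  proof -
    have "transpose H ** (transpose \<xi> ** x) = transpose (\<xi> ** H) ** x"
      by (simp only: matrix_transpose_mul matrix_mul_assoc)
    also have "\<dots> + transpose E ** x = (transpose (\<xi> ** H) + transpose E) ** x"
      by (rule linear_add[OF linear_matrix_mult_right, symmetric])
    also have "transpose (\<xi> ** H) + transpose E = transpose G"
      unfolding E_def linear_diff[OF linear_transpose] by simp
    finally show ?thesis by simp
  qed
  then have "norm (transpose G ** x) \<le> norm (transpose H ** (transpose \<xi> ** x)) + norm (transpose E ** x)"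
    by (simp add: norm_triangle_ineq)
  also have "\<dots> \<le> norm H * norm (transpose \<xi> ** x) + norm E * norm x"
    using norm_matrix_mult_le[of "transpose H" "transpose \<xi> ** x"] norm_matrix_mult_le[of "transpose E" x] by simp
  also have "\<dots> \<le> ?l * 2 * norm (transpose \<xi> ** x) + ?l * ?e * norm x"
    using Hn En by (intro add_mono mult_right_mono) auto
  also have "\<dots> \<le> ?l * (2 * norm (transpose \<xi> ** x) + 1)"
    using mult_left_mono[OF e(2), of ?l] by (simp add: algebra_simps)
  finally have "(norm (transpose G ** x))\<^sup>2 \<le> (?l * (2 * norm (transpose \<xi> ** x) + 1))\<^sup>2"
    by (intro power_mono) auto
  also have "\<dots> = ?l\<^sup>2 * (2 * norm (transpose \<xi> ** x) + 1)\<^sup>2" by (rule power_mult_distrib)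
  also have "\<dots> \<le> ?l\<^sup>2 * (8 * (norm (transpose \<xi> ** x))\<^sup>2 + 2)"
  proof (rule mult_left_mono)
    show "(2 * norm (transpose \<xi> ** x) + 1)\<^sup>2 \<le> 8 * (norm (transpose \<xi> ** x))\<^sup>2 + 2"
      using zero_le_power2[of "2 * norm (transpose \<xi> ** x) - 1"] by (simp add: power2_eq_square algebra_simps)
  qed simp
  finally have 1: "(norm (transpose G ** x))\<^sup>2 \<le> ?l\<^sup>2 * (8 * (norm (transpose \<xi> ** x))\<^sup>2 + 2)" .
  have 2: "(norm G)\<^sup>2 \<le> ?l\<^sup>2 * 4"
    using power_mono[OF Gn, of 2] by (simp add: power_mult_distrib)
  have "- (8 * ?l\<^sup>2 * (norm (transpose \<xi> ** x))\<^sup>2) \<le> 6 * ?l\<^sup>2 + - ((norm G)\<^sup>2 + (norm (transpose G ** x))\<^sup>2)"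
    using 1 2 by (simp add: algebra_simps)
  then show ?thesis by (simp only: exp_add[symmetric] exp_le_cancel_iff)
qed

text \<open>Multiply the average by the volume \<open>c e\<close> of a cap, write that volume as an
  integral over G, pass to the Gaussian in G, and interchange. What appears is the \<mu>-measure
  \<open>kap e G\<close> of the frames near G, which is bounded by a constant times
  \<open>c e\<close>. So \<open>c e\<close> cancels, and the constant is independent of x although e
  depends on it.\<close>

lemma frame_average_le:
  fixes \<mu> :: "(real ^ 'l ^ ('k::finite + 'l::finite)) measure"
    and g :: "real ^ 'l ^ ('k + 'l) \<Rightarrow> real ^ ('k + 'l) ^ ('k + 'l)"
  assumes \<mu>: "stiefel_invariant_measure \<mu>" and g: "rotation_choice g"
  obtains K where "0 \<le> K" "\<And>x :: real ^ 'm ^ ('k + 'l).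
    (\<integral>\<^sup>+\<xi>. ennreal (exp (- (8 * (real CARD('l))\<^sup>2 * (norm (transpose \<xi> ** x))\<^sup>2))) \<partial>\<mu>)
      \<le> ennreal K * (\<integral>\<^sup>+G. ennreal (exp (- ((norm G)\<^sup>2 + (norm (transpose G ** x))\<^sup>2))) \<partial>(lborel :: (real ^ 'l ^ ('k + 'l)) measure))"
proof -
  interpret finite_measure \<mu> by (rule stiefel_measure_finite[OF \<mu>])
  interpret P: pair_sigma_finite \<mu> "lborel :: (real ^ 'l ^ ('k + 'l)) measure" ..
  have Em: "(\<lambda>G :: real ^ 'l ^ ('k + 'l). ennreal (exp (- ((norm G)\<^sup>2 + (norm (transpose G ** x))\<^sup>2)))) \<in> borel_measurable borel"
    for x :: "real ^ 'm ^ ('k + 'l)" by measurable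
  note [measurable] = stiefel_measure_measurable[OF \<mu>]
  note sp = stiefel_measure_space[OF \<mu>]
  let ?b = "base_frame :: real ^ 'l ^ ('k + 'l)"
  define c where "c e = emeasure lborel (cap e ?b)" for e
  obtain C where C: "0 \<le> C" "\<And>e. 0 < e \<Longrightarrow> e \<le> 1 \<Longrightarrow> c (4 * e) \<le> ennreal C * c e"
    "\<And>e. 0 < e \<Longrightarrow> e \<le> 1 \<Longrightarrow> 0 < c e \<and> c e < \<infinity>"
    unfolding c_def using cap_volume_doubling[where 'k='k and 'l='l] by blast
  \<comment> \<open>Here \<open>g\<close> only supplies orthogonal matrices that carry
    \<open>base_frame\<close> to an arbitrary frame, which makes cap volumes equal at all
    frames.\<close>
  have c: "emeasure lborel (cap e \<xi>) = c e" if "\<xi> \<in> stiefel" for e and \<xi> :: "real ^ 'l ^ ('k + 'l)"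
    using cap_volume_orthogonal[OF rotation_choice_orthogonal(1)[OF g that], of e ?b]
    by (simp add: rotation_choice_orthogonal(2)[OF g that] c_def)
  define q where "q d = emeasure \<mu> {\<xi> \<in> space \<mu>. near_frame d \<xi> ?b}" for d
  have q: "emeasure \<mu> {\<xi> \<in> space \<mu>. near_frame d \<xi> \<eta>} = q d" if \<eta>: "\<eta> \<in> stiefel" for d \<eta>
  proof -
    note \<gamma> = rotation_choice_orthogonal[OF g \<eta>]
    let ?A = "{\<xi> \<in> space \<mu>. near_frame d \<xi> \<eta>}"
    have inv: "distr \<mu> \<mu> (\<lambda>\<xi>. g \<eta> ** \<xi>) = \<mu>"
      using \<mu> \<gamma>(1) by (simp add: stiefel_invariant_measure_def)
    have s: "sets \<mu> = sets (restrict_space borel stiefel)"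
      using \<mu> by (simp add: stiefel_invariant_measure_def)
    have m: "(\<lambda>\<xi>. g \<eta> ** \<xi>) \<in> measurable \<mu> \<mu>"
      unfolding measurable_cong_sets[OF refl s]
      by (rule measurable_restrict_space2) (auto simp: sp stiefel_orthogonal_mult[OF \<gamma>(1)])
    have "emeasure \<mu> ?A = emeasure (distr \<mu> \<mu> (\<lambda>\<xi>. g \<eta> ** \<xi>)) ?A" by (simp only: inv)
    also have "\<dots> = emeasure \<mu> ((\<lambda>\<xi>. g \<eta> ** \<xi>) -` ?A \<inter> space \<mu>)"
      by (rule emeasure_distr[OF m]) measurable
    also have "(\<lambda>\<xi>. g \<eta> ** \<xi>) -` ?A \<inter> space \<mu> = {\<xi> \<in> space \<mu>. near_frame d \<xi> ?b}"
      using near_frame_orthogonal[OF \<gamma>(1), of d _ ?b]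
      by (auto simp: sp stiefel_orthogonal_mult[OF \<gamma>(1)] \<gamma>(2))
    finally show ?thesis by (simp add: q_def)
  qed
  define kap where "kap e G = emeasure \<mu> {\<xi> \<in> space \<mu>. near_frame e \<xi> G}" for e G
  \<comment> \<open>By invariance of \<mu>, the frames near a given frame \<eta> have a measure
    \<open>q\<close> independent of \<eta>. Factoring G transfers this to well conditioned
    matrices.\<close>
  have kap: "kap e G \<le> q (2 * e)" "q e \<le> kap (2 * e) G" if e: "0 \<le> e" and G: "G \<in> well_conditioned" for e G
  proof -
    obtain \<eta> :: "real ^ 'l ^ ('k + 'l)" and T where \<eta>: "\<eta> \<in> stiefel" and GT: "G = \<eta> ** T"
      using well_conditioned_factor[OF G] .
    show "kap e G \<le> q (2 * e)"
      unfolding kap_def q[OF \<eta>, symmetric] GT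
      by (rule emeasure_mono) (use near_frame_factor(1)[OF \<eta> G[unfolded GT] e] in auto)
    show "q e \<le> kap (2 * e) G"
      unfolding kap_def q[OF \<eta>, symmetric] GT
      by (rule emeasure_mono) (use near_frame_factor(2)[OF \<eta> G[unfolded GT] e] in auto)
  qed
  have swap: "(\<integral>\<^sup>+\<xi>. \<integral>\<^sup>+G. f G * indicator (cap e \<xi>) G \<partial>lborel \<partial>\<mu>)
      = (\<integral>\<^sup>+G. f G * (indicator well_conditioned G * kap e G) \<partial>lborel)"
    if [measurable]: "f \<in> borel_measurable borel" for f :: "real ^ 'l ^ ('k + 'l) \<Rightarrow> ennreal" and e
  proof -
    have ind: "indicator (cap e \<xi>) G = (if G \<in> well_conditioned \<and> near_frame e \<xi> G then 1 else 0 :: ennreal)" for \<xi> G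
      by (simp add: cap_def)
    have "(\<integral>\<^sup>+\<xi>. \<integral>\<^sup>+G. f G * indicator (cap e \<xi>) G \<partial>lborel \<partial>\<mu>) = (\<integral>\<^sup>+G. \<integral>\<^sup>+\<xi>. f G * indicator (cap e \<xi>) G \<partial>\<mu> \<partial>lborel)"
      unfolding ind by (rule P.Fubini'[symmetric]) measurable
    also have "\<dots> = (\<integral>\<^sup>+G. \<integral>\<^sup>+\<xi>. (f G * indicator well_conditioned G) * indicator {\<xi> \<in> space \<mu>. near_frame e \<xi> G} \<xi> \<partial>\<mu> \<partial>lborel)"
      by (intro nn_integral_cong) (auto simp: cap_def indicator_def)
    also have "\<dots> = (\<integral>\<^sup>+G. (f G * indicator well_conditioned G) * kap e G \<partial>lborel)"
      unfolding kap_def by (intro nn_integral_cong nn_integral_cmult_indicator) measurable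
    finally show ?thesis by (simp add: mult.assoc)
  qed
  define m where "m = measure \<mu> (space \<mu>)"
  have m: "emeasure \<mu> (space \<mu>) = ennreal m" by (simp add: m_def emeasure_eq_measure)
  have m0: "0 \<le> m" by (simp add: m_def)
  \<comment> \<open>Integrating the kernel against the constant 1 in both orders compares
    \<open>q\<close> with cap volumes. This replaces a formula for the invariant measure;
    \<open>c 1\<close> serves as a positive lower bound for the volume of
    \<open>well_conditioned\<close>.\<close>
  have q_le: "q (2 * e) * c 1 \<le> ennreal m * c (4 * e)" if e: "0 < e" for e
  proof -
    have "q (2 * e) * c 1 \<le> q (2 * e) * emeasure lborel (well_conditioned :: (real ^ 'l ^ ('k + 'l)) set)"
      unfolding c_def using borel_closed[OF closed_well_conditioned]
      by (intro mult_left_mono emeasure_mono) (auto simp: cap_def)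
    also have "\<dots> = (\<integral>\<^sup>+G. q (2 * e) * indicator (well_conditioned :: (real ^ 'l ^ ('k + 'l)) set) G \<partial>lborel)"
      using borel_closed[OF closed_well_conditioned] by (intro nn_integral_cmult_indicator[symmetric]) auto
    also have "\<dots> \<le> (\<integral>\<^sup>+G. 1 * (indicator (well_conditioned :: (real ^ 'l ^ ('k + 'l)) set) G * kap (4 * e) G) \<partial>lborel)"
      using kap(2)[of "2 * e"] e by (intro nn_integral_mono) (auto simp: indicator_def)
    also have "\<dots> = (\<integral>\<^sup>+\<xi>. \<integral>\<^sup>+G. 1 * indicator (cap (4 * e) \<xi>) G \<partial>(lborel :: (real ^ 'l ^ ('k + 'l)) measure) \<partial>\<mu>)"
      by (rule swap[symmetric]) simp
    also have "\<dots> = (\<integral>\<^sup>+\<xi>. c (4 * e) \<partial>\<mu>)"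
      by (intro nn_integral_cong) (simp add: cap_borel c sp)
    also have "\<dots> = ennreal m * c (4 * e)" by (simp add: m mult.commute)
    finally show ?thesis .
  qed
  define c1 where "c1 = enn2real (c 1)"
  have c1: "c 1 = ennreal c1" "c1 > 0"
    using C(3)[of 1] by (auto simp: c1_def enn2real_positive_iff)
  have q_c: "q (2 * e) \<le> ennreal (m * C / c1) * c e" if e: "0 < e" "e \<le> 1" for e
  proof -
    have "q (2 * e) * c 1 \<le> ennreal m * (ennreal C * c e)"
      using q_le[OF e(1)] mult_left_mono[OF C(2)[OF e], of "ennreal m"] by (auto intro: order_trans)
    then have "ennreal (1 / c1) * (q (2 * e) * ennreal c1) \<le> ennreal (1 / c1) * (ennreal m * (ennreal C * c e))"
      unfolding c1(1) by (rule mult_left_mono) simp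
    moreover have "ennreal (1 / c1) * (q (2 * e) * ennreal c1) = q (2 * e)"
    proof -
      have "ennreal (1 / c1) * ennreal c1 = 1" using c1(2) by (simp add: ennreal_mult[symmetric])
      then show ?thesis by (metis mult.assoc mult.commute mult_1)
    qed
    moreover have "ennreal (1 / c1) * (ennreal m * (ennreal C * c e)) = ennreal (m * C / c1) * c e"
      using c1(2) m0 C(1) by (simp add: divide_inverse ennreal_mult mult_ac)
    ultimately show ?thesis by simp
  qed
  define K where "K = exp (6 * (real CARD('l))\<^sup>2) * (m * C / c1)"
  show thesis
  proof (rule that[of K])
    show K0: "0 \<le> K" using m0 C(1) c1(2) by (simp add: K_def)
    fix x :: "real ^ 'm ^ ('k + 'l)"
    let ?w = "\<lambda>\<xi> :: real ^ 'l ^ ('k + 'l). ennreal (exp (- (8 * (real CARD('l))\<^sup>2 * (norm (transpose \<xi> ** x))\<^sup>2)))"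
    let ?E = "\<lambda>G :: real ^ 'l ^ ('k + 'l). ennreal (exp (- ((norm G)\<^sup>2 + (norm (transpose G ** x))\<^sup>2)))"
    \<comment> \<open>The scale at which \<open>gaussian_near_frame_le\<close> applies to this
      x.\<close>
    define e where "e = 1 / (1 + norm x)"
    have e: "0 < e" "e \<le> 1" by (simp_all add: e_def add_pos_nonneg)
    note ce = C(3)[OF e]
    have "(\<integral>\<^sup>+\<xi>. ?w \<xi> \<partial>\<mu>) * c e = (\<integral>\<^sup>+\<xi>. ?w \<xi> * c e \<partial>\<mu>)"
      by (rule nn_integral_multc[symmetric]) measurable
    also have "\<dots> = (\<integral>\<^sup>+\<xi>. \<integral>\<^sup>+G. ?w \<xi> * indicator (cap e \<xi>) G \<partial>lborel \<partial>\<mu>)"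
      by (intro nn_integral_cong) (simp add: nn_integral_cmult_indicator cap_borel c sp)
    also have "\<dots> \<le> (\<integral>\<^sup>+\<xi>. \<integral>\<^sup>+G. (ennreal (exp (6 * (real CARD('l))\<^sup>2)) * ?E G) * indicator (cap e \<xi>) G \<partial>lborel \<partial>\<mu>)"
      using gaussian_near_frame_le[of _ x] unfolding e_def
      by (intro nn_integral_mono) (auto simp: indicator_def sp ennreal_mult[symmetric] intro!: ennreal_leI)
    also have "\<dots> = (\<integral>\<^sup>+G. (ennreal (exp (6 * (real CARD('l))\<^sup>2)) * ?E G) * (indicator well_conditioned G * kap e G) \<partial>lborel)"
      by (rule swap) measurable
    also have "\<dots> \<le> (\<integral>\<^sup>+G. (ennreal (exp (6 * (real CARD('l))\<^sup>2)) * ?E G) * (ennreal (m * C / c1) * c e) \<partial>lborel)"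
    proof (intro nn_integral_mono mult_left_mono)
      fix G :: "real ^ 'l ^ ('k + 'l)"
      show "indicator well_conditioned G * kap e G \<le> ennreal (m * C / c1) * c e"
        using kap(1)[of e G] q_c[OF e] e by (cases "G \<in> well_conditioned") auto
    qed simp
    also have "\<dots> = (\<integral>\<^sup>+G. (ennreal K * c e) * ?E G \<partial>lborel)"
    proof -
      have "ennreal K = ennreal (exp (6 * (real CARD('l))\<^sup>2)) * ennreal (m * C / c1)"
        unfolding K_def by (rule ennreal_mult') simp
      then show ?thesis by (simp only: mult_ac)
    qed
    also have "\<dots> = (ennreal K * c e) * (\<integral>\<^sup>+G. ?E G \<partial>lborel)"
      by (rule nn_integral_cmult) (simp add: Em)
    finally have "c e * (\<integral>\<^sup>+\<xi>. ?w \<xi> \<partial>\<mu>) \<le> c e * (ennreal K * (\<integral>\<^sup>+G. ?E G \<partial>lborel))"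
      by (simp only: mult_ac)
    then show "(\<integral>\<^sup>+\<xi>. ?w \<xi> \<partial>\<mu>) \<le> ennreal K * (\<integral>\<^sup>+G. ?E G \<partial>lborel)"
      using ce by (subst (asm) ennreal_mult_le_mult_iff) auto
  qed
qed

section \<open>The Gaussian average as a power of one integral\<close>

lemma gauss_int_ennreal:
  fixes X :: "'m \<Rightarrow> real ^ 'n"
  assumes "finite C"
  shows "(\<integral>\<^sup>+g. ennreal (exp (- ((norm g)\<^sup>2 + (\<Sum>j\<in>C. (X j \<bullet> g)\<^sup>2)))) \<partial>lborel) = ennreal (gauss_int C X)"
    and "gauss_int C X \<le> enn2real (\<integral>\<^sup>+z. ennreal (exp (- (norm z)\<^sup>2)) \<partial>(lborel :: (real ^ 'n) measure))"
proof -
  have le: "(\<integral>\<^sup>+g. ennreal (exp (- ((norm g)\<^sup>2 + (\<Sum>j\<in>C. (X j \<bullet> g)\<^sup>2)))) \<partial>lborel)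
     \<le> (\<integral>\<^sup>+z. ennreal (exp (- (norm z)\<^sup>2)) \<partial>(lborel :: (real ^ 'n) measure))"
    by (intro nn_integral_mono ennreal_leI) (simp add: sum_nonneg)
  also have "\<dots> < \<infinity>" by (rule gaussian_nn_integral_finite)
  finally show "(\<integral>\<^sup>+g. ennreal (exp (- ((norm g)\<^sup>2 + (\<Sum>j\<in>C. (X j \<bullet> g)\<^sup>2)))) \<partial>lborel) = ennreal (gauss_int C X)"
    by (simp add: gauss_int_def)
  show "gauss_int C X \<le> enn2real (\<integral>\<^sup>+z. ennreal (exp (- (norm z)\<^sup>2)) \<partial>(lborel :: (real ^ 'n) measure))"
    unfolding gauss_int_def using le gaussian_nn_integral_finite[where 'a="real ^ 'n"]
    by (intro enn2real_mono) auto
qed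

lemma gauss_int_nonneg: "0 \<le> gauss_int C X"
  by (simp add: gauss_int_def)

text \<open>The exponent is a sum over the columns of G. After transposition these are independent
  rows, so the integral is a product of \<open>CARD('l)\<close> equal factors.\<close>

lemma nn_integral_gaussian_frames:
  fixes x :: "real ^ 'm ^ 'n"
  shows "(\<integral>\<^sup>+G. ennreal (exp (- ((norm G)\<^sup>2 + (norm (transpose G ** x))\<^sup>2))) \<partial>(lborel :: (real ^ 'l ^ 'n) measure))
    = ennreal (gauss_int UNIV (\<lambda>j. column j x) ^ CARD('l))"
proof -
  interpret product_sigma_finite "\<lambda>_::'l. lborel :: (real ^ 'n) measure" ..
  let ?F = "\<lambda>H :: real ^ 'n ^ 'l. ennreal (exp (- ((norm H)\<^sup>2 + (norm (H ** x))\<^sup>2)))"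
  let ?f = "\<lambda>g. ennreal (exp (- ((norm g)\<^sup>2 + (\<Sum>j\<in>UNIV. (column j x \<bullet> g)\<^sup>2))))"
  have Fm: "?F \<in> borel_measurable borel" by measurable
  have Fp: "?F (\<chi> i. X i) = (\<Prod>i\<in>UNIV. ?f (X i))" for X
  proof -
    have "(norm ((\<chi> i. X i) ** x))\<^sup>2 = (\<Sum>i\<in>UNIV. \<Sum>j\<in>UNIV. (column j x \<bullet> X i)\<^sup>2)"
      by (simp add: norm_vec_power2 matrix_matrix_mult_def column_def inner_vec_def mult.commute)
    then have "- ((norm (\<chi> i. X i))\<^sup>2 + (norm ((\<chi> i. X i) ** x))\<^sup>2)
        = (\<Sum>i\<in>UNIV. - ((norm (X i))\<^sup>2 + (\<Sum>j\<in>UNIV. (column j x \<bullet> X i)\<^sup>2)))"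
      by (simp add: norm_vec_power2[of "\<chi> i. X i"] sum_negf sum.distrib sum_subtractf)
    then show ?thesis by (simp only: exp_sum[OF finite] prod_ennreal[OF exp_ge_zero, symmetric])
  qed
  have "(\<integral>\<^sup>+G. ennreal (exp (- ((norm G)\<^sup>2 + (norm (transpose G ** x))\<^sup>2))) \<partial>(lborel :: (real ^ 'l ^ 'n) measure))
     = (\<integral>\<^sup>+G. ?F (transpose G) \<partial>(lborel :: (real ^ 'l ^ 'n) measure))" by simp
  also have "\<dots> = (\<integral>\<^sup>+H. ?F H \<partial>lborel)" by (rule nn_integral_transpose[OF Fm])
  also have "\<dots> = (\<integral>\<^sup>+X. (\<Prod>i\<in>UNIV. ?f (X i)) \<partial>(\<Pi>\<^sub>M i\<in>(UNIV :: 'l set). lborel))"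
    unfolding nn_integral_lborel_vec[OF Fm] Fp ..
  also have "\<dots> = (\<Prod>i\<in>(UNIV :: 'l set). \<integral>\<^sup>+g. ?f g \<partial>lborel)"
    by (rule product_nn_integral_prod) measurable
  also have "\<dots> = ennreal (gauss_int UNIV (\<lambda>j. column j x) ^ CARD('l))"
    unfolding gauss_int_ennreal(1)[OF finite] by (simp add: ennreal_power gauss_int_nonneg)
  finally show ?thesis .
qed

lemma borel_measurable_gauss_int_columns:
  "(\<lambda>x :: real ^ 'm ^ 'n. gauss_int UNIV (\<lambda>j. column j x)) \<in> borel_measurable borel"
proof -
  have c: "column j x \<bullet> g = (\<Sum>i\<in>UNIV. x $ i $ j * g $ i)" for j g and x :: "real ^ 'm ^ 'n"
    by (simp add: column_def inner_vec_def)
  have [measurable]: "(\<lambda>p. (fst p :: real ^ 'm ^ 'n) $ i $ j) \<in> borel_measurable (borel \<Otimes>\<^sub>M borel)"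
    "(\<lambda>p. (snd p :: real ^ 'n) $ i) \<in> borel_measurable ((borel :: (real ^ 'm ^ 'n) measure) \<Otimes>\<^sub>M borel)" for i j
    by (intro borel_measurable_vec_nth; simp)+
  show ?thesis
    unfolding gauss_int_def c by measurable
qed

lemma gauss_int_columns_nn_integral_finite:
  assumes "real CARD('n) + real CARD('m) - 1 < lam"
  shows "(\<integral>\<^sup>+x. ennreal (gauss_int UNIV (\<lambda>j. column j x) powr lam) \<partial>(lborel :: (real ^ 'm ^ 'n) measure)) < \<infinity>"
proof -
  let ?F = "\<lambda>x :: real ^ 'm ^ 'n. ennreal (gauss_int UNIV (\<lambda>j. column j x) powr lam)"
  have Fm: "?F \<in> borel_measurable borel"
    using borel_measurable_gauss_int_columns by measurable
  have Fm': "(\<lambda>y. ?F (transpose y)) \<in> borel_measurable borel"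
    by (rule measurable_compose[OF _ Fm]) measurable
  have "(\<integral>\<^sup>+x. ?F x \<partial>lborel) = (\<integral>\<^sup>+y. ?F (transpose y) \<partial>lborel)"
    by (rule nn_integral_transpose[OF Fm, symmetric])
  also have "\<dots> = (\<integral>\<^sup>+X. ennreal (gauss_int (UNIV :: 'm set) X powr lam) \<partial>(\<Pi>\<^sub>M j\<in>UNIV. (lborel :: (real ^ 'n) measure)))"
    by (subst nn_integral_lborel_vec[OF Fm']) (simp add: row_def)
  also have "\<dots> < \<infinity>"
    by (rule gauss_int_powr_nn_integral_finite) (use assms in auto)
  finally show ?thesis .
qed

section \<open>Sufficiency\<close>

text \<open>Young's inequality with crude constants: either b is at most a powr (r - 1) and the
  first term dominates the product, or the second does. It takes the place of the Hoelder
  inequality.\<close>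

lemma mult_le_powr_add:
  fixes a b r :: real
  assumes "0 \<le> a" "0 \<le> b" "1 < r"
  shows "a * b \<le> a powr r + b powr (r / (r - 1))"
proof (cases "a = 0 \<or> b = 0")
  case False
  then have ab: "0 < a" "0 < b" using assms by auto
  show ?thesis
  proof (cases "b \<le> a powr (r - 1)")
    case True
    then have "a * b \<le> a powr 1 * a powr (r - 1)" using ab by simp
    also have "\<dots> = a powr r" using ab by (subst powr_add[symmetric]) simp
    finally show ?thesis using powr_ge_zero[of b "r / (r - 1)"] by linarith
  next
    case False
    have "a = (a powr (r - 1)) powr (1 / (r - 1))" using ab assms by (simp add: powr_powr)
    also have "\<dots> \<le> b powr (1 / (r - 1))" using False assms by (intro powr_mono2) auto
    finally have "a * b \<le> b powr (1 / (r - 1)) * b powr 1" using ab by simp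
    also have "\<dots> = b powr (r / (r - 1))"
      using ab assms by (subst powr_add[symmetric]) (simp add: field_simps)
    finally show ?thesis using powr_ge_zero[of a r] by linarith
  qed
qed (use assms in auto)

lemma lebesgue_measurable_ex_borel:
  fixes f :: "'a::euclidean_space \<Rightarrow> complex"
  assumes "f \<in> borel_measurable lebesgue"
  obtains f0 where "f0 \<in> borel_measurable borel" "AE x in lborel. f x = f0 x"
proof -
  have "(\<lambda>x. Re (f x)) \<in> borel_measurable lebesgue" "(\<lambda>x. Im (f x)) \<in> borel_measurable lebesgue"
    using assms by measurable
  then obtain a b where ab: "a \<in> borel_measurable lborel" "b \<in> borel_measurable lborel"
    "AE x in lborel. Re (f x) = a x" "AE x in lborel. Im (f x) = b x"
    using completion_ex_borel_measurable_real by metis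
  show thesis
  proof
    have [measurable]: "a \<in> borel_measurable borel" "b \<in> borel_measurable borel"
      using ab(1,2) by simp_all
    show "(\<lambda>x. complex_of_real (a x) + \<i> * complex_of_real (b x)) \<in> borel_measurable borel" by measurable
    show "AE x in lborel. f x = complex_of_real (a x) + \<i> * complex_of_real (b x)"
      using ab(3,4) by eventually_elim (simp add: complex_eq_iff)
  qed
qed

text \<open>The weighted integral of \<open>radon_AE_finite\<close> is bounded by the pairing of f
  with \<open>J\<close> to the power \<open>CARD('l)\<close>. Young's inequality handles it for r >
  1, boundedness of \<open>J\<close> for r = 1. The rest of the proof transfers the conclusion from
  a Borel representative to f.\<close>

lemma radon_AE_finite_Lp:
  fixes \<mu> :: "(real ^ 'l ^ ('k::finite + 'l::finite)) measure"
    and g :: "real ^ 'l ^ ('k + 'l) \<Rightarrow> real ^ ('k + 'l) ^ ('k + 'l)"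
    and f :: "real ^ 'm ^ ('k + 'l) \<Rightarrow> complex"
  assumes \<mu>: "stiefel_invariant_measure \<mu>" and g: "rotation_choice g"
    and r: "1 \<le> r" "r * (real CARD('k) + real CARD('m) - 1) < real CARD('k) + real CARD('l) + real CARD('m) - 1"
    and f: "f \<in> borel_measurable lebesgue" "integrable lebesgue (\<lambda>x. norm (f x) powr r)"
  shows "AE (\<xi>, t) in \<mu> \<Otimes>\<^sub>M (lebesgue :: (real ^ 'm ^ 'l) measure). radon_finite g f \<xi> t"
proof -
  let ?l = "real CARD('l)"
  obtain f0 where f0[measurable]: "f0 \<in> borel_measurable borel" and ff0: "AE x in lborel. f x = f0 x"
    using lebesgue_measurable_ex_borel[OF f(1)] .
  obtain N where N: "{x \<in> space lborel. f x \<noteq> f0 x} \<subseteq> N" "N \<in> null_sets lborel"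
    using ff0 by (auto elim!: AE_E simp: null_sets_def)
  have Nb[measurable]: "N \<in> sets borel" using N(2) by auto
  \<comment> \<open>The infinite values on \<open>N\<close> do not change the integral over the
    whole space, but they make a finite integral over a plane detect that the plane avoids
    \<open>N\<close> almost everywhere.\<close>
  define F where "F x = ennreal (norm (f0 x)) + \<infinity> * indicator N x" for x
  have Fm[measurable]: "F \<in> borel_measurable borel"
    unfolding F_def by (intro borel_measurable_add borel_measurable_times_ennreal borel_measurable_indicator) measurable
  have FN: "AE x in lborel. F x = ennreal (norm (f0 x))"
    using AE_not_in[OF N(2)] by eventually_elim (simp add: F_def)
  have fin_r: "(\<integral>\<^sup>+x. ennreal (norm (f0 x) powr r) \<partial>lborel) < \<infinity>"
  proof -
    have "(\<integral>\<^sup>+x. ennreal (norm (f0 x) powr r) \<partial>lborel) = (\<integral>\<^sup>+x. ennreal (norm (f x) powr r) \<partial>lborel)"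
    proof (rule nn_integral_cong_AE)
      show "AE x in lborel. ennreal (norm (f0 x) powr r) = ennreal (norm (f x) powr r)"
        using ff0 by eventually_elim simp
    qed
    also have "\<dots> = (\<integral>\<^sup>+x. ennreal (norm (norm (f x) powr r)) \<partial>lebesgue)"
      by (simp add: nn_integral_completion)
    also have "\<dots> < \<infinity>" using f(2) by (simp add: integrable_iff_bounded)
    finally show ?thesis .
  qed
  define w where "w t = ennreal (exp (- (8 * ?l\<^sup>2 * (norm t)\<^sup>2)))" for t :: "real ^ 'm ^ 'l"
  have wm: "w \<in> borel_measurable borel" unfolding w_def by measurable
  define J where "J x = gauss_int UNIV (\<lambda>j. column j x)" for x :: "real ^ 'm ^ ('k + 'l)"
  have Jm[measurable]: "J \<in> borel_measurable borel" unfolding J_def by (rule borel_measurable_gauss_int_columns)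
  have J0: "0 \<le> J x" for x by (simp add: J_def gauss_int_nonneg)
  obtain K where K: "0 \<le> K" "\<And>x :: real ^ 'm ^ ('k + 'l).
    (\<integral>\<^sup>+\<xi>. w (transpose \<xi> ** x) \<partial>\<mu>) \<le> ennreal K * ennreal (J x ^ CARD('l))"
    using frame_average_le[OF \<mu> g, where 'm='m] unfolding nn_integral_gaussian_frames J_def w_def by metis
  have "(\<integral>\<^sup>+x. F x * (\<integral>\<^sup>+\<xi>. w (transpose \<xi> ** x) \<partial>\<mu>) \<partial>lborel)
     = (\<integral>\<^sup>+x. ennreal (norm (f0 x)) * (\<integral>\<^sup>+\<xi>. w (transpose \<xi> ** x) \<partial>\<mu>) \<partial>lborel)"
  proof (rule nn_integral_cong_AE)
    show "AE x in lborel. F x * (\<integral>\<^sup>+\<xi>. w (transpose \<xi> ** x) \<partial>\<mu>) = ennreal (norm (f0 x)) * (\<integral>\<^sup>+\<xi>. w (transpose \<xi> ** x) \<partial>\<mu>)"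
      using FN by eventually_elim simp
  qed
  also have "\<dots> \<le> (\<integral>\<^sup>+x. ennreal K * ennreal (norm (f0 x) * J x ^ CARD('l)) \<partial>lborel)"
  proof (rule nn_integral_mono)
    fix x
    have "ennreal (norm (f0 x)) * (\<integral>\<^sup>+\<xi>. w (transpose \<xi> ** x) \<partial>\<mu>) \<le> ennreal (norm (f0 x)) * (ennreal K * ennreal (J x ^ CARD('l)))"
      by (intro mult_left_mono K(2)) simp
    also have "\<dots> = ennreal K * ennreal (norm (f0 x) * J x ^ CARD('l))"
      by (simp add: ennreal_mult J0 mult_ac)
    finally show "ennreal (norm (f0 x)) * (\<integral>\<^sup>+\<xi>. w (transpose \<xi> ** x) \<partial>\<mu>) \<le> ennreal K * ennreal (norm (f0 x) * J x ^ CARD('l))" .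
  qed
  also have "\<dots> = ennreal K * (\<integral>\<^sup>+x. ennreal (norm (f0 x) * J x ^ CARD('l)) \<partial>lborel)"
    by (rule nn_integral_cmult) measurable
  also have "\<dots> < \<infinity>"
  proof -
    have "(\<integral>\<^sup>+x. ennreal (norm (f0 x) * J x ^ CARD('l)) \<partial>lborel) < \<infinity>"
    \<comment> \<open>For r = 1 the conjugate exponent is infinite, so a uniform bound on
      \<open>J\<close> is used instead of its integrability.\<close>
    proof (cases "r = 1")
      case True
      define B where "B = enn2real (\<integral>\<^sup>+z. ennreal (exp (- (norm z)\<^sup>2)) \<partial>(lborel :: (real ^ ('k + 'l)) measure))"
      have JB: "J x \<le> B" for x unfolding J_def B_def by (rule gauss_int_ennreal(2)) simp
      have B0: "0 \<le> B" by (simp add: B_def)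
      have "(\<integral>\<^sup>+x. ennreal (norm (f0 x) * J x ^ CARD('l)) \<partial>lborel) \<le> (\<integral>\<^sup>+x. ennreal (B ^ CARD('l)) * ennreal (norm (f0 x) powr r) \<partial>lborel)"
        using JB J0 B0 True
        by (intro nn_integral_mono) (simp add: ennreal_mult[symmetric] ennreal_leI mult.commute mult_left_mono power_mono)
      also have "\<dots> = ennreal (B ^ CARD('l)) * (\<integral>\<^sup>+x. ennreal (norm (f0 x) powr r) \<partial>lborel)"
        by (rule nn_integral_cmult) measurable
      also have "\<dots> < \<infinity>" using fin_r by (simp add: ennreal_mult_less_top)
      finally show ?thesis .
    next
      case False
      then have r1: "1 < r" using r(1) by simp
      define lam where "lam = ?l * (r / (r - 1))"
      \<comment> \<open>Since k + l = n, this is the hypothesis on r rearranged; after division by r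
        - 1 it says that \<open>lam\<close> exceeds the integrability threshold for
        \<open>J\<close>.\<close>
      have "(real CARD('k) + ?l + real CARD('m) - 1) * (r - 1) < ?l * r"
        using r(2) by (simp add: algebra_simps)
      then have lam: "real CARD('k + 'l) + real CARD('m) - 1 < lam"
        using r1 by (simp add: lam_def field_simps)
      have "(\<integral>\<^sup>+x. ennreal (norm (f0 x) * J x ^ CARD('l)) \<partial>lborel)
         \<le> (\<integral>\<^sup>+x. ennreal (norm (f0 x) powr r) + ennreal (J x powr lam) \<partial>lborel)"
      proof (rule nn_integral_mono)
        fix x
        have "(J x ^ CARD('l)) powr (r / (r - 1)) = J x powr lam"
          using J0[of x] r1 by (cases "J x = 0") (simp_all add: lam_def powr_realpow[symmetric] powr_powr)
        then show "ennreal (norm (f0 x) * J x ^ CARD('l)) \<le> ennreal (norm (f0 x) powr r) + ennreal (J x powr lam)"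
          using mult_le_powr_add[of "norm (f0 x)" "J x ^ CARD('l)" r] r1 J0[of x]
          by (simp add: ennreal_plus[symmetric] ennreal_leI del: ennreal_plus)
      qed
      also have "\<dots> = (\<integral>\<^sup>+x. ennreal (norm (f0 x) powr r) \<partial>lborel) + (\<integral>\<^sup>+x. ennreal (J x powr lam) \<partial>lborel)"
        by (rule nn_integral_add) measurable
      also have "\<dots> < \<infinity>"
        using fin_r gauss_int_columns_nn_integral_finite[OF lam] by (simp add: J_def)
      finally show ?thesis .
    qed
    then show ?thesis by (simp add: ennreal_mult_less_top)
  qed
  finally have "AE (\<xi>, t) in \<mu> \<Otimes>\<^sub>M (lebesgue :: (real ^ 'm ^ 'l) measure). (\<integral>\<^sup>+\<omega>. F (g \<xi> ** stack_rows \<omega> t) \<partial>lborel) < \<infinity>"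
    by (intro radon_AE_finite[OF \<mu> Fm wm _ g]) (auto simp: w_def ennreal_eq_0_iff not_le)
  then show ?thesis
  proof (rule AE_mp, intro AE_I2 impI, clarify)
    fix \<xi> :: "real ^ 'l ^ ('k + 'l)" and t :: "real ^ 'm ^ 'l"
    define h :: "real ^ 'm ^ 'k \<Rightarrow> _" where "h \<omega> = g \<xi> ** stack_rows \<omega> t" for \<omega>
    have hm[measurable]: "h \<in> borel_measurable borel" unfolding h_def by measurable
    assume "(\<integral>\<^sup>+\<omega>. F (g \<xi> ** stack_rows \<omega> t) \<partial>lborel) < \<infinity>"
    then have fin: "(\<integral>\<^sup>+\<omega>. F (h \<omega>) \<partial>lborel) \<noteq> \<infinity>" by (simp add: h_def less_top)
    \<comment> \<open>Almost every point of the plane misses \<open>N\<close>, so on the plane f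
      agrees almost everywhere with the Borel function \<open>f0\<close>. This gives measurability
      of the restriction of f as well as its integrability.\<close>
    have "AE \<omega> in lborel. F (h \<omega>) \<noteq> \<infinity>"
      by (rule nn_integral_PInf_AE[OF _ fin]) measurable
    then have ae: "AE \<omega> in lborel. f0 (h \<omega>) = f (h \<omega>)"
    proof eventually_elim
      case (elim \<omega>)
      then have "h \<omega> \<notin> N" by (auto simp: F_def)
      then have "\<not> (f (h \<omega>) \<noteq> f0 (h \<omega>))" using N(1) by auto
      then show ?case by simp
    qed
    have m0: "(\<lambda>\<omega>. f0 (h \<omega>)) \<in> borel_measurable borel" by measurable
    have "(\<integral>\<^sup>+\<omega>. ennreal (norm (f0 (h \<omega>))) \<partial>lborel) \<le> (\<integral>\<^sup>+\<omega>. F (h \<omega>) \<partial>lborel)"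
      by (intro nn_integral_mono) (simp add: F_def)
    then have "integrable lborel (\<lambda>\<omega>. f0 (h \<omega>))"
      using fin m0 by (intro integrableI_bounded) (auto simp: less_top[symmetric] top_unique)
    then have i: "integrable lebesgue (\<lambda>\<omega>. f0 (h \<omega>))"
      using m0 by (subst integrable_completion) auto
    have ae': "AE \<omega> in lebesgue. f0 (h \<omega>) = f (h \<omega>)" using ae by (rule AE_completion)
    have "(\<lambda>\<omega>. f (h \<omega>)) \<in> borel_measurable lebesgue"
      by (rule borel_measurable_AE[OF borel_measurable_integrable[OF i]]) (use ae' in auto)
    then have "integrable lebesgue (\<lambda>\<omega>. f (h \<omega>))"
      using i ae' borel_measurable_integrable[OF i] integrable_cong_AE by blast
    then show "radon_finite g f \<xi> t"
      by (simp add: radon_finite_def radon_integrand_def[abs_def] h_def)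
  qed
qed

section \<open>Logarithmic radial integrals\<close>

text \<open>At the critical power the volume of a dyadic shell cancels exactly, so the j-th shell is
  bounded by a multiple of (j + 1) powr (- p), summable for p > 1.\<close>

lemma log_radial_nn_integral_finite:
  assumes p: "1 < p"
  shows "(\<integral>\<^sup>+r. ennreal (norm r powr (- real DIM('a)) * (1 + ln (norm r)) powr (- p)) * indicator {r. 1 \<le> norm r} r
     \<partial>(lborel :: 'a::euclidean_space measure)) < \<infinity>"
proof -
  let ?n = "DIM('a)" and ?B = "unit_ball_vol (real DIM('a))"
  let ?\<phi> = "\<lambda>s. s powr (- real ?n) * (1 + ln s) powr (- p)"
  have "(\<integral>\<^sup>+r. ennreal (?\<phi> (norm r)) * indicator {r. 1 \<le> norm r} r \<partial>(lborel :: 'a measure))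
     \<le> (\<Sum>j. ennreal (?\<phi> (2 ^ j) * (?B * (2 ^ Suc j) ^ ?n)))"
  proof (rule radial_nn_integral_le)
    fix s t :: real assume st: "1 \<le> s" "s \<le> t"
    then have "ln s \<le> ln t" "0 < 1 + ln s" by (simp_all add: add_pos_nonneg)
    then show "?\<phi> t \<le> ?\<phi> s"
      using st p by (intro mult_mono powr_mono2') auto
  qed simp
  also have "\<dots> \<le> (\<Sum>j. ennreal (?B * 2 ^ ?n * ln 2 powr (- p) * real (Suc j) powr (- p)))"
  proof (intro suminf_le summableI ennreal_leI)
    fix j :: nat
    have e: "ln ((2::real) ^ j) = real j * ln 2" by (simp add: ln_realpow)
    have "ln 2 * real (Suc j) \<le> 1 + real j * ln 2"
      using ln_le_minus_one[of "2::real"] by (simp add: algebra_simps)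
    then have "(1 + ln ((2::real) ^ j)) powr (- p) \<le> (ln 2 * real (Suc j)) powr (- p)"
      unfolding e using p by (intro powr_mono2') auto
    also have "\<dots> = ln 2 powr (- p) * real (Suc j) powr (- p)" by (rule powr_mult)
    finally have 1: "(1 + ln ((2::real) ^ j)) powr (- p) \<le> ln 2 powr (- p) * real (Suc j) powr (- p)" .
    have 2: "((2::real) ^ j) powr (- real ?n) * ((2 ^ Suc j) ^ ?n) = 2 ^ ?n"
    proof -
      have "((2::real) ^ j) powr (- real ?n) = inverse ((2 ^ j) ^ ?n)"
        by (simp add: powr_minus powr_realpow)
      then show ?thesis by (simp add: power_mult_distrib)
    qed
    have "?\<phi> (2 ^ j) * (?B * (2 ^ Suc j) ^ ?n) = ?B * (((2::real) ^ j) powr (- real ?n) * ((2 ^ Suc j) ^ ?n)) * (1 + ln ((2::real) ^ j)) powr (- p)"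
      by (simp only: mult_ac)
    also have "\<dots> \<le> ?B * 2 ^ ?n * (ln 2 powr (- p) * real (Suc j) powr (- p))"
      unfolding 2 by (rule mult_left_mono[OF 1]) simp
    finally show "?\<phi> (2 ^ j) * (?B * (2 ^ Suc j) ^ ?n) \<le> ?B * 2 ^ ?n * ln 2 powr (- p) * real (Suc j) powr (- p)"
      by (simp only: mult_ac)
  qed
  also have "\<dots> < \<infinity>"
  proof -
    have "summable (\<lambda>j. real (Suc j) powr (- p))"
      using p by (subst summable_Suc_iff[of "\<lambda>j. real j powr (- p)"]) (simp add: summable_real_powr_iff)
    then have "summable (\<lambda>j. ?B * 2 ^ ?n * ln 2 powr (- p) * real (Suc j) powr (- p))"
      by (rule summable_mult)
    then have "(\<Sum>j. ennreal (?B * 2 ^ ?n * ln 2 powr (- p) * real (Suc j) powr (- p))) \<noteq> top"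
      by (rule ennreal_suminf_neq_top) simp
    then show ?thesis by (simp add: less_top)
  qed
  finally show ?thesis .
qed

text \<open>With the first power of the logarithm the shells contribute a harmonic series. The
  cut-off \<open>A\<close> is harmless because the divergence comes from large r.\<close>

lemma log_radial_nn_integral_infinite:
  "(\<integral>\<^sup>+r. ennreal (norm r powr (- real DIM('a)) / (1 + ln (norm r))) * indicator {r. A \<le> norm r} r
     \<partial>(lborel :: 'a::euclidean_space measure)) = \<infinity>"
proof -
  let ?n = "DIM('a)" and ?B = "unit_ball_vol (real DIM('a))"
  let ?\<phi> = "\<lambda>s. s powr (- real ?n) / (1 + ln s)"
  have B: "?B > 0" by simp
  obtain j0 :: nat where j0: "A \<le> 2 ^ j0" using real_arch_pow[of 2 A] by (auto intro: less_imp_le)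
  define S where "S j = {r :: 'a. 2 ^ (j0 + j) \<le> norm r \<and> norm r < 2 ^ Suc (j0 + j)}" for j
  have Sb: "S j \<in> sets borel" for j unfolding S_def by measurable
  have disj: "disjoint_family S"
    unfolding disjoint_family_on_def
  proof (intro ballI impI, rule ccontr)
    fix i j :: nat assume ij: "i \<noteq> j" and "S i \<inter> S j \<noteq> {}"
    then obtain r where r: "r \<in> S i" "r \<in> S j" by auto
    have lt: "2 ^ (j0 + a) < (2::real) ^ Suc (j0 + b)" if "r \<in> S a" "r \<in> S b" for a b
    proof -
      have "2 ^ (j0 + a) \<le> norm r" "norm r < 2 ^ Suc (j0 + b)"
        using that unfolding S_def mem_Collect_eq by blast+
      then show ?thesis by (rule le_less_trans)
    qed
    from lt[OF r] have "j0 + i < Suc (j0 + j)" by (rule power_less_imp_less_exp[rotated]) simp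
    moreover from lt[OF r(2,1)] have "j0 + j < Suc (j0 + i)" by (rule power_less_imp_less_exp[rotated]) simp
    ultimately show False using ij by simp
  qed
  have vol: "ennreal (?B * (2 ^ (j0 + j)) ^ ?n) \<le> emeasure lborel (S j)" for j
  proof -
    have "S j = ball 0 (2 ^ Suc (j0 + j)) - ball 0 (2 ^ (j0 + j))" by (auto simp: S_def)
    also have "emeasure lborel \<dots> = emeasure lborel (ball (0::'a) (2 ^ Suc (j0 + j))) - emeasure lborel (ball (0::'a) (2 ^ (j0 + j)))"
      by (intro emeasure_Diff) (auto simp: emeasure_ball intro!: subset_ball)
    also have "\<dots> = ennreal (?B * (2 ^ Suc (j0 + j)) ^ ?n - ?B * (2 ^ (j0 + j)) ^ ?n)"
      by (simp add: emeasure_ball ennreal_minus)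
    finally have eq: "emeasure lborel (S j) = ennreal (?B * (2 ^ Suc (j0 + j)) ^ ?n - ?B * (2 ^ (j0 + j)) ^ ?n)" .
    \<comment> \<open>A shell has at least the volume of the ball inside it, because doubling the
      radius at least doubles the volume in dimension one or more.\<close>
    have "(2::real) * (2 ^ (j0 + j)) ^ ?n \<le> 2 ^ ?n * (2 ^ (j0 + j)) ^ ?n"
      using self_le_power[of "2::real" ?n] by (intro mult_right_mono) auto
    also have "\<dots> = (2 ^ Suc (j0 + j)) ^ ?n" by (simp add: power_mult_distrib)
    finally have "?B * (2 * (2 ^ (j0 + j)) ^ ?n) \<le> ?B * (2 ^ Suc (j0 + j)) ^ ?n"
      using B by (intro mult_left_mono) auto
    then show ?thesis unfolding eq by (intro ennreal_leI) (simp add: algebra_simps)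
  qed
  \<comment> \<open>The volume is bounded below through the inner radius and \<phi> through the
    outer one; the mismatch of radii leaves the factor 2 ^ (- DIM('a)).\<close>
  let ?c = "?B * inverse (2 ^ ?n)"
  have "(\<Sum>j. ennreal (?c * inverse (real (j + (j0 + 2))))) \<le> (\<Sum>j. ennreal (?\<phi> (2 ^ Suc (j0 + j))) * emeasure lborel (S j))"
  proof (intro suminf_le summableI)
    fix j
    let ?J = "j0 + j"
    have "ln ((2::real) ^ Suc ?J) = real (Suc ?J) * ln 2" by (rule ln_realpow)
    also have "\<dots> \<le> real (Suc ?J) * 1"
      using ln_le_minus_one[of "2::real"] by (intro mult_left_mono) auto
    finally have 1: "1 + ln ((2::real) ^ Suc ?J) \<le> real (j + (j0 + 2))" by simp
    have "(1::real) \<le> 2 ^ Suc ?J" by (rule one_le_power) simp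
    then have "0 \<le> ln ((2::real) ^ Suc ?J)" by (rule ln_ge_zero)
    then have 0: "0 < 1 + ln ((2::real) ^ Suc ?J)" by linarith
    have 2: "((2::real) ^ Suc ?J) powr (- real ?n) * (2 ^ ?J) ^ ?n = inverse (2 ^ ?n)"
    proof -
      have "((2::real) ^ Suc ?J) powr (- real ?n) = inverse ((2 ^ Suc ?J) ^ ?n)"
        unfolding powr_minus by (subst powr_realpow) simp_all
      then show ?thesis by (simp add: power_mult_distrib)
    qed
    have "?c * inverse (real (j + (j0 + 2))) \<le> ?c * inverse (1 + ln ((2::real) ^ Suc ?J))"
      using B 0 1 by (intro mult_left_mono le_imp_inverse_le) auto
    also have "\<dots> = ?\<phi> (2 ^ Suc ?J) * (?B * (2 ^ ?J) ^ ?n)"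
      unfolding 2[symmetric] divide_inverse by (simp only: mult_ac)
    finally have "ennreal (?c * inverse (real (j + (j0 + 2)))) \<le> ennreal (?\<phi> (2 ^ Suc ?J) * (?B * (2 ^ ?J) ^ ?n))"
      by (rule ennreal_leI)
    also have "\<dots> = ennreal (?\<phi> (2 ^ Suc ?J)) * ennreal (?B * (2 ^ ?J) ^ ?n)"
      using 0 by (intro ennreal_mult) auto
    also have "\<dots> \<le> ennreal (?\<phi> (2 ^ Suc ?J)) * emeasure lborel (S j)"
      by (intro mult_left_mono vol) simp
    finally show "ennreal (?c * inverse (real (j + (j0 + 2)))) \<le> ennreal (?\<phi> (2 ^ Suc ?J)) * emeasure lborel (S j)" .
  qed
  moreover have "(\<Sum>j. ennreal (?c * inverse (real (j + (j0 + 2))))) = top"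
  proof (rule ccontr)
    assume fin: "(\<Sum>j. ennreal (?c * inverse (real (j + (j0 + 2))))) \<noteq> top"
    have "0 \<le> ?c * inverse (real (j + (j0 + 2)))" for j using B by (intro mult_nonneg_nonneg) simp_all
    from summable_suminf_not_top[OF this fin]
    have "summable (\<lambda>j. ?c * inverse (real (j + (j0 + 2))))" .
    then have "summable (\<lambda>j. inverse (real (j + (j0 + 2))))"
      by (rule summable_mult_D) (simp add: less_imp_neq[OF B, symmetric])
    then have "summable (\<lambda>j. inverse (real j))"
      by (rule summable_iff_shift[THEN iffD1])
    with not_summable_harmonic[where 'a=real] show False by contradiction
  qed
  ultimately have "(\<Sum>j. ennreal (?\<phi> (2 ^ Suc (j0 + j))) * emeasure lborel (S j)) = top"
    by (simp add: top_unique)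
  moreover have "(\<Sum>j. ennreal (?\<phi> (2 ^ Suc (j0 + j))) * emeasure lborel (S j))
     = (\<integral>\<^sup>+r. (\<Sum>j. ennreal (?\<phi> (2 ^ Suc (j0 + j))) * indicator (S j) r) \<partial>lborel)"
  proof -
    have "(\<integral>\<^sup>+r. (\<Sum>j. ennreal (?\<phi> (2 ^ Suc (j0 + j))) * indicator (S j) r) \<partial>lborel)
       = (\<Sum>j. \<integral>\<^sup>+r. ennreal (?\<phi> (2 ^ Suc (j0 + j))) * indicator (S j) r \<partial>lborel)"
      by (intro nn_integral_suminf borel_measurable_times_ennreal borel_measurable_indicator) (simp_all only: Sb sets_lborel measurable_lborel1 borel_measurable_const)
    then show ?thesis using Sb by (simp only: nn_integral_cmult_indicator sets_lborel)
  qed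
  moreover have "\<dots> \<le> (\<integral>\<^sup>+r. ennreal (?\<phi> (norm r)) * indicator {r. A \<le> norm r} r \<partial>(lborel :: 'a measure))"
  proof (rule nn_integral_mono)
    fix r :: 'a
    show "(\<Sum>j. ennreal (?\<phi> (2 ^ Suc (j0 + j))) * indicator (S j) r) \<le> ennreal (?\<phi> (norm r)) * indicator {r. A \<le> norm r} r"
    proof (cases "\<exists>j. r \<in> S j")
      case True
      then obtain j where j: "r \<in> S j" by blast
      have r: "2 ^ (j0 + j) \<le> norm r" "norm r < 2 ^ Suc (j0 + j)" using j by (auto simp: S_def)
      have "(1::real) \<le> 2 ^ (j0 + j)" by simp
      then have r1: "1 \<le> norm r" using r(1) by linarith
      have "(2::real) ^ j0 \<le> 2 ^ (j0 + j)" by (intro power_increasing) auto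
      then have rA: "A \<le> norm r" using j0 r(1) by linarith
      have l0: "0 \<le> ln (norm r)" using r1 by (rule ln_ge_zero)
      have "0 < norm r" "0 < (2::real) ^ Suc (j0 + j)" using r1 by auto
      then have l1: "ln (norm r) \<le> ln (2 ^ Suc (j0 + j))"
        using less_imp_le[OF r(2)] by (simp only: ln_le_cancel_iff)
      have "?\<phi> (2 ^ Suc (j0 + j)) \<le> ?\<phi> (norm r)"
      proof (rule frac_le)
        show "(2 ^ Suc (j0 + j)) powr (- real ?n) \<le> norm r powr (- real ?n)"
          using r1 less_imp_le[OF r(2)] by (intro powr_mono2') auto
      qed (use l0 l1 in auto)
      then show ?thesis
        using suminf_cmult_indicator[OF disj j, of "\<lambda>j. ennreal (?\<phi> (2 ^ Suc (j0 + j)))"] rA by (simp add: ennreal_leI)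
    qed simp
  qed
  ultimately show ?thesis by (simp add: top_unique)
qed

section \<open>Tubes around a line\<close>

lemma emeasure_cbox_axis:
  fixes e :: "'m::finite"
  assumes "0 \<le> R" "0 \<le> S"
  shows "emeasure lborel (cbox (- (\<chi> j. if j = e then R else S)) (\<chi> j. if j = e then R else S) :: (real ^ 'm) set)
     = ennreal (2 * R * (2 * S) ^ (CARD('m) - 1))"
proof -
  let ?w = "(\<chi> j. if j = e then R else S) :: real ^ 'm"
  have Bas: "(Basis :: (real ^ 'm) set) = (\<lambda>i. axis i 1) ` UNIV" by (auto simp: Basis_vec_def)
  have w: "?w \<bullet> axis i 1 = (if i = e then R else S)" for i by (simp add: inner_axis)
  have "emeasure lborel (cbox (- ?w) ?w) = ennreal (\<Prod>b\<in>Basis. (?w - (- ?w)) \<bullet> b)"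
    using assms by (intro emeasure_lborel_cbox) (auto simp: Bas w)
  also have "(\<Prod>b\<in>Basis. (?w - (- ?w)) \<bullet> b) = (\<Prod>i\<in>UNIV. 2 * (if i = e then R else S))"
  proof -
    have "(?w - (- ?w)) \<bullet> axis i 1 = 2 * (if i = e then R else S)" for i
      by (simp only: inner_diff_left inner_minus_left w)
    moreover have "inj (\<lambda>i. axis i 1 :: real ^ 'm)" by (simp add: inj_on_def axis_eq_axis)
    ultimately show ?thesis unfolding Bas by (subst prod.reindex) simp_all
  qed
  also have "\<dots> = 2 * R * (\<Prod>i\<in>UNIV - {e}. 2 * (if i = e then R else S))"
    by (subst prod.remove[of _ e]) auto
  also have "(\<Prod>i\<in>UNIV - {e}. 2 * (if i = e then R else S)) = (\<Prod>i\<in>UNIV - {e}. 2 * S)"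
    by (intro prod.cong) auto
  finally show ?thesis by (simp add: card_Diff_singleton)
qed

text \<open>
  For \<open>r \<noteq> 0\<close> the second condition says that the squared distance from \<open>y\<close> to the line spanned by \<open>r\<close>
  is at most \<open>C\<close>; the form without division needs no case distinction.
\<close>

definition tube :: "real \<Rightarrow> real \<Rightarrow> real ^ 'm \<Rightarrow> (real ^ 'm) set" where
  "tube A C r = {y. norm y \<le> A * norm r \<and> (norm y)\<^sup>2 * (norm r)\<^sup>2 - (y \<bullet> r)\<^sup>2 \<le> C * (norm r)\<^sup>2}"

lemma pred_tube [measurable]:
  assumes "f \<in> borel_measurable M" "g \<in> borel_measurable M"
  shows "Measurable.pred M (\<lambda>x. f x \<in> tube A C (g x))"
proof -
  have "closed {p :: (real ^ 'm) \<times> (real ^ 'm). fst p \<in> tube A C (snd p)}"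
    unfolding tube_def mem_Collect_eq by (intro closed_Collect_conj closed_Collect_le continuous_intros)
  from borel_closed[OF this]
  have "Measurable.pred borel (\<lambda>p :: (real ^ 'm) \<times> (real ^ 'm). fst p \<in> tube A C (snd p))"
    by (simp add: pred_def)
  from measurable_compose[OF borel_measurable_Pair[OF assms] this] show ?thesis by simp
qed

lemma closed_tube: "closed (tube A C r)"
  unfolding tube_def by (intro closed_Collect_conj closed_Collect_le continuous_intros)

lemma tube_borel: "tube A C r \<in> sets borel"
  using closed_tube by (rule borel_closed)

lemma borel_measurable_tube:
  assumes "f \<in> borel_measurable M" "g \<in> borel_measurable M"
  shows "(\<lambda>x. if f x \<in> tube A C (g x) then 1 else 0 :: ennreal) \<in> borel_measurable M"
  using pred_tube[OF assms] by (intro measurable_If) (simp_all add: pred_def)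

text \<open>A rotation carries r to a multiple of the coordinate vector e, and Lebesgue measure does
  not see the rotation. Afterwards the tube can be compared with coordinate boxes.\<close>

lemma emeasure_tube:
  fixes r :: "real ^ 'm"
  assumes r: "r \<noteq> 0"
  shows "emeasure lborel (tube A C r) = emeasure lborel {y :: real ^ 'm. norm y \<le> A * norm r \<and> (norm y)\<^sup>2 - (y $ e)\<^sup>2 \<le> C}"
proof -
  have "norm (norm r *\<^sub>R axis e (1::real)) = norm r" by simp
  from orthogonal_transformation_exists[OF this]
  obtain f where f: "orthogonal_transformation f" and fr: "f (norm r *\<^sub>R axis e (1::real)) = r" .
  have lin: "linear f" by (rule orthogonal_transformation_linear[OF f])
  have surj: "surj f" by (rule orthogonal_transformation_surj[OF f])
  have iso: "norm (f x) = norm x" for x by (rule orthogonal_transformation_norm[OF f])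
  have inn: "f y \<bullet> r = norm r * y $ e" for y
  proof -
    have "f y \<bullet> r = f y \<bullet> f (norm r *\<^sub>R axis e 1)" by (simp add: fr)
    also have "\<dots> = y \<bullet> (norm r *\<^sub>R axis e 1)" using f by (simp only: orthogonal_transformation_def)
    finally show ?thesis by (simp add: inner_axis)
  qed
  have iff: "f y \<in> tube A C r \<longleftrightarrow> norm y \<le> A * norm r \<and> (norm y)\<^sup>2 - (y $ e)\<^sup>2 \<le> C" for y
  proof -
    have "(norm y)\<^sup>2 * (norm r)\<^sup>2 - (norm r * y $ e)\<^sup>2 = ((norm y)\<^sup>2 - (y $ e)\<^sup>2) * (norm r)\<^sup>2"
      by (simp add: power_mult_distrib algebra_simps)
    moreover have "((norm y)\<^sup>2 - (y $ e)\<^sup>2) * (norm r)\<^sup>2 \<le> C * (norm r)\<^sup>2 \<longleftrightarrow> (norm y)\<^sup>2 - (y $ e)\<^sup>2 \<le> C"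
      using r by (intro mult_le_cancel_right_pos) simp
    ultimately show ?thesis by (simp only: tube_def mem_Collect_eq iso inn)
  qed
  have "emeasure lborel (tube A C r) = (\<integral>\<^sup>+y. indicator (tube A C r) y \<partial>lborel)"
    by (simp add: tube_borel)
  also have "\<dots> = (\<integral>\<^sup>+y. indicator (tube A C r) (f y) \<partial>lborel)"
  proof -
    have "(indicator (tube A C r) :: _ \<Rightarrow> ennreal) \<in> borel_measurable borel"
      using tube_borel by (rule borel_measurable_indicator)
    from linear_isometry_nn_integral_lborel[OF lin surj iso this] show ?thesis by (rule sym)
  qed
  also have "\<dots> = (\<integral>\<^sup>+y. indicator {y. norm y \<le> A * norm r \<and> (norm y)\<^sup>2 - (y $ e)\<^sup>2 \<le> C} y \<partial>lborel)"
    by (intro nn_integral_cong) (simp add: indicator_def iff)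
  also have "\<dots> = emeasure lborel {y. norm y \<le> A * norm r \<and> (norm y)\<^sup>2 - (y $ e)\<^sup>2 \<le> C}"
  proof (rule nn_integral_indicator)
    have "closed {y. norm y \<le> A * norm r \<and> (norm y)\<^sup>2 - (y $ e)\<^sup>2 \<le> C}"
      by (intro closed_Collect_conj closed_Collect_le continuous_intros)
    then show "{y. norm y \<le> A * norm r \<and> (norm y)\<^sup>2 - (y $ e)\<^sup>2 \<le> C} \<in> sets lborel"
      by (simp only: sets_lborel borel_closed)
  qed
  finally show ?thesis .
qed

lemma norm_power2_minus_component:
  fixes y :: "real ^ 'm"
  shows "(norm y)\<^sup>2 - (y $ e)\<^sup>2 = (\<Sum>j\<in>UNIV - {e}. (y $ j)\<^sup>2)"
  by (simp add: norm_vec_power2 sum.remove[of UNIV e])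

lemma mem_cbox_symmetric:
  fixes w :: "real ^ 'm"
  shows "y \<in> cbox (- w) w \<longleftrightarrow> (\<forall>j. \<bar>y $ j\<bar> \<le> w $ j)"
proof -
  have "- a \<le> b \<and> b \<le> a \<longleftrightarrow> \<bar>b\<bar> \<le> a" for a b :: real by linarith
  then show ?thesis by (simp only: mem_box_cart vector_uminus_component)
qed

text \<open>Only the direction of r is allowed to grow; the others are bounded by sqrt C. A box with
  these sides contains the rotated tube, whence linear growth in \<open>norm r\<close>.\<close>

lemma tube_volume_le:
  assumes "0 \<le> A" "0 \<le> C"
  obtains K where "0 \<le> K" "\<And>r :: real ^ 'm. r \<noteq> 0 \<Longrightarrow> emeasure lborel (tube A C r) \<le> ennreal (K * norm r)"
proof
  define K where "K = 2 * A * (2 * sqrt C) ^ (CARD('m) - 1)"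
  show "0 \<le> K" using assms by (simp add: K_def)
  fix r :: "real ^ 'm" assume r: "r \<noteq> 0"
  obtain e :: 'm where True by blast
  let ?w = "(\<chi> j. if j = e then A * norm r else sqrt C) :: real ^ 'm"
  have "{y. norm y \<le> A * norm r \<and> (norm y)\<^sup>2 - (y $ e)\<^sup>2 \<le> C} \<subseteq> cbox (- ?w) ?w"
  proof clarify
    fix y :: "real ^ 'm" assume y: "norm y \<le> A * norm r" "(norm y)\<^sup>2 - (y $ e)\<^sup>2 \<le> C"
    have "\<bar>y $ j\<bar> \<le> ?w $ j" for j
    proof (cases "j = e")
      case True
      then show ?thesis using component_le_norm_cart[of y j] y(1) by simp
    next
      case False
      have "(y $ j)\<^sup>2 \<le> (\<Sum>j\<in>UNIV - {e}. (y $ j)\<^sup>2)"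
        using False by (intro member_le_sum) auto
      then have "(y $ j)\<^sup>2 \<le> C" using y(2) by (simp add: norm_power2_minus_component)
      then have "sqrt ((y $ j)\<^sup>2) \<le> sqrt C" by (rule real_sqrt_le_mono)
      then show ?thesis using False by simp
    qed
    then show "y \<in> cbox (- ?w) ?w" unfolding mem_cbox_symmetric by (rule allI)
  qed
  then have "emeasure lborel (tube A C r) \<le> emeasure lborel (cbox (- ?w) ?w)"
    unfolding emeasure_tube[OF r, of A C e] by (rule emeasure_mono) simp
  also have "\<dots> = ennreal (K * norm r)"
    using assms by (subst emeasure_cbox_axis) (auto simp: K_def mult_ac)
  finally show "emeasure lborel (tube A C r) \<le> ennreal (K * norm r)" .
qed

lemma tube_volume_ge:
  obtains c where "0 < c" "\<And>r :: real ^ 'm. 2 \<le> norm r \<Longrightarrow> ennreal (c * norm r) \<le> emeasure lborel (tube 1 1 r)"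
proof
  let ?m = "real CARD('m)"
  define c where "c = (2 * (1 / ?m)) ^ (CARD('m) - 1)"
  show "0 < c" by (simp add: c_def)
  fix r :: "real ^ 'm" assume r: "2 \<le> norm r"
  obtain e :: 'm where True by blast
  \<comment> \<open>With transverse half-width 1 / m the squares of the transverse coordinates sum
    to at most 1, and half the length of r leaves room for them once \<open>norm r\<close> is at
    least 2.\<close>
  let ?w = "(\<chi> j. if j = e then norm r / 2 else 1 / ?m) :: real ^ 'm"
  have sub: "cbox (- ?w) ?w \<subseteq> {y. norm y \<le> 1 * norm r \<and> (norm y)\<^sup>2 - (y $ e)\<^sup>2 \<le> 1}"
  proof clarify
    fix y :: "real ^ 'm" assume y: "y \<in> cbox (- ?w) ?w"
    have w: "\<bar>y $ j\<bar> \<le> ?w $ j" for j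
      using y unfolding mem_cbox_symmetric by (rule spec)
    have "(\<Sum>j\<in>UNIV - {e}. (y $ j)\<^sup>2) \<le> (\<Sum>j\<in>UNIV - {e}. 1 / ?m)"
    proof (rule sum_mono)
      fix j assume "j \<in> UNIV - {e}"
      then have "\<bar>y $ j\<bar> \<le> 1 / ?m" using w[of j] by simp
      then have "\<bar>y $ j\<bar>\<^sup>2 \<le> (1 / ?m)\<^sup>2" by (rule power_mono) simp
      also have "\<dots> \<le> (1 / ?m) ^ 1"
        using one_le_card_finite[where 'a='m] by (intro power_decreasing) auto
      finally show "(y $ j)\<^sup>2 \<le> 1 / ?m" by simp
    qed
    also have "\<dots> \<le> (\<Sum>j\<in>(UNIV :: 'm set). 1 / ?m)" by (intro sum_mono2) auto
    also have "\<dots> = 1" by simp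
    finally have 1: "(norm y)\<^sup>2 - (y $ e)\<^sup>2 \<le> 1" by (simp only: norm_power2_minus_component)
    have "\<bar>y $ e\<bar> \<le> norm r / 2" using w[of e] by simp
    then have "\<bar>y $ e\<bar>\<^sup>2 \<le> (norm r / 2)\<^sup>2" by (rule power_mono) simp
    then have "(y $ e)\<^sup>2 \<le> (norm r)\<^sup>2 / 4" by (simp add: power_divide)
    moreover have "4 \<le> (norm r)\<^sup>2" using power_mono[OF r, of 2] by simp
    ultimately have "(norm y)\<^sup>2 \<le> (norm r)\<^sup>2" using 1 by linarith
    then have "norm y \<le> norm r" by (rule power2_le_imp_le) simp
    with 1 show "norm y \<le> 1 * norm r \<and> (norm y)\<^sup>2 - (y $ e)\<^sup>2 \<le> 1" by simp
  qed
  have r0: "r \<noteq> 0" using r by auto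
  have "ennreal (c * norm r) = ennreal (2 * (norm r / 2) * (2 * (1 / ?m)) ^ (CARD('m) - 1))"
    by (simp add: c_def mult.commute)
  also have "\<dots> = emeasure lborel (cbox (- ?w) ?w)"
    by (rule emeasure_cbox_axis[symmetric]) auto
  also have "\<dots> \<le> emeasure lborel (tube 1 1 r)"
    unfolding emeasure_tube[OF r0, of 1 1 e]
  proof (rule emeasure_mono[OF sub])
    have "closed {y. norm y \<le> 1 * norm r \<and> (norm y)\<^sup>2 - (y $ e)\<^sup>2 \<le> 1}"
      by (intro closed_Collect_conj closed_Collect_le continuous_intros)
    then show "{y. norm y \<le> 1 * norm r \<and> (norm y)\<^sup>2 - (y $ e)\<^sup>2 \<le> 1} \<in> sets lborel"
      by (simp only: sets_lborel borel_closed)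
  qed
  finally show "ennreal (c * norm r) \<le> emeasure lborel (tube 1 1 r)" .
qed

text \<open>The row i is free and each other row is confined to a tube around it, so they can be
  integrated out independently. With tube volumes of order \<open>norm r\<close> and m dimensions
  for r, this is where the growth exponent m + \<open>CARD('n)\<close> - 1 originates.\<close>

lemma nn_integral_row_tubes:
  fixes h :: "real ^ 'm \<Rightarrow> ennreal" and i :: "'n::finite"
  assumes h[measurable]: "h \<in> borel_measurable borel"
  shows "(\<integral>\<^sup>+x. h (x $ i) * (\<Prod>a\<in>UNIV - {i}. if x $ a \<in> tube A C (x $ i) then 1 else 0) \<partial>(lborel :: (real ^ 'm ^ 'n) measure))
     = (\<integral>\<^sup>+r. h r * emeasure lborel (tube A C r) ^ (CARD('n) - 1) \<partial>lborel)"
proof -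
  interpret product_sigma_finite "\<lambda>_::'n. lborel :: (real ^ 'm) measure" ..
  let ?F = "\<lambda>x :: real ^ 'm ^ 'n. h (x $ i) * (\<Prod>a\<in>UNIV - {i}. if x $ a \<in> tube A C (x $ i) then 1 else 0)"
  have nth: "(\<lambda>x :: real ^ 'm ^ 'n. x $ a) \<in> borel_measurable borel" for a
    by (rule borel_measurable_vec_nth) simp
  have Fm: "?F \<in> borel_measurable borel"
    by (intro borel_measurable_times_ennreal borel_measurable_prod_ennreal borel_measurable_tube measurable_compose[OF _ h] nth)
  have ins: "insert i (UNIV - {i}) = UNIV" by auto
  let ?G = "\<lambda>X :: 'n \<Rightarrow> real ^ 'm. h (X i) * (\<Prod>a\<in>UNIV - {i}. if X a \<in> tube A C (X i) then 1 else 0)"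
  have cmp: "(\<lambda>X. X a) \<in> borel_measurable (\<Pi>\<^sub>M a\<in>insert i (UNIV - {i}). lborel)" for a
    using measurable_component_singleton[of a "insert i (UNIV - {i})" "\<lambda>_. lborel :: (real ^ 'm) measure"] by (simp add: ins)
  have Gm: "?G \<in> borel_measurable (\<Pi>\<^sub>M a\<in>insert i (UNIV - {i}). lborel)"
    by (intro borel_measurable_times_ennreal borel_measurable_prod_ennreal borel_measurable_tube measurable_compose[OF _ h] cmp)
  have "(\<integral>\<^sup>+x. ?F x \<partial>lborel) = (\<integral>\<^sup>+X. ?G X \<partial>(\<Pi>\<^sub>M a\<in>insert i (UNIV - {i}). lborel))"
    unfolding ins nn_integral_lborel_vec[OF Fm] by simp
  also have "\<dots> = (\<integral>\<^sup>+r. \<integral>\<^sup>+X. ?G (X(i := r)) \<partial>(\<Pi>\<^sub>M a\<in>UNIV - {i}. lborel) \<partial>lborel)"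
    by (rule product_nn_integral_insert_rev[OF _ _ Gm]) auto
  also have "\<dots> = (\<integral>\<^sup>+r. h r * emeasure lborel (tube A C r) ^ (CARD('n) - 1) \<partial>lborel)"
  proof (rule nn_integral_cong)
    fix r
    have "(\<integral>\<^sup>+X. ?G (X(i := r)) \<partial>(\<Pi>\<^sub>M a\<in>UNIV - {i}. lborel))
       = (\<integral>\<^sup>+X. h r * (\<Prod>a\<in>UNIV - {i}. if X a \<in> tube A C r then 1 else 0) \<partial>(\<Pi>\<^sub>M a\<in>UNIV - {i}. lborel))"
      by (intro nn_integral_cong arg_cong2[where f="(*)"] prod.cong) auto
    also have "\<dots> = h r * (\<integral>\<^sup>+X. (\<Prod>a\<in>UNIV - {i}. if X a \<in> tube A C r then 1 else 0) \<partial>(\<Pi>\<^sub>M a\<in>UNIV - {i}. lborel))"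
      by (intro nn_integral_cmult borel_measurable_prod_ennreal borel_measurable_tube) simp_all
    also have "(\<integral>\<^sup>+X. (\<Prod>a\<in>UNIV - {i}. if X a \<in> tube A C r then 1 else 0) \<partial>(\<Pi>\<^sub>M a\<in>UNIV - {i}. lborel))
        = (\<Prod>a\<in>UNIV - {i}. \<integral>\<^sup>+y. (if y \<in> tube A C r then 1 else 0) \<partial>lborel)"
      by (rule product_nn_integral_prod[of "UNIV - {i}" "\<lambda>_ y. if y \<in> tube A C r then 1 else 0"]) auto
    also have "(\<integral>\<^sup>+y. (if y \<in> tube A C r then 1 else 0) \<partial>lborel) = (\<integral>\<^sup>+y. indicator (tube A C r) y \<partial>lborel)"
      by (intro nn_integral_cong) (simp add: indicator_def)
    also have "\<dots> = emeasure lborel (tube A C r)" by (simp add: tube_borel)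
    finally show "(\<integral>\<^sup>+X. ?G (X(i := r)) \<partial>(\<Pi>\<^sub>M a\<in>UNIV - {i}. lborel)) = h r * emeasure lborel (tube A C r) ^ (CARD('n) - 1)"
      by (simp add: card_Diff_singleton)
  qed
  finally show ?thesis .
qed

section \<open>The critical function\<close>

text \<open>
  All rows of \<open>x\<close> are close to one line, that is, \<open>x\<close> is close to a matrix of rank one.
\<close>

definition near_line :: "real \<Rightarrow> real ^ 'm ^ 'n \<Rightarrow> bool" where
  "near_line N x \<longleftrightarrow> (\<exists>v. norm v = 1 \<and> (norm x)\<^sup>2 \<le> (norm (x *v v))\<^sup>2 + N)"

text \<open>The reason for measuring closeness by \<open>x *v v\<close>: left multiplication by
  \<gamma> preserves both norms, whereas a description by tubes around a row would not be
  invariant.\<close>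

lemma near_line_orthogonal:
  assumes "orthogonal_matrix \<gamma>"
  shows "near_line N (\<gamma> ** x) \<longleftrightarrow> near_line N x"
  unfolding near_line_def norm_orthogonal_matrix_mult_matrix[OF assms] matrix_vector_mul_assoc[symmetric]
    norm_orthogonal_matrix_mult[OF assms] ..

text \<open>The existential quantifier runs over the compact unit sphere, and projection along a
  compact factor preserves closedness.\<close>

lemma closed_near_line: "closed {x :: real ^ 'm ^ 'n. near_line N x}"
proof -
  let ?T = "{p :: (real ^ 'm) \<times> (real ^ 'm ^ 'n). (norm (snd p))\<^sup>2 \<le> (norm (snd p *v fst p))\<^sup>2 + N}"
  have "closed ?T"
    by (intro closed_Collect_le continuous_intros continuous_on_matrix_vector_mult)
  from closed_compact_projection[OF compact_sphere[of 0 1] this]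
  show ?thesis by (simp add: near_line_def)
qed

lemma norm_power2_minus_matrix_vector:
  fixes x :: "real ^ 'm ^ 'n"
  shows "(norm x)\<^sup>2 - (norm (x *v v))\<^sup>2 = (\<Sum>a\<in>UNIV. (norm (x $ a))\<^sup>2 - (x $ a \<bullet> v)\<^sup>2)"
proof -
  have "(x *v v) $ a = x $ a \<bullet> v" for a
    by (simp add: matrix_vector_mult_def inner_vec_def)
  then show ?thesis by (simp add: norm_vec_power2 sum_subtractf)
qed

lemma inner_unit_power2_le:
  assumes "norm v = 1"
  shows "(y \<bullet> v)\<^sup>2 \<le> (norm y)\<^sup>2"
  using Cauchy_Schwarz_ineq[of y v] assms by (simp add: power2_norm_eq_inner norm_eq_1)

text \<open>The left side is the Gram determinant of y and r; \<open>E\<close> and \<open>E0\<close>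
  are their squared distances to the line of v. Splitting y and r along v with coefficients \<alpha>
  and \<beta> and remainders e and f, the mixed term is controlled by the nonnegativity of the
  squared norm of \<alpha> f + \<beta> e. Thus two vectors close to a common line are close to each
  other's lines.\<close>

lemma norm_inner_defect_le:
  fixes y r v :: "'a::real_inner"
  assumes v: "norm v = 1"
  defines "E \<equiv> (norm y)\<^sup>2 - (y \<bullet> v)\<^sup>2" and "E0 \<equiv> (norm r)\<^sup>2 - (r \<bullet> v)\<^sup>2"
  shows "(norm y)\<^sup>2 * (norm r)\<^sup>2 - (y \<bullet> r)\<^sup>2 \<le> 2 * (y \<bullet> v)\<^sup>2 * E0 + 2 * (r \<bullet> v)\<^sup>2 * E + E * E0"
proof -
  have vv: "v \<bullet> v = 1" using v by (simp add: norm_eq_1)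
  define \<alpha> where "\<alpha> = y \<bullet> v"
  define \<beta> where "\<beta> = r \<bullet> v"
  define e where "e = y - \<alpha> *\<^sub>R v"
  define f where "f = r - \<beta> *\<^sub>R v"
  have ev: "v \<bullet> e = 0" "v \<bullet> f = 0"
    by (simp_all add: e_def f_def \<alpha>_def \<beta>_def inner_diff_right vv inner_commute)
  have y: "y = \<alpha> *\<^sub>R v + e" and r: "r = \<beta> *\<^sub>R v + f" by (simp_all add: e_def f_def)
  have "y \<bullet> y = \<alpha>\<^sup>2 + e \<bullet> e"
    unfolding y by (simp add: inner_add_left inner_add_right vv ev inner_commute[of e v] power2_eq_square)
  then have E: "E = e \<bullet> e" by (simp add: E_def power2_norm_eq_inner \<alpha>_def)
  have "r \<bullet> r = \<beta>\<^sup>2 + f \<bullet> f"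
    unfolding r by (simp add: inner_add_left inner_add_right vv ev inner_commute[of f v] power2_eq_square)
  then have E0: "E0 = f \<bullet> f" by (simp add: E0_def power2_norm_eq_inner \<beta>_def)
  have yr: "y \<bullet> r = \<alpha> * \<beta> + e \<bullet> f"
    unfolding y r by (simp add: inner_add_left inner_add_right vv ev inner_commute[of e v])
  have "0 \<le> (\<alpha> *\<^sub>R f + \<beta> *\<^sub>R e) \<bullet> (\<alpha> *\<^sub>R f + \<beta> *\<^sub>R e)" by simp
  also have "\<dots> = \<alpha>\<^sup>2 * E0 + 2 * (\<alpha> * \<beta> * (e \<bullet> f)) + \<beta>\<^sup>2 * E"
    unfolding E E0 by (simp add: inner_add_left inner_add_right inner_commute[of f e] power2_eq_square algebra_simps)
  finally have 1: "0 \<le> \<alpha>\<^sup>2 * E0 + 2 * (\<alpha> * \<beta> * (e \<bullet> f)) + \<beta>\<^sup>2 * E" .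
  have "(norm y)\<^sup>2 * (norm r)\<^sup>2 - (y \<bullet> r)\<^sup>2 = (\<alpha>\<^sup>2 + E) * (\<beta>\<^sup>2 + E0) - (\<alpha> * \<beta> + e \<bullet> f)\<^sup>2"
    by (simp add: E_def E0_def \<alpha>_def \<beta>_def yr[unfolded \<alpha>_def \<beta>_def])
  also have "\<dots> = \<alpha>\<^sup>2 * E0 + \<beta>\<^sup>2 * E + E * E0 - 2 * (\<alpha> * \<beta> * (e \<bullet> f)) - (e \<bullet> f)\<^sup>2"
    by (simp add: power2_eq_square algebra_simps)
  also have "\<dots> \<le> 2 * \<alpha>\<^sup>2 * E0 + 2 * \<beta>\<^sup>2 * E + E * E0"
    using 1 zero_le_power2[of "e \<bullet> f"] by linarith
  finally show ?thesis by (simp only: \<alpha>_def \<beta>_def)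
qed

text \<open>Take the longest row. It has norm at least \<open>norm x\<close> / N, and since all rows
  are close to the line of v, they are close to the line of this row by
  \<open>norm_inner_defect_le\<close>.\<close>

lemma near_line_rows:
  fixes x :: "real ^ 'm ^ 'n"
  assumes near: "near_line N x" and N: "N = real CARD('n)" and x: "N \<le> norm x"
  obtains i where "1 \<le> norm (x $ i)" "\<And>a. x $ a \<in> tube 1 (5 * N) (x $ i)"
proof -
  obtain v where v: "norm v = 1" and vx: "(norm x)\<^sup>2 \<le> (norm (x *v v))\<^sup>2 + N"
    using near by (auto simp: near_line_def)
  have N1: "1 \<le> N" using one_le_card_finite[where 'a='n] by (simp add: N)
  have "\<exists>i. \<forall>a. norm (x $ a) \<le> norm (x $ i)"
  proof -
    have "Max (range (\<lambda>a. norm (x $ a))) \<in> range (\<lambda>a. norm (x $ a))" by (rule Max_in) auto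
    then obtain i where i: "Max (range (\<lambda>a. norm (x $ a))) = norm (x $ i)" by (rule imageE)
    have "norm (x $ a) \<le> norm (x $ i)" for a unfolding i[symmetric] by (rule Max_ge) auto
    then show ?thesis by blast
  qed
  then obtain i where i: "\<And>a. norm (x $ a) \<le> norm (x $ i)" by blast
  have "(norm x)\<^sup>2 \<le> (\<Sum>a\<in>(UNIV :: 'n set). (norm (x $ i))\<^sup>2)"
    unfolding norm_vec_power2[of x] by (intro sum_mono power_mono i) simp
  also have "\<dots> = N * (norm (x $ i))\<^sup>2" by (simp add: N)
  also have "\<dots> \<le> N\<^sup>2 * (norm (x $ i))\<^sup>2"
    using N1 by (intro mult_right_mono self_le_power) auto
  finally have "(norm x)\<^sup>2 \<le> (N * norm (x $ i))\<^sup>2" by (simp only: power_mult_distrib)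
  then have "norm x \<le> N * norm (x $ i)" by (rule power2_le_imp_le) (use N1 in simp)
  then have "N * 1 \<le> N * norm (x $ i)" using x by simp
  then have i1: "1 \<le> norm (x $ i)" by (rule mult_left_le_imp_le) (use N1 in linarith)
  define E where "E a = (norm (x $ a))\<^sup>2 - (x $ a \<bullet> v)\<^sup>2" for a
  have E0: "0 \<le> E a" for a using inner_unit_power2_le[OF v, of "x $ a"] by (simp add: E_def)
  have EN: "E a \<le> N" for a
  proof -
    have "E a \<le> (\<Sum>a\<in>UNIV. E a)" by (rule member_le_sum) (use E0 in auto)
    also have "\<dots> \<le> N" using vx norm_power2_minus_matrix_vector[of x v] unfolding E_def by linarith
    finally show ?thesis .
  qed
  show thesis
  proof (rule that[OF i1])
    fix a
    let ?R = "(norm (x $ i))\<^sup>2"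
    have ya: "(norm (x $ a))\<^sup>2 \<le> ?R" by (intro power_mono i) simp
    have al: "(x $ a \<bullet> v)\<^sup>2 \<le> ?R" using inner_unit_power2_le[OF v, of "x $ a"] ya by linarith
    have be: "(x $ i \<bullet> v)\<^sup>2 \<le> ?R" by (rule inner_unit_power2_le[OF v])
    have Ea: "E a \<le> ?R" using ya zero_le_power2[of "x $ a \<bullet> v"] unfolding E_def by linarith
    have "(norm (x $ a))\<^sup>2 * ?R - (x $ a \<bullet> x $ i)\<^sup>2 \<le> 2 * (x $ a \<bullet> v)\<^sup>2 * E i + 2 * (x $ i \<bullet> v)\<^sup>2 * E a + E a * E i"
      unfolding E_def by (rule norm_inner_defect_le[OF v])
    also have "\<dots> \<le> 2 * ?R * N + 2 * ?R * N + ?R * N"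
      \<comment> \<open>The three terms give 2 + 2 + 1 = 5; in the last one \<open>E a\<close> is
        bounded by the squared length of row i and \<open>E i\<close> by N.\<close>
      using al be Ea E0 EN by (intro add_mono mult_mono) auto
    also have "\<dots> = 5 * N * ?R" by simp
    finally show "x $ a \<in> tube 1 (5 * N) (x $ i)" using i[of a] by (simp add: tube_def)
  qed
qed

text \<open>The norm cut-off makes the longest row have length at least 1 and the logarithm
  nonnegative. The tolerance \<open>CARD('n)\<close> leaves room for unit tubes around the k rows of
  \<omega> and for a block t of norm at most 1.\<close>

definition critical_function :: "real \<Rightarrow> real ^ 'm ^ 'n \<Rightarrow> real" where
  "critical_function \<alpha> x =
     (if real CARD('n) \<le> norm x \<and> near_line (real CARD('n)) x then norm x powr (- \<alpha>) / (1 + ln (norm x)) else 0)"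

lemma critical_function_measurable: "critical_function \<alpha> \<in> borel_measurable borel"
proof -
  have "closed ({x :: real ^ 'm ^ 'n. real CARD('n) \<le> norm x} \<inter> {x. near_line (real CARD('n)) x})"
    by (intro closed_Int closed_near_line closed_Collect_le continuous_intros)
  from borel_closed[OF this]
  have s: "{x \<in> space borel. real CARD('n) \<le> norm x \<and> near_line (real CARD('n)) x} \<in> sets (borel :: (real ^ 'm ^ 'n) measure)"
    by (simp add: Int_def)
  show ?thesis
    unfolding critical_function_def[abs_def] by (rule measurable_If[OF _ _ s]) measurable
qed

lemma critical_function_nonneg: "0 \<le> critical_function \<alpha> (x :: real ^ 'm ^ 'n)"
proof -
  have "0 \<le> ln (norm x)" if "real CARD('n) \<le> norm x"
    using that one_le_card_finite[where 'a='n] by (intro ln_ge_zero) linarith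
  then show ?thesis by (simp add: critical_function_def)
qed

lemma critical_function_orthogonal:
  assumes "orthogonal_matrix \<gamma>"
  shows "critical_function \<alpha> (\<gamma> ** x) = critical_function \<alpha> x"
  unfolding critical_function_def near_line_orthogonal[OF assms] norm_orthogonal_matrix_mult_matrix[OF assms] ..

text \<open>Summing over the possible longest rows i dominates the function. Each summand
  \<open>F i\<close> is integrated by \<open>nn_integral_row_tubes\<close> and leaves the convergent
  logarithmic integral in m dimensions.\<close>

lemma critical_function_powr_integrable:
  assumes p: "1 < p" and \<alpha>: "\<alpha> = (real CARD('n) + real CARD('m) - 1) / p"
  shows "(\<integral>\<^sup>+x. ennreal (critical_function \<alpha> (x :: real ^ 'm ^ 'n) powr p) \<partial>lborel) < \<infinity>"
proof -
  let ?n = "real CARD('n)" and ?m = "real CARD('m)"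
  let ?\<phi> = "\<lambda>s. s powr (- (\<alpha> * p)) * (1 + ln s) powr (- p)"
  have n1: "1 \<le> ?n" using one_le_card_finite[where 'a='n] by simp
  have ap: "\<alpha> * p = ?n + ?m - 1" using p by (simp add: \<alpha>)
  have ap0: "0 \<le> \<alpha> * p" unfolding ap using n1 of_nat_0_le_iff[of "CARD('m)"] by linarith
  define h where "h r = ennreal (?\<phi> (norm r)) * indicator {r. 1 \<le> norm r} r" for r :: "real ^ 'm"
  have hm: "h \<in> borel_measurable borel" unfolding h_def by measurable
  define F where "F i x = h (x $ i) * (\<Prod>a\<in>UNIV - {i}. if x $ a \<in> tube 1 (5 * ?n) (x $ i) then 1 else 0)" for i and x :: "real ^ 'm ^ 'n"
  have nth: "(\<lambda>x :: real ^ 'm ^ 'n. x $ a) \<in> borel_measurable borel" for a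
    by (rule borel_measurable_vec_nth) simp
  have Fm: "F i \<in> borel_measurable borel" for i
    unfolding F_def by (intro borel_measurable_times_ennreal borel_measurable_prod_ennreal borel_measurable_tube measurable_compose[OF _ hm] nth)
  have le: "ennreal (critical_function \<alpha> x powr p) \<le> (\<Sum>i\<in>UNIV. F i x)" for x :: "real ^ 'm ^ 'n"
  proof (cases "?n \<le> norm x \<and> near_line ?n x")
    case True
    then obtain i where i: "1 \<le> norm (x $ i)" "\<And>a. x $ a \<in> tube 1 (5 * ?n) (x $ i)"
      using near_line_rows[of ?n x] by blast
    have ix: "norm (x $ i) \<le> norm x" by (rule Finite_Cartesian_Product.norm_nth_le)
    have l: "0 \<le> ln (norm (x $ i))" using i(1) by (rule ln_ge_zero)
    have "0 < norm (x $ i)" "0 < norm x" using i(1) ix by linarith+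
    then have ll: "ln (norm (x $ i)) \<le> ln (norm x)" using ix by (simp only: ln_le_cancel_iff)
    have "critical_function \<alpha> x powr p = (norm x powr (- \<alpha>)) powr p / (1 + ln (norm x)) powr p"
      using True by (simp only: critical_function_def simp_thms if_True powr_divide)
    also have "\<dots> = ?\<phi> (norm x)"
      by (simp only: powr_powr powr_minus[of "1 + ln (norm x)" p] divide_inverse mult_minus_left)
    also have "\<dots> \<le> ?\<phi> (norm (x $ i))"
    proof (intro mult_mono powr_mono2')
      show "0 < 1 + ln (norm (x $ i))" using l by linarith
    qed (use i(1) ix l ll ap0 p in auto)
    finally have "ennreal (critical_function \<alpha> x powr p) \<le> F i x"
      using i by (simp add: F_def h_def ennreal_leI)
    also have "\<dots> \<le> (\<Sum>i\<in>UNIV. F i x)" by (rule member_le_sum) auto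
    finally show ?thesis .
  qed (auto simp: critical_function_def)
  obtain K where K: "0 \<le> K" "\<And>r :: real ^ 'm. r \<noteq> 0 \<Longrightarrow> emeasure lborel (tube 1 (5 * ?n) r) \<le> ennreal (K * norm r)"
    using tube_volume_le[of 1 "5 * ?n", where 'm='m] by auto
  have Fi: "(\<integral>\<^sup>+x. F i x \<partial>lborel) < \<infinity>" for i
  proof -
    let ?g = "\<lambda>r :: real ^ 'm. ennreal (norm r powr (- real DIM(real ^ 'm)) * (1 + ln (norm r)) powr (- p)) * indicator {r. 1 \<le> norm r} r"
    have "(\<integral>\<^sup>+x. F i x \<partial>lborel) = (\<integral>\<^sup>+r. h r * emeasure lborel (tube 1 (5 * ?n) r) ^ (CARD('n) - 1) \<partial>lborel)"
      unfolding F_def by (rule nn_integral_row_tubes[OF hm])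
    also have "\<dots> \<le> (\<integral>\<^sup>+r. ennreal (K ^ (CARD('n) - 1)) * ?g r \<partial>lborel)"
    proof (rule nn_integral_mono)
      fix r :: "real ^ 'm"
      show "h r * emeasure lborel (tube 1 (5 * ?n) r) ^ (CARD('n) - 1) \<le> ennreal (K ^ (CARD('n) - 1)) * ?g r"
      proof (cases "1 \<le> norm r")
        case True
        then have r0: "r \<noteq> 0" "0 < norm r" by auto
        have "h r * emeasure lborel (tube 1 (5 * ?n) r) ^ (CARD('n) - 1)
            \<le> ennreal (?\<phi> (norm r)) * ennreal (K * norm r) ^ (CARD('n) - 1)"
          using True K(2)[OF r0(1)] by (auto simp: h_def intro!: mult_left_mono power_mono)
        also have "\<dots> = ennreal (?\<phi> (norm r) * (K * norm r) ^ (CARD('n) - 1))"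
        proof -
          have "ennreal (K * norm r) ^ (CARD('n) - 1) = ennreal ((K * norm r) ^ (CARD('n) - 1))"
            using K(1) by (intro ennreal_power) simp
          then show ?thesis
            by (simp only: ennreal_mult''[OF zero_le_power[OF mult_nonneg_nonneg[OF K(1) norm_ge_zero]]])
        qed
        also have "?\<phi> (norm r) * (K * norm r) ^ (CARD('n) - 1)
            = K ^ (CARD('n) - 1) * ((norm r powr (- (\<alpha> * p)) * norm r ^ (CARD('n) - 1)) * (1 + ln (norm r)) powr (- p))"
          by (simp only: power_mult_distrib mult_ac)
        \<comment> \<open>\<alpha> * p is n + m - 1, and the n - 1 tubes give back n - 1 powers of
          \<open>norm r\<close>; the remaining exponent - m is critical in dimension m.\<close>
        also have "norm r powr (- (\<alpha> * p)) * norm r ^ (CARD('n) - 1) = norm r powr (- ?m)"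
        proof -
          have "norm r ^ (CARD('n) - 1) = norm r powr (?n - 1)"
            using r0(2) n1 by (simp add: powr_realpow[symmetric] of_nat_diff)
          then show ?thesis by (simp add: powr_add[symmetric] ap)
        qed
        finally show ?thesis using True K(1) by (simp add: ennreal_mult)
      qed (simp add: h_def)
    qed
    also have "\<dots> = ennreal (K ^ (CARD('n) - 1)) * (\<integral>\<^sup>+r. ?g r \<partial>lborel)"
      by (rule nn_integral_cmult) measurable
    also have "\<dots> < \<infinity>"
      using log_radial_nn_integral_finite[OF p, where 'a="real ^ 'm"] by (simp add: ennreal_mult_less_top)
    finally show ?thesis .
  qed
  have "(\<integral>\<^sup>+x. ennreal (critical_function \<alpha> (x :: real ^ 'm ^ 'n) powr p) \<partial>lborel) \<le> (\<integral>\<^sup>+x. (\<Sum>i\<in>UNIV. F i x) \<partial>lborel)"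
    by (intro nn_integral_mono le)
  also have "\<dots> = (\<Sum>i\<in>UNIV. \<integral>\<^sup>+x. F i x \<partial>lborel)"
    by (rule nn_integral_sum) (simp add: Fm)
  also have "\<dots> < \<infinity>" using Fi by simp
  finally show ?thesis .
qed

text \<open>The direction of row i serves as v. The rows of \<omega> contribute at most 1 each to
  the squared distance from the line, and the whole block t at most 1.\<close>

lemma near_line_stack_rows:
  fixes \<omega> :: "real ^ 'm ^ ('k::finite)" and t :: "real ^ 'm ^ ('l::finite)"
  assumes tube: "\<And>a. a \<noteq> i \<Longrightarrow> \<omega> $ a \<in> tube 1 1 (\<omega> $ i)" and r: "1 \<le> norm (\<omega> $ i)" and t: "norm t \<le> 1"
  shows "near_line (real CARD('k + 'l)) (stack_rows \<omega> t)"
    and "norm (\<omega> $ i) \<le> norm (stack_rows \<omega> t)"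
    and "norm (stack_rows \<omega> t) \<le> real CARD('k + 'l) * norm (\<omega> $ i)"
proof -
  let ?r = "\<omega> $ i" and ?x = "stack_rows \<omega> t"
  define v where "v = ?r /\<^sub>R norm ?r"
  have r0: "?r \<noteq> 0" using r by auto
  have v: "norm v = 1" using r0 by (simp add: v_def)
  have t2: "(norm t)\<^sup>2 \<le> 1" using power_mono[OF t, of 2] by simp
  have l1: "1 \<le> real CARD('l)" using one_le_card_finite[where 'a='l] by simp
  have tube': "\<omega> $ a \<in> tube 1 1 ?r" for a
    using tube[of a] by (cases "a = i") (auto simp: tube_def dot_square_norm power2_eq_square)
  have na: "norm (\<omega> $ a) \<le> norm ?r" for a using tube'[of a] by (simp add: tube_def)
  have da: "(norm (\<omega> $ a))\<^sup>2 - (\<omega> $ a \<bullet> v)\<^sup>2 \<le> 1" for a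
  proof -
    have "((norm (\<omega> $ a))\<^sup>2 - (\<omega> $ a \<bullet> v)\<^sup>2) * (norm ?r)\<^sup>2 = (norm (\<omega> $ a))\<^sup>2 * (norm ?r)\<^sup>2 - (\<omega> $ a \<bullet> ?r)\<^sup>2"
      using r0 by (simp add: v_def power_mult_distrib left_diff_distrib power_inverse)
    also have "\<dots> \<le> 1 * (norm ?r)\<^sup>2" using tube'[of a] by (simp add: tube_def)
    finally show ?thesis by (rule mult_right_le_imp_le) (use r0 in simp)
  qed
  have "(norm ?x)\<^sup>2 - (norm (?x *v v))\<^sup>2
     = (\<Sum>a\<in>UNIV. (norm (\<omega> $ a))\<^sup>2 - (\<omega> $ a \<bullet> v)\<^sup>2) + (\<Sum>b\<in>UNIV. (norm (t $ b))\<^sup>2 - (t $ b \<bullet> v)\<^sup>2)"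
    unfolding norm_power2_minus_matrix_vector sum_UNIV_Plus by (simp add: stack_rows_def)
  also have "\<dots> \<le> (\<Sum>a\<in>(UNIV :: 'k set). 1) + (\<Sum>b\<in>UNIV. (norm (t $ b))\<^sup>2)"
    by (intro add_mono sum_mono da) simp
  also have "\<dots> = real CARD('k) + (norm t)\<^sup>2" by (simp add: norm_vec_power2)
  also have "\<dots> \<le> real CARD('k) + real CARD('l)" using t2 l1 by linarith
  also have "\<dots> = real CARD('k + 'l)" by simp
  finally show "near_line (real CARD('k + 'l)) ?x"
    unfolding near_line_def using v by (intro exI[of _ v]) simp
  have "(?x $ Inl i) = ?r" by (simp add: stack_rows_def)
  then show "norm ?r \<le> norm ?x" using Finite_Cartesian_Product.norm_nth_le[of ?x "Inl i"] by simp
  have "(norm \<omega>)\<^sup>2 \<le> (\<Sum>a\<in>(UNIV :: 'k set). (norm ?r)\<^sup>2)"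
    unfolding norm_vec_power2[of \<omega>] by (intro sum_mono power_mono na) simp
  then have "(norm ?x)\<^sup>2 \<le> real CARD('k) * (norm ?r)\<^sup>2 + 1"
    unfolding norm_stack_rows using t2 by simp
  also have "\<dots> \<le> real CARD('k) * (norm ?r)\<^sup>2 + real CARD('l) * (norm ?r)\<^sup>2"
  proof -
    have "1 * 1 \<le> real CARD('l) * (norm ?r)\<^sup>2" using l1 r by (intro mult_mono one_le_power) auto
    then show ?thesis by simp
  qed
  also have "\<dots> = real CARD('k + 'l) * (norm ?r)\<^sup>2" by (simp add: distrib_right)
  also have "\<dots> \<le> (real CARD('k + 'l))\<^sup>2 * (norm ?r)\<^sup>2"
  proof (intro mult_right_mono self_le_power)
    have "real CARD('k + 'l) = real CARD('k) + real CARD('l)" by simp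
    then show "1 \<le> real CARD('k + 'l)" using l1 of_nat_0_le_iff[of "CARD('k)"] by linarith
  qed simp_all
  finally have "(norm ?x)\<^sup>2 \<le> (real CARD('k + 'l) * norm ?r)\<^sup>2" by (simp only: power_mult_distrib)
  then show "norm ?x \<le> real CARD('k + 'l) * norm ?r" by (rule power2_le_imp_le) simp
qed

section \<open>Divergence on the planes of integration\<close>

text \<open>Keep only those \<omega> whose rows lie in unit tubes around one row r. The k - 1 tubes
  contribute (norm r) ^ (k - 1), and with \<alpha> at most k + m - 1 at least the critical power - m
  remains, divided by a logarithm, so the integral diverges in m dimensions.\<close>

lemma critical_function_radon_infinite:
  fixes t :: "real ^ 'm ^ ('l::finite)"
  assumes \<alpha>: "\<alpha> \<le> real CARD('k::finite) + real CARD('m) - 1" "0 \<le> \<alpha>" and t: "norm t \<le> 1"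
  shows "(\<integral>\<^sup>+\<omega>. ennreal (critical_function \<alpha> (stack_rows (\<omega> :: real ^ 'm ^ 'k) t)) \<partial>lborel) = \<infinity>"
proof -
  let ?N = "real CARD('k + 'l)" and ?k = "real CARD('k)" and ?m = "real CARD('m)"
  let ?\<phi> = "\<lambda>s. s powr (- \<alpha>) / (1 + ln s)"
  have k1: "1 \<le> ?k" "1 \<le> real CARD('l)" using one_le_card_finite[where 'a='k] one_le_card_finite[where 'a='l] by simp_all
  moreover have "?N = ?k + real CARD('l)" by simp
  ultimately have N2: "2 \<le> ?N" by linarith
  obtain i :: 'k where True by blast
  \<comment> \<open>The decreasing profile is evaluated at N * norm r because the norm of the
    stacked matrix is at most that.\<close>
  define h where "h r = ennreal (?\<phi> (?N * norm r)) * indicator {r. ?N \<le> norm r} r" for r :: "real ^ 'm"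
  have hm: "h \<in> borel_measurable borel" unfolding h_def by measurable
  obtain c where c: "0 < c" "\<And>r :: real ^ 'm. 2 \<le> norm r \<Longrightarrow> ennreal (c * norm r) \<le> emeasure lborel (tube 1 1 r)"
    using tube_volume_ge[where 'm='m] by blast
  define C where "C = ?N powr (- \<alpha>) / (1 + ln ?N) * c ^ (CARD('k) - 1)"
  have lN: "0 \<le> ln ?N" using N2 by (intro ln_ge_zero) linarith
  have C: "0 < C"
    unfolding C_def
  proof (intro mult_pos_pos divide_pos_pos zero_less_power c(1))
    show "0 < ?N powr (- \<alpha>)" using N2 by simp
    show "0 < 1 + ln ?N" using lN by linarith
  qed
  let ?g = "\<lambda>r :: real ^ 'm. ennreal (norm r powr (- real DIM(real ^ 'm)) / (1 + ln (norm r))) * indicator {r. ?N \<le> norm r} r"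
  have "\<infinity> = ennreal C * (\<integral>\<^sup>+r. ?g r \<partial>lborel)"
    using log_radial_nn_integral_infinite[of ?N, where 'a="real ^ 'm"] C by (simp add: ennreal_mult_top)
  also have "\<dots> = (\<integral>\<^sup>+r. ennreal C * ?g r \<partial>lborel)"
    by (rule nn_integral_cmult[symmetric]) measurable
  also have "\<dots> \<le> (\<integral>\<^sup>+r. h r * emeasure lborel (tube 1 1 r) ^ (CARD('k) - 1) \<partial>lborel)"
  proof (rule nn_integral_mono)
    fix r :: "real ^ 'm"
    show "ennreal C * ?g r \<le> h r * emeasure lborel (tube 1 1 r) ^ (CARD('k) - 1)"
    proof (cases "?N \<le> norm r")
      case True
      then have r2: "2 \<le> norm r" using N2 by linarith
      then have r0: "0 < norm r" by linarith
      have lr: "0 \<le> ln (norm r)" using r2 by (intro ln_ge_zero) linarith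
      have "C * (norm r powr (- ?m) / (1 + ln (norm r)))
         = (?N powr (- \<alpha>) * (norm r powr (- ?m) * (c ^ (CARD('k) - 1)))) * (1 / ((1 + ln ?N) * (1 + ln (norm r))))"
        by (simp add: C_def)
      also have "\<dots> \<le> (?N powr (- \<alpha>) * (norm r powr (- \<alpha>) * (c * norm r) ^ (CARD('k) - 1))) * (1 / (1 + ln (?N * norm r)))"
      proof (rule mult_mono, rule mult_left_mono)
        have "norm r powr (- ?m) = norm r powr (- (?k + ?m - 1)) * norm r powr (?k - 1)"
          by (simp add: powr_add[symmetric])
        also have "norm r powr (?k - 1) = norm r ^ (CARD('k) - 1)"
          using r0 k1 by (simp add: powr_realpow[symmetric] of_nat_diff)
        also have "norm r powr (- (?k + ?m - 1)) * norm r ^ (CARD('k) - 1) \<le> norm r powr (- \<alpha>) * norm r ^ (CARD('k) - 1)"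
          using \<alpha>(1) r2 by (intro mult_right_mono powr_mono) auto
        finally have "norm r powr (- ?m) \<le> norm r powr (- \<alpha>) * norm r ^ (CARD('k) - 1)" .
        then have "norm r powr (- ?m) * (c ^ (CARD('k) - 1)) \<le> norm r powr (- \<alpha>) * norm r ^ (CARD('k) - 1) * (c ^ (CARD('k) - 1))"
          using c(1) by (intro mult_right_mono) auto
        then show "norm r powr (- ?m) * (c ^ (CARD('k) - 1)) \<le> norm r powr (- \<alpha>) * (c * norm r) ^ (CARD('k) - 1)"
          by (simp add: power_mult_distrib mult_ac)
        have ln: "ln (?N * norm r) = ln ?N + ln (norm r)" using N2 r0 by (intro ln_mult_pos) linarith+
        \<comment> \<open>Separates the rescaling by N from the logarithm, so that it only affects
          the constant \<open>C\<close>.\<close>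
        have "1 + ln (?N * norm r) \<le> (1 + ln ?N) * (1 + ln (norm r))"
          unfolding ln using mult_nonneg_nonneg[OF lN lr] by (simp add: algebra_simps)
        moreover have "0 < 1 + ln (?N * norm r)" unfolding ln using lN lr by linarith
        ultimately show "1 / ((1 + ln ?N) * (1 + ln (norm r))) \<le> 1 / (1 + ln (?N * norm r))"
          by (intro frac_le) auto
        show "0 \<le> 1 / ((1 + ln ?N) * (1 + ln (norm r)))" using lN lr by simp
      qed (use c(1) in auto)
      also have "\<dots> = ?\<phi> (?N * norm r) * (c * norm r) ^ (CARD('k) - 1)"
        using N2 r0 by (simp add: powr_mult)
      finally have "ennreal (C * (norm r powr (- ?m) / (1 + ln (norm r)))) \<le> ennreal (?\<phi> (?N * norm r) * (c * norm r) ^ (CARD('k) - 1))"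
        by (rule ennreal_leI)
      also have "\<dots> = ennreal (?\<phi> (?N * norm r)) * ennreal (c * norm r) ^ (CARD('k) - 1)"
        using c(1) by (subst ennreal_mult'') (simp_all add: ennreal_power)
      also have "\<dots> \<le> ennreal (?\<phi> (?N * norm r)) * emeasure lborel (tube 1 1 r) ^ (CARD('k) - 1)"
        by (intro mult_left_mono power_mono c(2)[OF r2]) auto
      finally show ?thesis using True C by (simp add: h_def ennreal_mult' del: times_divide_eq_right)
    qed simp
  qed
  also have "\<dots> = (\<integral>\<^sup>+\<omega>. h (\<omega> $ i) * (\<Prod>a\<in>UNIV - {i}. if \<omega> $ a \<in> tube 1 1 (\<omega> $ i) then 1 else 0) \<partial>(lborel :: (real ^ 'm ^ 'k) measure))"
    by (rule nn_integral_row_tubes[OF hm, symmetric])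
  also have "\<dots> \<le> (\<integral>\<^sup>+\<omega>. ennreal (critical_function \<alpha> (stack_rows (\<omega> :: real ^ 'm ^ 'k) t)) \<partial>lborel)"
  proof (rule nn_integral_mono)
    fix \<omega> :: "real ^ 'm ^ 'k"
    let ?x = "stack_rows \<omega> t"
    show "h (\<omega> $ i) * (\<Prod>a\<in>UNIV - {i}. if \<omega> $ a \<in> tube 1 1 (\<omega> $ i) then 1 else 0) \<le> ennreal (critical_function \<alpha> ?x)"
    proof (cases "?N \<le> norm (\<omega> $ i) \<and> (\<forall>a. a \<noteq> i \<longrightarrow> \<omega> $ a \<in> tube 1 1 (\<omega> $ i))")
      case True
      then have r1: "1 \<le> norm (\<omega> $ i)" using N2 by linarith
      note near = near_line_stack_rows[OF _ r1 t]
      have n: "near_line ?N ?x" "norm (\<omega> $ i) \<le> norm ?x" "norm ?x \<le> ?N * norm (\<omega> $ i)"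
        by (rule near; use True in blast)+
      have x1: "1 \<le> norm ?x" using n(2) r1 by linarith
      have l: "0 \<le> ln (norm ?x)" using x1 by (rule ln_ge_zero)
      have "0 < norm ?x" "0 < ?N * norm (\<omega> $ i)" using x1 n(3) by linarith+
      then have ll: "ln (norm ?x) \<le> ln (?N * norm (\<omega> $ i))" using n(3) by (simp only: ln_le_cancel_iff)
      have "?\<phi> (?N * norm (\<omega> $ i)) \<le> ?\<phi> (norm ?x)"
      proof (rule frac_le)
        show "(?N * norm (\<omega> $ i)) powr (- \<alpha>) \<le> norm ?x powr (- \<alpha>)"
          using x1 n(3) \<alpha>(2) by (intro powr_mono2') auto
      qed (use l ll in auto)
      then have "ennreal (?\<phi> (?N * norm (\<omega> $ i))) \<le> ennreal (critical_function \<alpha> ?x)"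
        using n True by (intro ennreal_leI) (simp add: critical_function_def)
      moreover have "(\<Prod>a\<in>UNIV - {i}. if \<omega> $ a \<in> tube 1 1 (\<omega> $ i) then 1 else 0 :: ennreal) = 1"
        using True by (intro prod.neutral) auto
      ultimately show ?thesis using True by (simp add: h_def)
    next
      case False
      have "h (\<omega> $ i) * (\<Prod>a\<in>UNIV - {i}. if \<omega> $ a \<in> tube 1 1 (\<omega> $ i) then 1 else 0) = 0"
      proof (cases "?N \<le> norm (\<omega> $ i)")
        case True
        then obtain a where "a \<noteq> i" "\<omega> $ a \<notin> tube 1 1 (\<omega> $ i)" using False by blast
        then have "(\<Prod>a\<in>UNIV - {i}. if \<omega> $ a \<in> tube 1 1 (\<omega> $ i) then 1 else 0 :: ennreal) = 0"
          by (intro prod_zero) auto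
        then show ?thesis by simp
      qed (simp add: h_def)
      then show ?thesis by (simp only: zero_le)
    qed
  qed
  finally show ?thesis by (simp add: top_unique)
qed

text \<open>P fails on the product of the Stiefel manifold and the unit ball, which has positive
  measure. P itself may be nonmeasurable, so the contradiction is drawn from a measurable null set
  that covers its failures.\<close>

lemma radon_not_AE:
  fixes \<mu> :: "(real ^ 'l ^ ('k::finite + 'l::finite)) measure" and P :: "_ \<Rightarrow> real ^ 'm ^ 'l \<Rightarrow> bool"
  assumes \<mu>: "stiefel_invariant_measure \<mu>" and P: "\<And>\<xi> t. \<xi> \<in> stiefel \<Longrightarrow> norm t \<le> 1 \<Longrightarrow> \<not> P \<xi> t"
  shows "\<not> (AE (\<xi>, t) in \<mu> \<Otimes>\<^sub>M (lebesgue :: (real ^ 'm ^ 'l) measure). P \<xi> t)"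
proof
  let ?M = "\<mu> \<Otimes>\<^sub>M (lebesgue :: (real ^ 'm ^ 'l) measure)"
  interpret leb: sigma_finite_measure "lebesgue :: (real ^ 'm ^ 'l) measure" by (rule sigma_finite_lebesgue)
  note sp = stiefel_measure_space[OF \<mu>]
  assume "AE (\<xi>, t) in ?M. P \<xi> t"
  then obtain N where N: "{x \<in> space ?M. \<not> (case x of (\<xi>, t) \<Rightarrow> P \<xi> t)} \<subseteq> N" "emeasure ?M N = 0" "N \<in> sets ?M"
    by (rule AE_E)
  have sub: "space \<mu> \<times> cball 0 1 \<subseteq> N"
    using P N(1) by (auto simp: space_pair_measure sp)
  have "emeasure ?M (space \<mu> \<times> cball 0 1) \<le> emeasure ?M N"
    using sub N(3) by (rule emeasure_mono)
  moreover have "emeasure ?M (space \<mu> \<times> cball 0 1) = emeasure \<mu> (space \<mu>) * emeasure lebesgue (cball (0 :: real ^ 'm ^ 'l) 1)"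
    by (rule leb.emeasure_pair_measure_Times) auto
  moreover have "emeasure \<mu> (space \<mu>) \<noteq> 0"
    using \<mu> by (simp add: stiefel_invariant_measure_def sp)
  moreover have "emeasure lebesgue (cball (0 :: real ^ 'm ^ 'l) 1) \<noteq> 0"
    by (auto simp: emeasure_cball unit_ball_vol_pos less_imp_neq ennreal_eq_0_iff not_le)
  ultimately show False using N(2) by simp
qed

text \<open>Rotation invariance removes \<open>g \<xi>\<close> from the integrand, so the divergence
  at the standard plane holds at every frame.\<close>

lemma critical_function_not_radon_finite:
  fixes g :: "real ^ 'l ^ ('k::finite + 'l::finite) \<Rightarrow> real ^ ('k + 'l) ^ ('k + 'l)" and t :: "real ^ 'm ^ 'l"
  assumes g: "rotation_choice g" and \<alpha>: "\<alpha> \<le> real CARD('k) + real CARD('m) - 1" "0 \<le> \<alpha>"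
    and \<xi>: "\<xi> \<in> stiefel" and t: "norm t \<le> 1"
  shows "\<not> radon_finite g (\<lambda>x. complex_of_real (critical_function \<alpha> x)) \<xi> t"
proof
  assume "radon_finite g (\<lambda>x. complex_of_real (critical_function \<alpha> x)) \<xi> t"
  then have "(\<integral>\<^sup>+\<omega>. ennreal (norm (complex_of_real (critical_function \<alpha> (g \<xi> ** stack_rows (\<omega> :: real ^ 'm ^ 'k) t)))) \<partial>lebesgue) < \<infinity>"
    by (simp only: radon_finite_def radon_integrand_def[abs_def] integrable_iff_bounded)
  then have "(\<integral>\<^sup>+\<omega>. ennreal (critical_function \<alpha> (stack_rows (\<omega> :: real ^ 'm ^ 'k) t)) \<partial>lborel) < \<infinity>"
    by (simp only: nn_integral_completion norm_of_real abs_of_nonneg[OF critical_function_nonneg]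
        critical_function_orthogonal[OF rotation_choice_orthogonal(1)[OF g \<xi>]])
  then show False by (simp add: critical_function_radon_infinite[OF \<alpha> t])
qed

section \<open>Both directions combined\<close>

theorem theorem4p27:
  fixes n m k :: nat
    and p :: ereal
    and \<mu> :: "(real ^ 'l ^ ('k::finite + 'l::finite)) measure"
    and g :: "real ^ 'l ^ ('k + 'l) \<Rightarrow> real ^ ('k + 'l) ^ ('k + 'l)"
  assumes "n = CARD('k + 'l)" and "k = CARD('k)" and "m = CARD('m::finite)"
    and "m \<le> n"
    and "1 \<le> p" and "p \<le> \<infinity>"
    and "stiefel_invariant_measure \<mu>"
    and "rotation_choice g"
  shows "(\<forall>f \<in> Lp_space p (lebesgue :: (real ^ 'm ^ ('k + 'l)) measure).
            AE (\<xi>, t) in \<mu> \<Otimes>\<^sub>M (lebesgue :: (real ^ 'm ^ 'l) measure). radon_finite g f \<xi> t)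
         \<longleftrightarrow> 1 \<le> p \<and> p < ereal ((real n + real m - 1) / (real k + real m - 1))"
proof -
  note \<mu> = \<open>stiefel_invariant_measure \<mu>\<close> and g = \<open>rotation_choice g\<close>
  have k1: "1 \<le> real k" and m1: "1 \<le> real m" and l1: "1 \<le> real CARD('l)"
    using one_le_card_finite[where 'a='k] one_le_card_finite[where 'a='m] one_le_card_finite[where 'a='l]
    unfolding assms(2,3) by simp_all
  have n: "real n = real k + real CARD('l)" by (simp add: assms(1,2))
  have pos: "0 < real k + real m - 1" using k1 m1 by linarith
  have iff: "r < (real n + real m - 1) / (real k + real m - 1) \<longleftrightarrow> r * (real k + real m - 1) < real n + real m - 1" for r
    using pos by (simp only: pos_less_divide_eq)
  show ?thesis
  proof (intro iffI conjI ballI)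
    assume L: "\<forall>f \<in> Lp_space p (lebesgue :: (real ^ 'm ^ ('k + 'l)) measure).
            AE (\<xi>, t) in \<mu> \<Otimes>\<^sub>M (lebesgue :: (real ^ 'm ^ 'l) measure). radon_finite g f \<xi> t"
    have bad: False
      if "f \<in> Lp_space p (lebesgue :: (real ^ 'm ^ ('k + 'l)) measure)"
        "\<And>\<xi> t. \<xi> \<in> stiefel \<Longrightarrow> norm t \<le> 1 \<Longrightarrow> \<not> radon_finite g f \<xi> (t :: real ^ 'm ^ 'l)" for f
      using L that(1) radon_not_AE[OF \<mu>, of "radon_finite g f", OF that(2)] by blast
    show "p < ereal ((real n + real m - 1) / (real k + real m - 1))"
    proof (rule ccontr)
      assume np: "\<not> p < ereal ((real n + real m - 1) / (real k + real m - 1))"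
      show False
      proof (cases p)
        \<comment> \<open>The constant 1 is bounded, but its integral over any plane is
          infinite.\<close>
        case PInf
        show False
        proof (rule bad)
          show "(\<lambda>x. 1) \<in> Lp_space p (lebesgue :: (real ^ 'm ^ ('k + 'l)) measure)"
            using PInf by (auto simp: Lp_space_def intro!: exI[of _ 1])
          show "\<not> radon_finite g (\<lambda>x. 1) \<xi> t" for \<xi> and t :: "real ^ 'm ^ 'l"
            by (simp add: radon_finite_def radon_integrand_def[abs_def] integrable_iff_bounded)
        qed
      next
        case MInf
        then show False using \<open>1 \<le> p\<close> by simp
      next
        case (real r)
        then have "real n + real m - 1 \<le> r * (real k + real m - 1)"
          using np iff[of r] by auto
        \<comment> \<open>Because n > k the critical exponent exceeds 1, so any failing r lies
          strictly above 1, as the logarithmic factor requires.\<close>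
        moreover have "1 * (real k + real m - 1) < real n + real m - 1" using n l1 by simp
        ultimately have r: "real n + real m - 1 \<le> r * (real k + real m - 1)" "1 < r"
          using pos by (simp, metis less_le_trans mult_less_cancel_right_pos)
        \<comment> \<open>This decay is critical for r-integrability on the whole space; failure of
          the exponent condition says that it is no faster than the critical decay k + m - 1 on the
          planes.\<close>
        define \<alpha> where "\<alpha> = (real n + real m - 1) / r"
        have \<alpha>: "\<alpha> \<le> real k + real m - 1" "0 \<le> \<alpha>"
          using r k1 m1 n l1 by (simp_all add: \<alpha>_def divide_le_eq mult.commute)
        let ?f = "\<lambda>x :: real ^ 'm ^ ('k + 'l). complex_of_real (critical_function \<alpha> x)"
        have cm: "(critical_function \<alpha> :: real ^ 'm ^ ('k + 'l) \<Rightarrow> real) \<in> borel_measurable borel"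
          by (rule critical_function_measurable)
        show False
        proof (rule bad)
          have "?f \<in> borel_measurable lebesgue"
            using cm by (intro measurable_completion) simp
          moreover have "integrable lebesgue (\<lambda>x :: real ^ 'm ^ ('k + 'l). norm (?f x) powr r)"
          proof -
            have fm: "(\<lambda>x :: real ^ 'm ^ ('k + 'l). critical_function \<alpha> x powr r) \<in> borel_measurable lborel"
              using cm by simp
            have "integrable lborel (\<lambda>x :: real ^ 'm ^ ('k + 'l). critical_function \<alpha> x powr r)"
              using fm critical_function_powr_integrable[OF r(2), of \<alpha>, where 'n="'k + 'l" and 'm='m]
              by (intro integrableI_nonneg) (simp_all add: \<alpha>_def assms(1,3))
            then have "integrable lebesgue (\<lambda>x :: real ^ 'm ^ ('k + 'l). critical_function \<alpha> x powr r)"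
              using integrable_completion[OF fm] by simp
            then show ?thesis by (simp only: norm_of_real abs_of_nonneg[OF critical_function_nonneg])
          qed
          ultimately show "?f \<in> Lp_space p lebesgue"
            using real by (simp add: Lp_space_def)
          show "\<not> radon_finite g ?f \<xi> t" if "\<xi> \<in> stiefel" "norm t \<le> 1" for \<xi> and t :: "real ^ 'm ^ 'l"
            using critical_function_not_radon_finite[OF g _ _ that] \<alpha> unfolding assms(2,3) by blast
        qed
      qed
    qed
  next
    fix f assume f: "f \<in> Lp_space p (lebesgue :: (real ^ 'm ^ ('k + 'l)) measure)"
      and p: "1 \<le> p \<and> p < ereal ((real n + real m - 1) / (real k + real m - 1))"
    obtain r where r: "p = ereal r" using p by (cases p) auto
    have r1: "1 \<le> r" using p by (simp add: r)
    have r2: "r * (real CARD('k) + real CARD('m) - 1) < real CARD('k) + real CARD('l) + real CARD('m) - 1"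
      using p iff[of r] n by (simp add: r assms(2,3))
    show "AE (\<xi>, t) in \<mu> \<Otimes>\<^sub>M (lebesgue :: (real ^ 'm ^ 'l) measure). radon_finite g f \<xi> t"
      using f by (intro radon_AE_finite_Lp[OF \<mu> g r1 r2]) (simp_all add: Lp_space_def r)
  qed (rule \<open>1 \<le> p\<close>)
qed

end
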